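(* Let $A\in\mathbb M_n(\mathbb C)$ with $n\ge2$, and let $\Omega\subset\mathbb C$ be a bounded open simply connected set with piecewise smooth boundary such that $\Omega$ contains the set of eigenvalues $\sigma(A)$. Let $\varphi\in C^{n-1}(\overline\Omega)$. Then the matrix $\varphi(A)$ defined by Hermite interpolation (see context) is given by $$\varphi(A)=\frac{1}{2\pi i}\int_{\partial\Omega}\varphi(\zeta)(\zeta I-A)^{-1}\,d\zeta+\frac{1}{2\pi i}\int_{\Omega}\overline\partial\varphi(\zeta)\,(\zeta I-A)^{-1}\,d\zeta\wedge d\overline\zeta .$$ Here the area integral is understood as $\lim_{r\to0}$ of the integral over $\Omega$ with the open discs of radius $r$ centered at the eigenvalues of $A$ removed.
   Context: With $\zeta=\xi+i\eta$: $\partial=\frac12\left(\frac{\partial}{\partial\xi}-i\frac{\partial}{\partial\eta}\right)$, $\overline\partial=\frac12\left(\frac{\partial}{\partial\xi}+i\frac{\partial}{\partial\eta}\right)$, and $d\zeta\wedge d\overline\zeta=-2i\,d\xi\,d\eta$; $\partial\Omega$ as a contour is positively oriented. $C^{k}(\overline\Omega)$ denotes complex-valued functions with continuous partial derivatives up to order $k$ on $\overline\Omega$. Definition of $\varphi(A)$: let $m_A(z)=\prod_{j=1}^N(z-\lambda_j)^{1+n_j}$ (with distinct $\lambda_j$) be the minimal polynomial of $A$, and suppose $\varphi$ is $C^{n_j}$ in some closed disc of positive radius around $\lambda_j$, for each $j$. Let $p$ be the Hermite interpolation polynomial satisfying $p^{(\nu)}(\lambda_j)=\partial^\nu\varphi(\lambda_j)$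 for $\nu=0,\dots,n_j$ and $j=1,\dots,N$. Then $\varphi(A):=p(A)$. *)

theory Defs
  imports
    "HOL-Complex_Analysis.Complex_Analysis"
    "HOL-Computational_Algebra.Polynomial"
begin

section \<open>Wirtinger derivatives and $C^k(\overline\Omega)$\<close>

text \<open>Only the values of f near z matter, so for an open \<open>\<Omega>\<close> the derivatives at points of
  \<open>\<Omega>\<close> do not depend on how f is extended beyond \<open>\<Omega>\<close>.\<close>

definition partial_xi :: "(complex \<Rightarrow> complex) \<Rightarrow> complex \<Rightarrow> complex" where
  "partial_xi f z = vector_derivative (\<lambda>t::real. f (z + of_real t)) (at 0)"

definition partial_eta :: "(complex \<Rightarrow> complex) \<Rightarrow> complex \<Rightarrow> complex" where
  "partial_eta f z = vector_derivative (\<lambda>t::real. f (z + \<i> * of_real t)) (at 0)"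

definition wirtinger :: "(complex \<Rightarrow> complex) \<Rightarrow> complex \<Rightarrow> complex" where
  "wirtinger f z = (partial_xi f z - \<i> * partial_eta f z) / 2"

definition wirtinger_bar :: "(complex \<Rightarrow> complex) \<Rightarrow> complex \<Rightarrow> complex" where
  "wirtinger_bar f z = (partial_xi f z + \<i> * partial_eta f z) / 2"

text \<open>\<open>C_closure k \<Omega> f\<close>: on the open set \<open>\<Omega>\<close> all partial derivatives of f of order at most k
  exist, and each of them extends continuously to the closure of \<open>\<Omega>\<close> (f itself being
  continuous there). The functions \<open>fx\<close> and \<open>fy\<close> are the extensions of the first partial
  derivatives.\<close>

primrec C_closure :: "nat \<Rightarrow> complex set \<Rightarrow> (complex \<Rightarrow> complex) \<Rightarrow> bool" where
  "C_closure 0 \<Omega> f \<longleftrightarrow> continuous_on (closure \<Omega>) f"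
| "C_closure (Suc k) \<Omega> f \<longleftrightarrow>
     continuous_on (closure \<Omega>) f \<and>
     (\<exists>fx fy.
        (\<forall>z\<in>\<Omega>. ((\<lambda>t::real. f (z + of_real t)) has_vector_derivative fx z) (at 0)) \<and>
        (\<forall>z\<in>\<Omega>. ((\<lambda>t::real. f (z + \<i> * of_real t)) has_vector_derivative fy z) (at 0)) \<and>
        C_closure k \<Omega> fx \<and> C_closure k \<Omega> fy)"


section \<open>Piecewise smooth, positively oriented boundaries\<close>

text \<open>On each closed piece the derivative (one-sided at the ends) exists, is continuous and does
  not vanish. This is stronger than \<^const>\<open>valid_path\<close>, which neither requires the derivative to
  extend to the break points nor excludes zeros of the derivative.\<close>

definition piecewise_smooth_path :: "(real \<Rightarrow> complex) \<Rightarrow> bool" where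
  "piecewise_smooth_path g \<longleftrightarrow>
     (\<exists>(m::nat) (t::nat \<Rightarrow> real).
        t 0 = 0 \<and> t m = 1 \<and>
        (\<forall>k<m. t k < t (Suc k) \<and>
          (\<exists>D. continuous_on {t k..t (Suc k)} D \<and>
             (\<forall>x\<in>{t k..t (Suc k)}. D x \<noteq> 0 \<and>
                (g has_vector_derivative D x) (at x within {t k..t (Suc k)})))))"

text \<open>\<open>\<gamma>\<close> parametrises the boundary of the (simply connected) set \<open>\<Omega>\<close> as a piecewise smooth Jordan
  curve; winding number 1 around the points of \<open>\<Omega>\<close> is the positive orientation.\<close>

definition positively_oriented_boundary :: "(real \<Rightarrow> complex) \<Rightarrow> complex set \<Rightarrow> bool" where
  "positively_oriented_boundary \<gamma> \<Omega> \<longleftrightarrow>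
     piecewise_smooth_path \<gamma> \<and> simple_path \<gamma> \<and> pathfinish \<gamma> = pathstart \<gamma> \<and>
     path_image \<gamma> = frontier \<Omega> \<and> (\<forall>z\<in>\<Omega>. winding_number \<gamma> z = 1)"


section \<open>Matrix functions by Hermite interpolation\<close>

definition cscale :: "complex \<Rightarrow> complex ^ 'n ^ 'm \<Rightarrow> complex ^ 'n ^ 'm" (infixr "*\<^sub>c" 75) where
  "c *\<^sub>c M = (\<chi> i j. c * M $ i $ j)"

definition eigenvalues :: "complex ^ 'n ^ 'n \<Rightarrow> complex set" where
  "eigenvalues A = {l. \<exists>v. v \<noteq> 0 \<and> A *v v = l *s v}"

text \<open>The type of square matrices carries the componentwise product, so the class-based power
  cannot be used for matrix powers.\<close>

primrec matrix_pow :: "complex ^ 'n ^ 'n \<Rightarrow> nat \<Rightarrow> complex ^ 'n ^ 'n" where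
  "matrix_pow A 0 = mat 1"
| "matrix_pow A (Suc k) = A ** matrix_pow A k"

definition poly_matrix :: "complex poly \<Rightarrow> complex ^ 'n ^ 'n \<Rightarrow> complex ^ 'n ^ 'n" where
  "poly_matrix p A = (\<Sum>k\<le>degree p. coeff p k *\<^sub>c matrix_pow A k)"

definition minimal_polynomial :: "complex ^ 'n ^ 'n \<Rightarrow> complex poly" where
  "minimal_polynomial A =
     (THE m. lead_coeff m = 1 \<and> poly_matrix m A = 0 \<and>
        (\<forall>q. q \<noteq> 0 \<and> poly_matrix q A = 0 \<longrightarrow> degree m \<le> degree q))"

text \<open>The number \<open>1 + n\<^sub>j\<close> is the order of \<open>\<lambda>\<^sub>j\<close> as a root of the minimal polynomial, so
  \<open>\<nu> \<le> n\<^sub>j\<close> reads \<open>\<nu> < order \<lambda>\<^sub>j m\<close>. The degree bound singles out the interpolation polynomial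
  among all solutions of the interpolation conditions.\<close>

definition hermite_interpolant ::
    "(complex \<Rightarrow> complex) \<Rightarrow> complex ^ 'n ^ 'n \<Rightarrow> complex poly" where
  "hermite_interpolant \<phi> A =
     (THE p. degree p < degree (minimal_polynomial A) \<and>
        (\<forall>l. poly (minimal_polynomial A) l = 0 \<longrightarrow>
          (\<forall>\<nu> < order l (minimal_polynomial A).
             poly ((pderiv ^^ \<nu>) p) l = (wirtinger ^^ \<nu>) \<phi> l)))"

definition matrix_function ::
    "(complex \<Rightarrow> complex) \<Rightarrow> complex ^ 'n ^ 'n \<Rightarrow> complex ^ 'n ^ 'n" where
  "matrix_function \<phi> A = poly_matrix (hermite_interpolant \<phi> A) A"

definition resolvent :: "complex ^ 'n ^ 'n \<Rightarrow> complex \<Rightarrow> complex ^ 'n ^ 'n" where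
  "resolvent A \<zeta> = matrix_inv (mat \<zeta> - A)"


section \<open>Matrix-valued integrals\<close>

definition matrix_contour_integrable ::
    "(real \<Rightarrow> complex) \<Rightarrow> (complex \<Rightarrow> complex ^ 'n ^ 'm) \<Rightarrow> bool" where
  "matrix_contour_integrable \<gamma> F \<longleftrightarrow> (\<forall>i j. (\<lambda>\<zeta>. F \<zeta> $ i $ j) contour_integrable_on \<gamma>)"

definition matrix_contour_integral ::
    "(real \<Rightarrow> complex) \<Rightarrow> (complex \<Rightarrow> complex ^ 'n ^ 'm) \<Rightarrow> complex ^ 'n ^ 'm" where
  "matrix_contour_integral \<gamma> F = (\<chi> i j. contour_integral \<gamma> (\<lambda>\<zeta>. F \<zeta> $ i $ j))"

text \<open>The integral against the two-form $d\zeta\wedge d\overline\zeta = -2i\,d\xi\,d\eta$.\<close>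

definition wedge_integral ::
    "complex set \<Rightarrow> (complex \<Rightarrow> complex ^ 'n ^ 'm) \<Rightarrow> complex ^ 'n ^ 'm" where
  "wedge_integral S F = (- 2 * \<i>) *\<^sub>c (LINT \<zeta>:S|lborel. F \<zeta>)"

end

theory Submission
  imports Defs "HOL-Computational_Algebra.Fundamental_Theorem_Algebra"
begin

text \<open>Every entry of the resolvent is a rational function \<open>q / m\<close> whose denominator is the minimal polynomial,
  and the order of an eigenvalue as a root of \<open>m\<close> is at most \<open>n\<close>. Let \<open>p\<close> be the Hermite interpolation
  polynomial and \<open>\<psi> = \<phi> - p\<close>, so that \<open>\<psi>\<close> and \<open>\<phi>\<close> have the same \<open>\<partial>\<close>-bar derivative. Green's formula on \<open>\<Omega>\<close>
  without small discs expresses the excised area integral by the integral of \<open>\<psi> q / m\<close> over the boundary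
  and over the small circles. On a circle of radius \<open>r\<close>, integration by parts shows that the Fourier coefficient
  of order \<open>j\<close> of a \<open>C\<^sup>j\<close> function is \<open>r\<^sup>j\<close> times \<open>\<partial>\<^sup>j / j!\<close> up to \<open>o(r\<^sup>j)\<close>; as the relevant derivatives
  of \<open>\<psi>\<close> vanish, the circle integrals tend to 0. What remains is the integral of \<open>p\<close> times the resolvent, which
  is \<open>p(A)\<close> by the residue theorem.

  Green's formula for functions that are \<open>C\<^sup>1\<close> only up to the boundary is obtained in three steps. For a compactly
  supported \<open>C\<^sup>1\<close> function on the plane, integrate the Cauchy-Pompeiu formula along the path and exchange the
  integrals: the inner integral is a winding number. Near a smooth boundary point the closure of \<open>\<Omega>\<close> can be
  translated into \<open>\<Omega>\<close>, which reduces localised functions to the first case. The finitely many corners are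
  removed by cutoff functions.\<close>

section \<open>Wirtinger derivatives and cutoff functions\<close>

text \<open>Nothing is known about \<phi> beyond the closure of \<Omega>, and a piecewise smooth
  boundary may have cusps, where no single direction need translate the closure into \<Omega>. So
  the corners cannot be treated like smooth points, and no extension of \<phi> to the plane is
  attempted. Cutoffs of class C^1 are enough, which is why cubic splines serve. No polar coordinates
  occur: the constant in Green's formula stays unknown until the conjugate function on the unit disc
  fixes it as pi. Green's formula is proved for Jordan domains only. To excise discs, the poles are
  cut off inside them, and the formula for \<Omega> is compared with those for the discs, applied to
  the same cut-off function. The singular area integrand is never estimated; its limit is read off
  from the circle integrals. The smoothness n - 1 is what the poles demand: a pole of order k tests
  derivatives up to order k - 1, and no pole of the resolvent has order above n.\<close>

text \<open>In \<open>C1_wirtinger U f a b\<close> the functions \<open>a\<close> and \<open>b\<close> are the two Wirtinger derivatives of \<open>f\<close>.\<close>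

definition C1_wirtinger ::
    "complex set \<Rightarrow> (complex \<Rightarrow> complex) \<Rightarrow> (complex \<Rightarrow> complex) \<Rightarrow> (complex \<Rightarrow> complex) \<Rightarrow> bool"
  where
  "C1_wirtinger U f a b \<longleftrightarrow> continuous_on U a \<and> continuous_on U b \<and>
     (\<forall>z\<in>U. (f has_derivative (\<lambda>h. a z * h + b z * cnj h)) (at z))"

lemma C1_wirtinger_continuous_on: "C1_wirtinger U f a b \<Longrightarrow> continuous_on U f"
  unfolding C1_wirtinger_def
  by (meson continuous_at_imp_continuous_on has_derivative_continuous)

lemma C1_wirtinger_subset: "C1_wirtinger U f a b \<Longrightarrow> V \<subseteq> U \<Longrightarrow> C1_wirtinger V f a b"
  unfolding C1_wirtinger_def by (meson continuous_on_subset subset_iff)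

lemma C1_wirtinger_const: "C1_wirtinger U (\<lambda>_. c) (\<lambda>_. 0) (\<lambda>_. 0)"
  by (simp add: C1_wirtinger_def)

lemma C1_wirtinger_diff:
  assumes "C1_wirtinger U f a b" "C1_wirtinger U g a' b'"
  shows "C1_wirtinger U (\<lambda>z. f z - g z) (\<lambda>z. a z - a' z) (\<lambda>z. b z - b' z)"
  unfolding C1_wirtinger_def
proof (intro conjI ballI)
  fix z assume z: "z \<in> U"
  have "((\<lambda>z. f z - g z) has_derivative
      (\<lambda>h. (a z * h + b z * cnj h) - (a' z * h + b' z * cnj h))) (at z)"
    using assms z unfolding C1_wirtinger_def by (intro has_derivative_diff) auto
  then show "((\<lambda>z. f z - g z) has_derivative
      (\<lambda>h. (a z - a' z) * h + (b z - b' z) * cnj h)) (at z)"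
    by (simp add: algebra_simps)
qed (use assms in \<open>auto simp: C1_wirtinger_def intro!: continuous_intros\<close>)

lemma C1_wirtinger_mult:
  assumes "C1_wirtinger U f a b" "C1_wirtinger U g a' b'"
  shows "C1_wirtinger U (\<lambda>z. f z * g z)
           (\<lambda>z. a z * g z + f z * a' z) (\<lambda>z. b z * g z + f z * b' z)"
  unfolding C1_wirtinger_def
proof (intro conjI ballI)
  fix z assume z: "z \<in> U"
  have "((\<lambda>z. f z * g z) has_derivative
      (\<lambda>h. f z * (a' z * h + b' z * cnj h) + (a z * h + b z * cnj h) * g z)) (at z)"
    using assms z unfolding C1_wirtinger_def by (intro has_derivative_mult) auto
  then show "((\<lambda>z. f z * g z) has_derivative
      (\<lambda>h. (a z * g z + f z * a' z) * h + (b z * g z + f z * b' z) * cnj h)) (at z)"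
    by (simp add: algebra_simps)
qed (use assms in \<open>auto simp: C1_wirtinger_def intro!: continuous_intros
       C1_wirtinger_continuous_on[OF assms(1)] C1_wirtinger_continuous_on[OF assms(2)]\<close>)

lemma C1_wirtinger_holomorphic:
  assumes "f holomorphic_on U" "open U"
  shows "C1_wirtinger U f (deriv f) (\<lambda>_. 0)"
  unfolding C1_wirtinger_def
proof (intro conjI ballI)
  show "continuous_on U (deriv f)"
    using assms by (intro holomorphic_on_imp_continuous_on holomorphic_deriv)
  fix z assume "z \<in> U"
  then have "(f has_field_derivative deriv f z) (at z)"
    using assms holomorphic_derivI by blast
  then show "(f has_derivative (\<lambda>h. deriv f z * h + 0 * cnj h)) (at z)"
    by (simp add: has_field_derivative_def)
qed auto

lemma C1_wirtinger_cong:
  assumes "C1_wirtinger U f a b" "open U"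
    and "\<And>z. z \<in> U \<Longrightarrow> f z = f' z" "\<And>z. z \<in> U \<Longrightarrow> a z = a' z" "\<And>z. z \<in> U \<Longrightarrow> b z = b' z"
  shows "C1_wirtinger U f' a' b'"
  unfolding C1_wirtinger_def
proof (intro conjI ballI)
  show "continuous_on U a'" "continuous_on U b'"
    using assms(1) unfolding C1_wirtinger_def
    by (meson assms(4,5) continuous_on_eq)+
  fix z assume z: "z \<in> U"
  have "(f has_derivative (\<lambda>h. a z * h + b z * cnj h)) (at z)"
    using assms(1) z unfolding C1_wirtinger_def by blast
  then have "(f has_derivative (\<lambda>h. a' z * h + b' z * cnj h)) (at z)"
    by (simp only: assms(4)[OF z] assms(5)[OF z])
  then show "(f' has_derivative (\<lambda>h. a' z * h + b' z * cnj h)) (at z)"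
    by (rule has_derivative_transform_within_open[OF _ assms(2) z]) (simp only: assms(3))
qed

lemma C1_wirtinger_Un:
  assumes "C1_wirtinger U f a b" "C1_wirtinger V f a b" "open U" "open V"
  shows "C1_wirtinger (U \<union> V) f a b"
  using assms unfolding C1_wirtinger_def by (auto simp: continuous_on_open_Un)

lemma C1_wirtinger_shift:
  assumes "C1_wirtinger U f a b"
  shows "C1_wirtinger {z. z + c \<in> U} (\<lambda>z. f (z + c)) (\<lambda>z. a (z + c)) (\<lambda>z. b (z + c))"
  unfolding C1_wirtinger_def
proof (intro conjI ballI)
  show "continuous_on {z. z + c \<in> U} (\<lambda>z. a (z + c))" "continuous_on {z. z + c \<in> U} (\<lambda>z. b (z + c))"
    using assms unfolding C1_wirtinger_def
    by (auto intro!: continuous_on_compose2[where f="\<lambda>z. z + c"] continuous_intros)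
  fix z assume "z \<in> {z. z + c \<in> U}"
  then have *: "(f has_derivative (\<lambda>h. a (z + c) * h + b (z + c) * cnj h)) (at (z + c))"
    using assms unfolding C1_wirtinger_def by auto
  have "((\<lambda>z. f (z + c)) has_derivative (\<lambda>h. a (z + c) * h + b (z + c) * cnj h)) (at z)"
    by (rule has_derivative_compose[where f="\<lambda>z. z + c" and f'="\<lambda>h. h", OF _ *])
      (auto intro!: derivative_eq_intros)
  then show "((\<lambda>z. f (z + c)) has_derivative (\<lambda>h. a (z + c) * h + b (z + c) * cnj h)) (at z)" .
qed

text \<open>The directions 1 and \<open>\<i>\<close> separate the two coefficients. Applied to a
  zero function, this shows that \<open>a\<close> and \<open>b\<close> vanish wherever
  \<open>f\<close> vanishes on an open set.\<close>

lemma C1_wirtinger_unique: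
  assumes "C1_wirtinger U f a b" "C1_wirtinger U f a' b'" "z \<in> U"
  shows "a z = a' z" "b z = b' z"
proof -
  have "(\<lambda>h. a z * h + b z * cnj h) = (\<lambda>h. a' z * h + b' z * cnj h)"
    using assms has_derivative_unique unfolding C1_wirtinger_def by blast
  then have "a z * h + b z * cnj h = a' z * h + b' z * cnj h" for h
    by metis
  from this[of 1] this[of \<i>]
  have "a z + b z = a' z + b' z" "\<i> * (a z - b z) = \<i> * (a' z - b' z)"
    by (auto simp: algebra_simps)
  then have "a z + b z = a' z + b' z" "a z - b z = a' z - b' z"
    by auto
  then show "a z = a' z" "b z = b' z"
    by (simp_all add: complex_eq_iff)
qed

section \<open>Truncated powers and cubic cutoff functions\<close>

lemma DERIV_pos_part_power:
  fixes x :: real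
  shows "((\<lambda>x. max 0 x ^ Suc (Suc n)) has_real_derivative
            real (Suc (Suc n)) * max 0 x ^ Suc n) (at x)"
proof -
  consider "x > 0" | "x < 0" | "x = 0" by linarith
  then show ?thesis
  proof cases
    case 1
    have "((\<lambda>x. x ^ Suc (Suc n)) has_real_derivative real (Suc (Suc n)) * x ^ Suc n) (at x)"
      using DERIV_pow[of "Suc (Suc n)" x] by simp
    then have "((\<lambda>x. x ^ Suc (Suc n)) has_real_derivative
            real (Suc (Suc n)) * max 0 x ^ Suc n) (at x)"
      using 1 by (simp add: max_def)
    then show ?thesis
      by (rule has_field_derivative_transform_within_open[where S="{0<..}"])
        (use 1 in \<open>auto simp: max_def\<close>)
  next
    case 2
    have "((\<lambda>x. 0) has_real_derivative real (Suc (Suc n)) * max 0 x ^ Suc n) (at x)"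
      using 2 by (auto simp: max_def)
    then show ?thesis
      by (rule has_field_derivative_transform_within_open[where S="{..<0}"])
        (use 2 in \<open>auto simp: max_def\<close>)
  next
    case 3
    have "((\<lambda>h::real. max 0 h ^ Suc (Suc n) / h) \<longlongrightarrow> 0) (at 0)"
    proof (rule Lim_null_comparison)
      show "\<forall>\<^sub>F h in at (0::real). norm (max 0 h ^ Suc (Suc n) / h) \<le> \<bar>h\<bar> ^ Suc n"
        by (rule always_eventually, intro allI, rename_tac x, case_tac "x > 0")
          (auto simp: max_def norm_mult norm_power intro!: mult_nonpos_nonneg)
      have "((\<lambda>h::real. \<bar>h\<bar> ^ Suc n) \<longlongrightarrow> \<bar>0\<bar> ^ Suc n) (at 0)"
        by (intro tendsto_intros)
      then show "((\<lambda>h::real. \<bar>h\<bar> ^ Suc n) \<longlongrightarrow> 0) (at 0)" by simp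
    qed
    then show ?thesis using 3 by (simp add: has_field_derivative_iff)
  qed
qed

text \<open>A cubic spline in truncated powers with knots 1 and 2: it is 1 up to 1, it is 0 from 2
  on, and with u = s - 1 it is 1 - 3u^2 + 2u^3 in between. Truncated powers of exponent at least 2
  are differentiable at their knots too, so one formula holds on the whole line.\<close>

definition bump_profile :: "real \<Rightarrow> real" where
  "bump_profile s = 1 - 3 * max 0 (s - 1) ^ 2 + 2 * max 0 (s - 1) ^ 3
                      - 3 * max 0 (s - 2) ^ 2 - 2 * max 0 (s - 2) ^ 3"

definition bump_profile' :: "real \<Rightarrow> real" where
  "bump_profile' s = - 6 * max 0 (s - 1) + 6 * max 0 (s - 1) ^ 2
                      - 6 * max 0 (s - 2) - 6 * max 0 (s - 2) ^ 2"

lemma DERIV_bump_profile: "(bump_profile has_real_derivative bump_profile' s) (at s)"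
proof -
  have *: "((\<lambda>x. x - c) has_real_derivative 1) (at s)" for c
    by (auto intro!: derivative_eq_intros)
  have 2: "((\<lambda>x. max 0 (x - c) ^ 2) has_real_derivative 2 * max 0 (s - c)) (at s)" for c :: real
    using DERIV_chain2[OF DERIV_pos_part_power[of 0 "s - c"] *[of c]] by (simp add: numeral_2_eq_2)
  have 3: "((\<lambda>x. max 0 (x - c) ^ 3) has_real_derivative 3 * max 0 (s - c) ^ 2) (at s)" for c :: real
    using DERIV_chain2[OF DERIV_pos_part_power[of 1 "s - c"] *[of c]]
    by (simp add: numeral_2_eq_2 numeral_3_eq_3)
  show ?thesis
    unfolding bump_profile_def[abs_def] bump_profile'_def
    by (rule derivative_eq_intros 2 3 refl)+ simp
qed

lemma bump_profile_eq:
  "s \<le> 1 \<Longrightarrow> bump_profile s = 1" "2 \<le> s \<Longrightarrow> bump_profile s = 0"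
  "s \<le> 1 \<Longrightarrow> bump_profile' s = 0" "2 \<le> s \<Longrightarrow> bump_profile' s = 0"
  by (auto simp: bump_profile_def bump_profile'_def max_def algebra_simps
        power2_eq_square power3_eq_cube)

lemma bump_profile_bounds: "0 \<le> bump_profile s" "bump_profile s \<le> 1" "\<bar>bump_profile' s\<bar> \<le> 6"
proof -
  consider "s \<le> 1" | "2 \<le> s" | "1 < s" "s < 2" by linarith
  then have "0 \<le> bump_profile s \<and> bump_profile s \<le> 1 \<and> \<bar>bump_profile' s\<bar> \<le> 6"
  proof cases
    case 3
    define u where "u = s - 1"
    have u: "0 < u" "u < 1" using 3 by (auto simp: u_def)
    have B: "bump_profile s = 1 - u^2 * (3 - 2 * u)" "bump_profile' s = - (6 * (u * (1 - u)))"
      using 3 by (auto simp: bump_profile_def bump_profile'_def u_def max_def power2_eq_square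
          power3_eq_cube algebra_simps)
    have "1 - u^2 * (3 - 2 * u) = (1 - u)^2 * (1 + 2 * u)"
      by (simp add: power2_eq_square algebra_simps)
    moreover have "0 \<le> u^2 * (3 - 2 * u)" "0 \<le> (1 - u)^2 * (1 + 2 * u)"
      using u by auto
    moreover have "0 \<le> u * (1 - u)" using u by simp
    moreover have "u * (1 - u) \<le> 1 * 1" using u by (intro mult_mono) auto
    ultimately show ?thesis unfolding B by auto
  qed (auto simp: bump_profile_eq)
  then show "0 \<le> bump_profile s" "bump_profile s \<le> 1" "\<bar>bump_profile' s\<bar> \<le> 6" by auto
qed

lemma continuous_bump_profile': "continuous_on S bump_profile'"
  unfolding bump_profile'_def[abs_def] by (intro continuous_intros)

text \<open>The squared distance is smooth at the centre \<open>p\<close>, unlike the distance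
  itself, and its d-bar derivative is \<open>z - p\<close>; the chain rule then gives
  \<open>bump_bar\<close>.\<close>

definition bump :: "complex \<Rightarrow> real \<Rightarrow> complex \<Rightarrow> complex" where
  "bump p r z = of_real (bump_profile ((cmod (z - p) / r)\<^sup>2))"

definition bump_bar :: "complex \<Rightarrow> real \<Rightarrow> complex \<Rightarrow> complex" where
  "bump_bar p r z = of_real (bump_profile' ((cmod (z - p) / r)\<^sup>2)) * (z - p) / of_real (r\<^sup>2)"

text \<open>\<open>bump\<close> is real valued, so its two Wirtinger derivatives are conjugate to
  each other.\<close>

lemma C1_wirtinger_bump: "C1_wirtinger UNIV (bump p r) (\<lambda>z. cnj (bump_bar p r z)) (bump_bar p r)"
  unfolding C1_wirtinger_def
proof (intro conjI ballI)
  show *: "continuous_on UNIV (bump_bar p r)"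
    unfolding bump_bar_def[abs_def] divide_inverse
    by (intro continuous_intros continuous_on_compose2[OF continuous_bump_profile'[of UNIV]]) auto
  show "continuous_on UNIV (\<lambda>z. cnj (bump_bar p r z))"
    by (intro continuous_intros *)
  fix z :: complex
  have sq: "(\<lambda>z. (cmod (z - p) / r)\<^sup>2) = (\<lambda>z. ((z - p) \<bullet> (z - p)) / r\<^sup>2)"
    by (auto simp: power_divide power2_norm_eq_inner)
  have "((\<lambda>z. (cmod (z - p) / r)\<^sup>2) has_derivative (\<lambda>h. (2 * ((z - p) \<bullet> h)) / r\<^sup>2)) (at z)"
    unfolding sq divide_inverse[of _ "r\<^sup>2"]
    by (rule has_derivative_eq_rhs, (rule derivative_intros)+)
      (simp add: fun_eq_iff inner_commute algebra_simps)
  from has_derivative_compose[OF this,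
      OF DERIV_bump_profile[unfolded has_field_derivative_def]]
  have "((\<lambda>z. bump_profile ((cmod (z - p) / r)\<^sup>2)) has_derivative
     (\<lambda>h. bump_profile' ((cmod (z - p) / r)\<^sup>2) * ((2 * ((z - p) \<bullet> h)) / r\<^sup>2))) (at z)"
    by simp
  from bounded_linear.has_derivative[OF bounded_linear_of_real this]
  have "(bump p r has_derivative
     (\<lambda>h. of_real (bump_profile' ((cmod (z - p) / r)\<^sup>2) * ((2 * ((z - p) \<bullet> h)) / r\<^sup>2)))) (at z)"
    unfolding bump_def[abs_def] .
  moreover have "of_real (c * ((2 * ((z - p) \<bullet> h)) / r\<^sup>2)) =
      cnj (of_real c * (z - p) / of_real (r\<^sup>2)) * h + of_real c * (z - p) / of_real (r\<^sup>2) * cnj h"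
    for c :: real and h
  proof -
    have "of_real (2 * ((z - p) \<bullet> h)) = (z - p) * cnj h + cnj (z - p) * h"
      by (simp add: complex_eq_iff inner_complex_def algebra_simps)
    then have "of_real (c * ((2 * ((z - p) \<bullet> h)) / r\<^sup>2)) =
        of_real c * ((z - p) * cnj h + cnj (z - p) * h) / of_real (r\<^sup>2)"
      by (simp only: of_real_mult of_real_divide times_divide_eq_right)
    then show ?thesis
      by (simp add: add_divide_distrib distrib_left mult.assoc add.commute)
  qed
  ultimately show "(bump p r has_derivative
      (\<lambda>h. cnj (bump_bar p r z) * h + bump_bar p r z * cnj h)) (at z)"
    unfolding bump_bar_def by simp
qed

lemma bump_eq_1:
  assumes "cmod (z - p) \<le> r" shows "bump p r z = 1" "bump_bar p r z = 0"
\<comment> \<open>For \<open>r = 0\<close> division by zero makes the argument of the profile 0,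
  which lies where the profile is 1.\<close>
proof (atomize (full), cases "r = 0")
  case False
  then have "r > 0" using assms norm_ge_zero[of "z - p"] by linarith
  then have "(cmod (z - p) / r)\<^sup>2 \<le> 1"
    using assms by (intro power_le_one) auto
  then show "bump p r z = 1 \<and> bump_bar p r z = 0"
    by (simp add: bump_def bump_bar_def bump_profile_eq)
qed (simp add: bump_def bump_bar_def bump_profile_eq)

text \<open>3/2 is a rational stand-in for sqrt 2: its square 9/4 exceeds the knot 2.\<close>

lemma bump_eq_0:
  assumes "r > 0" "3 / 2 * r \<le> cmod (z - p)" shows "bump p r z = 0" "bump_bar p r z = 0"
proof -
  have "(3 / 2)\<^sup>2 \<le> (cmod (z - p) / r)\<^sup>2"
    using assms by (intro power_mono) (auto simp: field_simps)
  moreover have "(2::real) \<le> (3 / 2)\<^sup>2"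
    by (simp add: power2_eq_square)
  ultimately have "2 \<le> (cmod (z - p) / r)\<^sup>2"
    by linarith
  then show "bump p r z = 0" "bump_bar p r z = 0"
    by (simp_all add: bump_def bump_bar_def bump_profile_eq)
qed

lemma norm_one_minus_bump_le: "norm (1 - bump p r z) \<le> 1"
proof -
  have "1 - bump p r z = of_real (1 - bump_profile ((cmod (z - p) / r)\<^sup>2))"
    by (simp add: bump_def)
  then show ?thesis
    using bump_profile_bounds[of "(cmod (z - p) / r)\<^sup>2"] by (simp only: norm_of_real)
qed

text \<open>The constant is 6 times 3/2, from the bound 6 on \<open>bump_profile'\<close> and the
  radius 3/2 * r of the support. The order 1/r is what the later limits rest on.\<close>

lemma norm_bump_bar_le:
  assumes "r > 0" shows "norm (bump_bar p r z) \<le> 9 / r"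
proof (cases "3 / 2 * r \<le> cmod (z - p)")
  case True
  then show ?thesis using assms bump_eq_0[OF assms True] by simp
next
  case False
  have "norm (bump_bar p r z) = \<bar>bump_profile' ((cmod (z - p) / r)\<^sup>2)\<bar> * cmod (z - p) / r\<^sup>2"
    by (simp add: bump_bar_def norm_mult norm_divide norm_power)
  also have "\<dots> \<le> 6 * (3 / 2 * r) / r\<^sup>2"
    using False bump_profile_bounds by (intro divide_right_mono mult_mono) auto
  finally show ?thesis using assms by (simp add: power2_eq_square)
qed

text \<open>\<open>G\<close> is the product of the factors \<open>1 - bump p (r p)\<close>. Its
  derivatives vanish on the closed discs as well, because every summand of the product rule keeps a
  factor that is 0 there.\<close>

lemma cutoff_exists:
  fixes r :: "complex \<Rightarrow> real"
  assumes "finite I" "\<And>p. p \<in> I \<Longrightarrow> r p > 0"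
  obtains G a b where "C1_wirtinger UNIV G a b"
    "\<And>p z. p \<in> I \<Longrightarrow> z \<in> cball p (r p) \<Longrightarrow> G z = 0 \<and> a z = 0 \<and> b z = 0"
    "\<And>z. (\<And>p. p \<in> I \<Longrightarrow> z \<notin> ball p (3/2 * r p)) \<Longrightarrow> G z = 1 \<and> a z = 0 \<and> b z = 0"
proof -
  have "\<exists>G a b. C1_wirtinger UNIV G a b \<and>
     (\<forall>p\<in>I. \<forall>z\<in>cball p (r p). G z = 0 \<and> a z = 0 \<and> b z = 0) \<and>
     (\<forall>z. (\<forall>p\<in>I. z \<notin> ball p (3/2 * r p)) \<longrightarrow> G z = 1 \<and> a z = 0 \<and> b z = 0)"
    using assms
  proof (induction I rule: finite_induct)
    case empty
    show ?case
      by (rule exI[of _ "\<lambda>_. 1"], rule exI[of _ "\<lambda>_. 0"], rule exI[of _ "\<lambda>_. 0"])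
        (auto simp: C1_wirtinger_const)
  next
    case (insert p I)
    then obtain G a b where G: "C1_wirtinger UNIV G a b"
      "\<And>p z. p \<in> I \<Longrightarrow> z \<in> cball p (r p) \<Longrightarrow> G z = 0 \<and> a z = 0 \<and> b z = 0"
      "\<And>z. (\<forall>p\<in>I. z \<notin> ball p (3/2 * r p)) \<Longrightarrow> G z = 1 \<and> a z = 0 \<and> b z = 0"
      by (metis insertCI)
    have rp: "r p > 0" using insert by auto
    have "C1_wirtinger UNIV (\<lambda>z. 1 - bump p (r p) z)
        (\<lambda>z. 0 - cnj (bump_bar p (r p) z)) (\<lambda>z. 0 - bump_bar p (r p) z)"
      by (intro C1_wirtinger_diff C1_wirtinger_const C1_wirtinger_bump)
    note C = C1_wirtinger_mult[OF G(1) this]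
    have 1: "z \<in> cball p (r p) \<Longrightarrow> bump p (r p) z = 1 \<and> bump_bar p (r p) z = 0" for z
      using bump_eq_1[of z p "r p"] by (auto simp: dist_norm norm_minus_commute)
    have 0: "z \<notin> ball p (3/2 * r p) \<Longrightarrow> bump p (r p) z = 0 \<and> bump_bar p (r p) z = 0" for z
      using bump_eq_0[of "r p" z p] rp by (auto simp: dist_norm norm_minus_commute)
    show ?case
      by (rule exI, rule exI, rule exI, rule conjI[OF C]) (use 0 1 G in auto)
  qed
  then show ?thesis using that by blast
qed

text \<open>A finite subcover and the complement of \<open>cutoff_exists\<close>. Vanishing on an
  open set around \<open>- W\<close> is stronger than vanishing off \<open>W\<close>: a function
  that is C^1 only on \<open>W\<close> becomes C^1 on the plane after multiplication by
  \<open>G\<close>.\<close>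

lemma cutoff_compact:
  assumes "compact K" "open W" "K \<subseteq> W"
  obtains G a b R where "C1_wirtinger UNIV G a b" "\<And>z. z \<in> K \<Longrightarrow> G z = 1 \<and> b z = 0"
    "\<And>z. z \<notin> cball 0 R \<Longrightarrow> G z = 0 \<and> a z = 0 \<and> b z = 0"
    "\<exists>V. open V \<and> - W \<subseteq> V \<and> (\<forall>z\<in>V. G z = 0 \<and> a z = 0 \<and> b z = 0)"
proof -
  have "\<forall>p\<in>K. \<exists>r>0. cball p (2 * r) \<subseteq> W"
  proof
    fix p assume "p \<in> K"
    then obtain e where "e > 0" "cball p e \<subseteq> W"
      using assms open_contains_cball by (metis subsetD)
    then show "\<exists>r>0. cball p (2 * r) \<subseteq> W" by (intro exI[of _ "e/2"]) auto
  qed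
  then obtain r where r: "\<And>p. p \<in> K \<Longrightarrow> r p > 0 \<and> cball p (2 * r p) \<subseteq> W"
    by metis
  have "K \<subseteq> (\<Union>p\<in>K. ball p (r p))" using r by auto
  then obtain I where I: "I \<subseteq> K" "finite I" "K \<subseteq> (\<Union>p\<in>I. ball p (r p))"
    using compactE_image[OF assms(1), of K "\<lambda>p. ball p (r p)"] by (metis open_ball)
  obtain G a b where G: "C1_wirtinger UNIV G a b"
    "\<And>p z. p \<in> I \<Longrightarrow> z \<in> cball p (r p) \<Longrightarrow> G z = 0 \<and> a z = 0 \<and> b z = 0"
    "\<And>z. (\<And>p. p \<in> I \<Longrightarrow> z \<notin> ball p (3/2 * r p)) \<Longrightarrow> G z = 1 \<and> a z = 0 \<and> b z = 0"
    using r I(1) by (rule_tac cutoff_exists[OF I(2), of r]) (blast+)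
  define T where "T = (\<Union>p\<in>I. cball p (3/2 * r p))"
  have T: "compact T" using I by (auto simp: T_def)
  have T0: "1 - G z = 0 \<and> 0 - a z = 0 \<and> 0 - b z = 0" if "z \<notin> T" for z
  proof -
    have "p \<in> I \<Longrightarrow> z \<notin> ball p (3/2 * r p)" for p using that by (auto simp: T_def)
    then show ?thesis using G(3)[of z] by simp
  qed
  have TW: "T \<subseteq> W"
  proof
    fix z assume "z \<in> T"
    then obtain p where "p \<in> I" "z \<in> cball p (3/2 * r p)" by (auto simp: T_def)
    moreover have "3/2 * r p \<le> 2 * r p" using r[of p] I \<open>p \<in> I\<close> by (auto simp: subset_iff)
    ultimately show "z \<in> W" using r[of p] I(1) by (auto simp: subset_iff)
  qed
  obtain R where R: "T \<subseteq> cball 0 R"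
    using bounded_subset_ballD[OF compact_imp_bounded[OF T], of 0] ball_subset_cball by blast
  show ?thesis
  proof (rule that)
    show "C1_wirtinger UNIV (\<lambda>z. 1 - G z) (\<lambda>z. 0 - a z) (\<lambda>z. 0 - b z)"
      by (intro C1_wirtinger_diff C1_wirtinger_const G)
    show "1 - G z = 1 \<and> 0 - b z = 0" if "z \<in> K" for z
    proof -
      obtain p where "p \<in> I" "z \<in> ball p (r p)" using \<open>z \<in> K\<close> I(3) by blast
      then show ?thesis using G(2)[of p z] ball_subset_cball[of p "r p"] by auto
    qed
    show "1 - G z = 0 \<and> 0 - a z = 0 \<and> 0 - b z = 0" if "z \<notin> cball 0 R" for z
      using that R T0 by blast
    show "\<exists>V. open V \<and> - W \<subseteq> V \<and> (\<forall>z\<in>V. 1 - G z = 0 \<and> 0 - a z = 0 \<and> 0 - b z = 0)"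
      using T0 TW compact_imp_closed[OF T] by (intro exI[of _ "- T"]) auto
  qed
qed

section \<open>Integrals over the plane and the regularised Cauchy kernel\<close>

lemma integral_lborel_shift:
  fixes f :: "complex \<Rightarrow> 'b::{banach, second_countable_topology}"
  assumes "f \<in> borel_measurable borel"
  shows "(LINT z|lborel. f (z + c)) = (LINT z|lborel. f z)"
proof -
  have "(LINT z|lborel. f z) = (LINT z|distr lborel borel ((+) c). f z)"
    by (simp only: lborel_distr_plus)
  also have "\<dots> = (LINT z|lborel. f (c + z))"
    using assms by (subst integral_distr) auto
  finally show ?thesis by (simp add: add.commute)
qed

lemma nn_integral_lborel_shift:
  fixes f :: "complex \<Rightarrow> ennreal"
  assumes "f \<in> borel_measurable borel"
  shows "(\<integral>\<^sup>+z. f (z + c) \<partial>lborel) = (\<integral>\<^sup>+z. f z \<partial>lborel)"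
proof -
  have "(\<integral>\<^sup>+z. f z \<partial>lborel) = (\<integral>\<^sup>+z. f z \<partial>(distr lborel borel ((+) c)))"
    by (simp only: lborel_distr_plus)
  also have "\<dots> = (\<integral>\<^sup>+z. f (c + z) \<partial>lborel)"
    using assms by (subst nn_integral_distr) auto
  finally show ?thesis by (simp add: add.commute)
qed

lemma integrable_compact_support:
  fixes f :: "complex \<Rightarrow> complex"
  assumes "continuous_on UNIV f" "\<And>z. z \<notin> cball 0 R \<Longrightarrow> f z = 0"
  shows "integrable lborel f"
proof -
  have "integrable lborel (\<lambda>x. indicator (cball 0 R) x *\<^sub>R f x)"
    using assms by (intro borel_integrable_compact) (auto intro: continuous_on_subset)
  moreover have "(\<lambda>x. indicator (cball 0 R) x *\<^sub>R f x) = f"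
    using assms(2) by (auto simp: indicator_def fun_eq_iff)
  ultimately show ?thesis by simp
qed

lemma bounded_compact_support:
  fixes f :: "complex \<Rightarrow> complex"
  assumes "continuous_on UNIV f" "\<And>z. z \<notin> cball 0 R \<Longrightarrow> f z = 0"
  obtains M where "M > 0" "\<And>z. norm (f z) \<le> M"
proof -
  have "bounded (f ` cball 0 R)"
    using assms by (intro compact_imp_bounded compact_continuous_image) (auto intro: continuous_on_subset)
  then obtain M where M: "M > 0" "\<And>z. z \<in> cball 0 R \<Longrightarrow> norm (f z) \<le> M"
    by (auto simp: bounded_pos)
  show ?thesis
  proof (rule that[OF M(1)])
    fix z show "norm (f z) \<le> M"
      using M(2)[of z] assms(2)[of z] M(1) by (cases "z \<in> cball 0 R") auto
  qed
qed

lemma C1_wirtinger_support: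
  assumes "C1_wirtinger UNIV f a b" "\<And>z. z \<notin> cball 0 R \<Longrightarrow> f z = 0"
    "z \<notin> cball 0 R"
  shows "a z = 0" "b z = 0"
proof -
  have "C1_wirtinger (- cball 0 R) (\<lambda>_. 0) a b"
    by (rule C1_wirtinger_cong[OF C1_wirtinger_subset[OF assms(1)]]) (use assms(2) in auto)
  from C1_wirtinger_unique[OF this C1_wirtinger_const] assms(3)
  show "a z = 0" "b z = 0" by auto
qed

text \<open>Translation invariance of the integral replaces an iterated integration: the integral of each
  difference quotient vanishes.\<close>

lemma integral_wirtinger_bar_eq_0:
  assumes g: "C1_wirtinger UNIV g a b" and supp: "\<And>z. z \<notin> cball 0 R \<Longrightarrow> g z = 0"
  shows "(LINT z|lborel. b z) = 0"
proof -
  have ab0: "\<And>z. z \<notin> cball 0 R \<Longrightarrow> a z = 0" "\<And>z. z \<notin> cball 0 R \<Longrightarrow> b z = 0"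
    using C1_wirtinger_support[OF g supp] by auto
  have cont: "continuous_on UNIV a" "continuous_on UNIV b" "continuous_on UNIV g"
    using g C1_wirtinger_continuous_on[OF g] by (auto simp: C1_wirtinger_def)
  obtain A where A: "\<And>z. norm (a z) \<le> A" using bounded_compact_support[OF cont(1) ab0(1)] by metis
  obtain B where B: "\<And>z. norm (b z) \<le> B" using bounded_compact_support[OF cont(2) ab0(2)] by metis
  have der: "(g has_derivative (\<lambda>h. a z * h + b z * cnj h)) (at z)" for z
    using g by (auto simp: C1_wirtinger_def)
  \<comment> \<open>The global Lipschitz bound supplies the dominating constant for the difference
    quotients.\<close>
  have lip: "norm (g x - g y) \<le> (A + B) * norm (x - y)" for x y
  proof (rule differentiable_bound[of UNIV g])
    fix z
    show "onorm (\<lambda>h. a z * h + b z * cnj h) \<le> A + B"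
    proof (rule onorm_le)
      fix h
      have "norm (a z * h + b z * cnj h) \<le> norm (a z) * norm h + norm (b z) * norm h"
        by (rule order_trans[OF norm_triangle_ineq]) (simp add: norm_mult)
      also have "\<dots> \<le> A * norm h + B * norm h"
        by (intro add_mono mult_right_mono A B) auto
      finally show "norm (a z * h + b z * cnj h) \<le> (A + B) * norm h"
        by (simp add: algebra_simps)
    qed
  qed (use der in auto)
  have AB: "0 \<le> A + B" using A[of 0] B[of 0] norm_ge_zero by (meson add_nonneg_nonneg order_trans)
  \<comment> \<open>The integrand is the derivative of \<open>g\<close> in direction
    \<open>e\<close>; the directions 1 and \<open>\<i>\<close> together isolate the integral of
    \<open>b\<close>.\<close>
  have dir: "(LINT z|lborel. a z * e + b z * cnj e) = 0" if e: "norm e = 1" for e :: complex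
  proof -
    define h :: "nat \<Rightarrow> real" where "h n = inverse (real (Suc n))" for n
    have h0: "h \<longlonglongrightarrow> 0" unfolding h_def by (rule LIMSEQ_inverse_real_of_nat)
    have hpos: "h n > 0" "h n \<le> 1" for n by (auto simp: h_def field_simps)
    define q where "q n z = (g (z + of_real (h n) * e) - g z) / of_real (h n)" for n z
    have gint: "integrable lborel g" by (rule integrable_compact_support[OF cont(3) supp])
    have gm: "g \<in> borel_measurable borel" using cont(3) by (rule borel_measurable_continuous_onI)
    have shift_int: "integrable lborel (\<lambda>z. g (z + c))" for c
    proof (rule integrable_compact_support[of _ "R + norm c"])
      show "continuous_on UNIV (\<lambda>z. g (z + c))"
        by (intro continuous_on_compose2[OF cont(3)] continuous_intros) auto
      fix z :: complex assume "z \<notin> cball 0 (R + norm c)"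
      then have "z + c \<notin> cball 0 R"
        using norm_triangle_ineq4[of "z + c" c] by auto
      then show "g (z + c) = 0" by (rule supp)
    qed
    have q0: "(LINT z|lborel. q n z) = 0" for n
      unfolding q_def using integral_lborel_shift[OF gm] gint shift_int by simp
    \<comment> \<open>All steps \<open>h n\<close> are at most 1, so the quotients vanish outside
      the disc of radius \<open>R + 1\<close>.\<close>
    have "(\<lambda>n. LINT z|lborel. q n z) \<longlonglongrightarrow> (LINT z|lborel. a z * e + b z * cnj e)"
    proof (rule integral_dominated_convergence[where w = "\<lambda>z. indicator (cball 0 (R + 1)) z *\<^sub>R (A + B)"])
      show "(\<lambda>z. a z * e + b z * cnj e) \<in> borel_measurable lborel"
        using cont by (auto intro!: borel_measurable_continuous_onI continuous_intros)
      show "q n \<in> borel_measurable lborel" for n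
        unfolding q_def using gint shift_int by (auto intro!: borel_measurable_integrable)
      show "integrable lborel (\<lambda>z::complex. indicator (cball 0 (R + 1)) z *\<^sub>R (A + B))"
        by (intro borel_integrable_compact) auto
      show "AE z in lborel. (\<lambda>n. q n z) \<longlonglongrightarrow> a z * e + b z * cnj e"
      proof (rule AE_I2)
        fix z
        have "((\<lambda>t. g (z + of_real t * e)) has_derivative
            (\<lambda>t. a z * (of_real t * e) + b z * cnj (of_real t * e))) (at (0::real))"
        proof (rule has_derivative_compose[where g=g and f="\<lambda>t. z + of_real t * e" and f'="\<lambda>t. of_real t * e"
              and g'="\<lambda>h. a z * h + b z * cnj h"])
          show "((\<lambda>t. z + of_real t * e) has_derivative (\<lambda>t. of_real t * e)) (at (0::real))"
            by (rule has_derivative_eq_rhs, (rule derivative_intros)+) auto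
        qed (use der[of z] in auto)
        then have lim: "((\<lambda>t. norm (g (z + of_real t * e) - g z
            - (a z * (of_real t * e) + b z * cnj (of_real t * e))) / norm t) \<longlongrightarrow> 0) (at (0::real))"
          by (simp add: has_derivative_at)
        have "filterlim h (at 0) sequentially"
          using h0 hpos(1) by (auto simp: filterlim_at less_imp_neq[symmetric] intro!: always_eventually)
        from filterlim_compose[OF lim this]
        have "(\<lambda>n. norm (g (z + of_real (h n) * e) - g z
            - (a z * (of_real (h n) * e) + b z * cnj (of_real (h n) * e))) / norm (h n)) \<longlonglongrightarrow> 0" .
        moreover have "norm (g (z + of_real (h n) * e) - g z
            - (a z * (of_real (h n) * e) + b z * cnj (of_real (h n) * e))) / norm (h n) =
            norm (q n z - (a z * e + b z * cnj e))" for n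
        proof -
          have "q n z - (a z * e + b z * cnj e) = (g (z + of_real (h n) * e) - g z
            - (a z * (of_real (h n) * e) + b z * cnj (of_real (h n) * e))) / of_real (h n)"
            using hpos(1)[of n] by (simp add: q_def field_simps)
          then show ?thesis by (simp add: norm_divide)
        qed
        ultimately show "(\<lambda>n. q n z) \<longlonglongrightarrow> a z * e + b z * cnj e"
          by (simp add: tendsto_norm_zero_iff LIM_zero_iff)
      qed
      show "AE z in lborel. norm (q n z) \<le> indicator (cball 0 (R + 1)) z *\<^sub>R (A + B)" for n
      proof (rule AE_I2)
        fix z
        show "norm (q n z) \<le> indicator (cball 0 (R + 1)) z *\<^sub>R (A + B)"
        proof (cases "z \<in> cball 0 (R + 1)")
          case True
          have "norm (g (z + of_real (h n) * e) - g z) \<le> (A + B) * h n"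
            using lip[of "z + of_real (h n) * e" z] hpos[of n] e by (simp add: norm_mult)
          then show ?thesis using True hpos[of n] by (simp add: q_def norm_divide field_simps)
        next
          case False
          have "z + of_real (h n) * e \<notin> cball 0 R"
            using False norm_triangle_ineq4[of "z + of_real (h n) * e" "of_real (h n) * e"] hpos[of n] e
            by (auto simp: norm_mult)
          moreover have "z \<notin> cball 0 R" using False by auto
          ultimately show ?thesis using False by (simp add: q_def supp)
        qed
      qed
    qed
    then show ?thesis using q0 by (simp add: LIMSEQ_const_iff)
  qed
  have int: "integrable lborel a" "integrable lborel b"
    using integrable_compact_support cont ab0 by blast+
  have "(LINT z|lborel. a z) + (LINT z|lborel. b z) = 0"
    using dir[of 1] int by simp
  moreover have "(LINT z|lborel. a z) * \<i> - (LINT z|lborel. b z) * \<i> = 0"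
    using dir[of \<i>] int by simp
  then have "((LINT z|lborel. a z) - (LINT z|lborel. b z)) * \<i> = 0" by (simp add: algebra_simps)
  then have "(LINT z|lborel. a z) - (LINT z|lborel. b z) = 0" by simp
  ultimately show ?thesis by simp
qed

section \<open>The Cauchy kernel with its pole cut off\<close>

definition cauchy_kernel :: "real \<Rightarrow> complex \<Rightarrow> complex" where
  "cauchy_kernel e z = (1 - bump 0 e z) * inverse z"

text \<open>The product rule is left unsimplified, so that \<open>C1_wirtinger_mult\<close> produces
  exactly this term. As \<open>e\<close> tends to 0 these functions act like a multiple of the Dirac
  mass at 0.\<close>

definition cauchy_kernel_bar :: "real \<Rightarrow> complex \<Rightarrow> complex" where
  "cauchy_kernel_bar e z = (0 - bump_bar 0 e z) * inverse z + (1 - bump 0 e z) * 0"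

text \<open>Near 0 the kernel is constantly 0, off 0 it is a product of C^1 functions, and these two
  open sets cover the plane.\<close>

lemma C1_wirtinger_cauchy_kernel:
  assumes "e > 0"
  shows "\<exists>a. C1_wirtinger UNIV (cauchy_kernel e) a (cauchy_kernel_bar e)"
proof -
  define a where "a z = (0 - cnj (bump_bar 0 e z)) * inverse z + (1 - bump 0 e z) * deriv inverse z" for z
  have "C1_wirtinger (- {0}) inverse (deriv inverse) (\<lambda>_. 0)"
    by (intro C1_wirtinger_holomorphic holomorphic_intros) auto
  moreover have "C1_wirtinger (- {0}) (\<lambda>z. 1 - bump 0 e z)
        (\<lambda>z. 0 - cnj (bump_bar 0 e z)) (\<lambda>z. 0 - bump_bar 0 e z)"
    by (intro C1_wirtinger_diff C1_wirtinger_const C1_wirtinger_subset[OF C1_wirtinger_bump]) auto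
  ultimately have 1: "C1_wirtinger (- {0}) (cauchy_kernel e) a (cauchy_kernel_bar e)"
    unfolding cauchy_kernel_def[abs_def] cauchy_kernel_bar_def[abs_def] a_def[abs_def]
    by (rule C1_wirtinger_mult[rotated])
  have 2: "C1_wirtinger (ball 0 e) (cauchy_kernel e) a (cauchy_kernel_bar e)"
    by (rule C1_wirtinger_cong[OF C1_wirtinger_const[of _ 0]])
      (auto simp: cauchy_kernel_def cauchy_kernel_bar_def a_def bump_eq_1)
  have "- {0} \<union> ball 0 e = (UNIV :: complex set)" using assms by auto
  with C1_wirtinger_Un[OF 1 2] show ?thesis by (auto simp: open_Compl)
qed

lemma cauchy_kernel_far:
  assumes "e > 0" "3/2 * e \<le> norm z"
  shows "cauchy_kernel e z = inverse z" "cauchy_kernel_bar e z = 0"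
  using bump_eq_0[OF assms(1), of z 0] assms(2)
  by (auto simp: cauchy_kernel_def cauchy_kernel_bar_def)

lemma cauchy_kernel_bar_near: "norm z \<le> e \<Longrightarrow> cauchy_kernel_bar e z = 0"
  by (simp add: cauchy_kernel_bar_def bump_eq_1)

lemma norm_cauchy_kernel_le: "norm (cauchy_kernel e z) \<le> inverse (norm z)"
  using norm_one_minus_bump_le[of 0 e z]
  by (auto simp: cauchy_kernel_def norm_mult norm_inverse intro!: mult_left_le_one_le)

text \<open>Only the annulus between \<open>e\<close> and 3/2 * e matters; there the bound is 9/e
  for \<open>bump_bar\<close> times 1/e for the inverse.\<close>

lemma norm_cauchy_kernel_bar_le:
  assumes "e > 0"
  shows "norm (cauchy_kernel_bar e z) \<le> indicator (cball 0 (3/2 * e)) z *\<^sub>R (9 / e\<^sup>2)"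
proof -
  consider "norm z \<le> e" | "3/2 * e < norm z" | "e < norm z" "norm z \<le> 3/2 * e" by linarith
  then show ?thesis
  proof cases
    case 1 then show ?thesis by (simp add: cauchy_kernel_bar_near)
  next
    case 2 then show ?thesis using cauchy_kernel_far[of e z] assms by simp
  next
    case 3
    have "norm (cauchy_kernel_bar e z) = norm (bump_bar 0 e z) * inverse (norm z)"
      by (simp add: cauchy_kernel_bar_def norm_mult norm_inverse)
    also have "\<dots> \<le> (9 / e) * inverse e"
      using 3 assms by (intro mult_mono norm_bump_bar_le le_imp_inverse_le) auto
    finally show ?thesis using 3 by (simp add: power2_eq_square field_simps)
  qed
qed

lemma continuous_on_cauchy_kernel:
  assumes "e > 0"
  shows "continuous_on UNIV (cauchy_kernel e)" "continuous_on UNIV (cauchy_kernel_bar e)"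
  using C1_wirtinger_cauchy_kernel[OF assms] C1_wirtinger_continuous_on
  unfolding C1_wirtinger_def by blast+

text \<open>Integration by parts without boundary term: \<open>f\<close> times the translated kernel
  has compact support, so its d-bar derivative integrates to 0.\<close>

lemma cauchy_kernel_by_parts:
  assumes f: "C1_wirtinger UNIV f a b" and supp: "\<And>z. z \<notin> cball 0 R \<Longrightarrow> f z = 0" and e: "e > 0"
  shows "(LINT \<zeta>|lborel. b \<zeta> * cauchy_kernel e (\<zeta> - z)) =
         - (LINT \<zeta>|lborel. f \<zeta> * cauchy_kernel_bar e (\<zeta> - z))"
proof -
  obtain a' where K: "C1_wirtinger UNIV (cauchy_kernel e) a' (cauchy_kernel_bar e)"
    using C1_wirtinger_cauchy_kernel[OF e] by blast
  have K': "C1_wirtinger UNIV (\<lambda>\<zeta>. cauchy_kernel e (\<zeta> - z)) (\<lambda>\<zeta>. a' (\<zeta> - z)) (\<lambda>\<zeta>. cauchy_kernel_bar e (\<zeta> - z))"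
    using C1_wirtinger_shift[OF K, of "- z"] by simp
  have "(LINT \<zeta>|lborel. b \<zeta> * cauchy_kernel e (\<zeta> - z) + f \<zeta> * cauchy_kernel_bar e (\<zeta> - z)) = 0"
    by (rule integral_wirtinger_bar_eq_0[OF C1_wirtinger_mult[OF f K'], where R=R]) (simp add: supp)
  moreover have "integrable lborel (\<lambda>\<zeta>. b \<zeta> * cauchy_kernel e (\<zeta> - z))"
    using f C1_wirtinger_continuous_on[OF K'] C1_wirtinger_support(2)[OF f supp]
    by (intro integrable_compact_support[of _ R] continuous_on_mult) (auto simp: C1_wirtinger_def)
  moreover have "integrable lborel (\<lambda>\<zeta>. f \<zeta> * cauchy_kernel_bar e (\<zeta> - z))"
    using K' C1_wirtinger_continuous_on[OF f] supp
    by (intro integrable_compact_support[of _ R] continuous_on_mult) (auto simp: C1_wirtinger_def)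
  ultimately show ?thesis by (simp add: eq_neg_iff_add_eq_0)
qed

text \<open>The mass of the approximate identity. Its value pi is found in
  \<open>cauchy_const_eq\<close>, once Green's formula is known up to this factor.\<close>

definition cauchy_const :: complex where
  "cauchy_const = (LINT \<zeta>|lborel. cauchy_kernel_bar 1 \<zeta>)"

text \<open>The bump of radius 1 is 1 on the support of the kernel derivative, since 3/2 * e is at
  most 3/4. Moving the derivative to the bump leaves an integrand supported off the unit disc, where
  the kernel is 1/z for every such \<open>e\<close>.\<close>

lemma integral_cauchy_kernel_bar:
  assumes e: "0 < e" "e \<le> 1/2"
  shows "(LINT \<zeta>|lborel. cauchy_kernel_bar e \<zeta>) = cauchy_const"
proof -
  have supp: "bump 0 1 z = 0" if "z \<notin> cball 0 2" for z
    using that bump_eq_0[of 1 z 0] by auto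
  have "(LINT \<zeta>|lborel. cauchy_kernel_bar e \<zeta>) = (LINT \<zeta>|lborel. bump 0 1 \<zeta> * cauchy_kernel_bar e (\<zeta> - 0))"
  proof (rule Bochner_Integration.integral_cong)
    fix z :: complex
    show "cauchy_kernel_bar e z = bump 0 1 z * cauchy_kernel_bar e (z - 0)"
      using cauchy_kernel_far(2)[of e z] bump_eq_1[of z 0 1] e by (cases "norm z \<le> 1") auto
  qed auto
  also have "\<dots> = - (LINT \<zeta>|lborel. bump_bar 0 1 \<zeta> * cauchy_kernel e (\<zeta> - 0))"
  proof -
    have "(LINT \<zeta>|lborel. bump_bar 0 1 \<zeta> * cauchy_kernel e (\<zeta> - 0)) =
        - (LINT \<zeta>|lborel. bump 0 1 \<zeta> * cauchy_kernel_bar e (\<zeta> - 0))"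
      by (rule cauchy_kernel_by_parts[OF C1_wirtinger_bump supp e(1)])
    then show ?thesis by (simp only: minus_minus)
  qed
  also have "\<dots> = (LINT \<zeta>|lborel. - (bump_bar 0 1 \<zeta> * cauchy_kernel e (\<zeta> - 0)))"
    by simp
  also have "\<dots> = cauchy_const" unfolding cauchy_const_def
  proof (rule Bochner_Integration.integral_cong)
    fix z :: complex
    show "- (bump_bar 0 1 z * cauchy_kernel e (z - 0)) = cauchy_kernel_bar 1 z"
      using cauchy_kernel_far(1)[of e z] bump_eq_1(2)[of z 0 1] e
      by (cases "norm z \<le> 1") (auto simp: cauchy_kernel_bar_def)
  qed auto
  finally show ?thesis .
qed

text \<open>The constant is 9/e^2 times the area pi * (3/2 * e)^2. That \<open>e\<close> cancels is
  the scale invariance behind the limit \<open>e\<close> to 0.\<close>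

lemma cauchy_kernel_bar_integral_bound:
  assumes e: "0 < e" and m: "f \<in> borel_measurable borel"
    and M: "\<And>z. norm z \<le> 3/2 * e \<Longrightarrow> norm (f z :: complex) \<le> M"
  shows "norm (LINT \<zeta>|lborel. f \<zeta> * cauchy_kernel_bar e \<zeta>) \<le> M * (81 * pi / 4)"
proof -
  have M0: "0 \<le> M" using M[of 0] e norm_ge_zero[of "f 0"] by (simp del: norm_ge_zero)
  have I: "integrable lborel (\<lambda>\<zeta>::complex. indicator (cball 0 (3/2 * e)) \<zeta> *\<^sub>R (M * (9 / e\<^sup>2)))"
    by (intro borel_integrable_compact) auto
  have B: "norm (f z * cauchy_kernel_bar e z) \<le> indicator (cball 0 (3/2 * e)) z *\<^sub>R (M * (9 / e\<^sup>2))" for z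
  proof (cases "norm z \<le> 3/2 * e")
    case True
    have "norm (f z * cauchy_kernel_bar e z) \<le> M * (9 / e\<^sup>2)"
      unfolding norm_mult using norm_cauchy_kernel_bar_le[OF e, of z] M[OF True] M0 True
      by (intro mult_mono) auto
    then show ?thesis using True by simp
  next
    case False
    then show ?thesis using norm_cauchy_kernel_bar_le[OF e, of z] by simp
  qed
  have J: "integrable lborel (\<lambda>\<zeta>. f \<zeta> * cauchy_kernel_bar e \<zeta>)"
  proof (rule Bochner_Integration.integrable_bound[OF I])
    show "(\<lambda>\<zeta>. f \<zeta> * cauchy_kernel_bar e \<zeta>) \<in> borel_measurable lborel"
      using m borel_measurable_continuous_onI[OF continuous_on_cauchy_kernel(2)[OF e]]
      by measurable
    show "AE z in lborel. norm (f z * cauchy_kernel_bar e z) \<le>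
        norm (indicator (cball 0 (3/2 * e)) z *\<^sub>R (M * (9 / e\<^sup>2)))"
      by (rule AE_I2, rule order_trans[OF B]) (simp only: real_norm_def abs_ge_self)
  qed
  have "norm (LINT \<zeta>|lborel. f \<zeta> * cauchy_kernel_bar e \<zeta>) \<le>
      (LINT \<zeta>|lborel. norm (f \<zeta> * cauchy_kernel_bar e \<zeta>))"
    by (rule integral_norm_bound)
  also have "\<dots> \<le> (LINT \<zeta>::complex|lborel. indicator (cball 0 (3/2 * e)) \<zeta> *\<^sub>R (M * (9 / e\<^sup>2)))"
    by (intro integral_mono integrable_norm I J B)
  also have "\<dots> = M * (9 / e\<^sup>2) * (pi * (3/2 * e)\<^sup>2)"
    using e by (simp add: content_cball unit_ball_vol_2)
  also have "\<dots> = M * (81 * pi / 4)"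
    using e by (simp add: field_simps power2_eq_square)
  finally show ?thesis .
qed

lemma cauchy_kernel_bar_tendsto:
  assumes cont: "continuous_on UNIV f" and e: "\<And>n. e n > 0" "e \<longlonglongrightarrow> 0"
  shows "(\<lambda>n. LINT \<zeta>|lborel. f \<zeta> * cauchy_kernel_bar (e n) (\<zeta> - z)) \<longlonglongrightarrow> f z * cauchy_const"
proof (rule tendstoI)
  fix d :: real assume d: "d > 0"
  \<comment> \<open>The added 1 makes the final error strictly smaller than
    \<open>d\<close>.\<close>
  define c where "c = d / (81 * pi / 4 + 1)"
  have c: "c > 0" using d by (auto simp: c_def intro!: divide_pos_pos add_nonneg_pos)
  obtain s where s: "s > 0" "\<And>w. dist w z < s \<Longrightarrow> dist (f w) (f z) < c"
    using cont c unfolding continuous_on_iff by (metis UNIV_I)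
  \<comment> \<open>1/2 is the range of \<open>integral_cauchy_kernel_bar\<close>;
    \<open>s / 2\<close> keeps the support radius 3/2 * e n below \<open>s\<close>.\<close>
  have "eventually (\<lambda>n. e n < min (1/2) (s / 2)) sequentially"
    using e(2) s(1) by (intro order_tendstoD) auto
  then show "eventually (\<lambda>n. dist (LINT \<zeta>|lborel. f \<zeta> * cauchy_kernel_bar (e n) (\<zeta> - z)) (f z * cauchy_const) < d) sequentially"
  proof eventually_elim
    case (elim n)
    have en: "e n > 0" "e n \<le> 1/2" using e elim by auto
    have fm: "(\<lambda>\<zeta>. f (\<zeta> + z)) \<in> borel_measurable borel" "f \<in> borel_measurable borel"
      using cont by (auto intro!: borel_measurable_continuous_onI continuous_on_compose2[OF cont] continuous_intros)
    have km: "cauchy_kernel_bar (e n) \<in> borel_measurable borel"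
      using continuous_on_cauchy_kernel(2)[OF en(1)] by (rule borel_measurable_continuous_onI)
    have ki: "integrable lborel (\<lambda>\<zeta>. h \<zeta> * cauchy_kernel_bar (e n) \<zeta>)"
      if "continuous_on UNIV h" for h
      using that continuous_on_cauchy_kernel(2)[OF en(1)] cauchy_kernel_far(2)[OF en(1)]
      by (intro integrable_compact_support[of _ "3/2 * e n"] continuous_intros) auto
    have "(\<lambda>\<zeta>. f \<zeta> * cauchy_kernel_bar (e n) (\<zeta> - z)) \<in> borel_measurable borel"
      using fm(2) km by measurable
    from integral_lborel_shift[OF this, of z]
    have "(LINT \<zeta>|lborel. f \<zeta> * cauchy_kernel_bar (e n) (\<zeta> - z)) =
        (LINT \<zeta>|lborel. f (\<zeta> + z) * cauchy_kernel_bar (e n) \<zeta>)" by simp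
    moreover have "f z * cauchy_const = (LINT \<zeta>|lborel. f z * cauchy_kernel_bar (e n) \<zeta>)"
      using integral_cauchy_kernel_bar[OF en] by simp
    moreover have "(LINT \<zeta>|lborel. f (\<zeta> + z) * cauchy_kernel_bar (e n) \<zeta>) -
        (LINT \<zeta>|lborel. f z * cauchy_kernel_bar (e n) \<zeta>) =
        (LINT \<zeta>|lborel. (f (\<zeta> + z) - f z) * cauchy_kernel_bar (e n) \<zeta>)"
      unfolding left_diff_distrib
      by (rule Bochner_Integration.integral_diff[symmetric];
          intro ki continuous_intros continuous_on_compose2[OF cont]) auto
    moreover have "norm (LINT \<zeta>|lborel. (f (\<zeta> + z) - f z) * cauchy_kernel_bar (e n) \<zeta>) \<le> c * (81 * pi / 4)"
    proof (rule cauchy_kernel_bar_integral_bound[OF en(1)])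
      fix w :: complex assume "norm w \<le> 3/2 * e n"
      then have "dist (w + z) z < s" using elim en by (auto simp: dist_norm)
      then show "norm (f (w + z) - f z) \<le> c" using s(2) by (fastforce simp: dist_norm)
    qed (use fm in measurable)
    moreover have "c * (81 * pi / 4) < d"
      using d by (simp add: c_def field_simps add_pos_pos)
    ultimately show ?case unfolding dist_norm by (simp only:)
  qed
qed

text \<open>Dyadic discs replace polar coordinates: if |z| lies between 2^(-k-1) and 2^(-k), then
  1/|z| is at most 2^(k+1), and the areas of the discs turn the sum into a geometric series.\<close>

lemma nn_integral_inverse_norm_finite:
  "(\<integral>\<^sup>+z. ennreal (indicator (cball 0 1) z * inverse (norm (z::complex))) \<partial>lborel) < \<infinity>"
proof -
  have le_suminf: "f j \<le> suminf f" for f :: "nat \<Rightarrow> ennreal" and j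
    using sum_le_suminf[of f "{j}"] by simp
  have "(\<integral>\<^sup>+z. ennreal (indicator (cball 0 1) z * inverse (norm (z::complex))) \<partial>lborel) \<le>
     (\<integral>\<^sup>+z. (\<Sum>k. ennreal (2 ^ Suc k) * indicator (cball 0 ((1/2) ^ k)) (z::complex)) \<partial>lborel)"
  proof (rule nn_integral_mono)
    fix z :: complex
    show "ennreal (indicator (cball 0 1) z * inverse (norm z)) \<le>
        (\<Sum>k. ennreal (2 ^ Suc k) * indicator (cball 0 ((1/2) ^ k)) z)"
    proof (cases "z = 0 \<or> norm z > 1")
      case False
      then have z: "0 < norm z" "norm z \<le> 1" by auto
      have ex: "\<exists>k. (1/2) ^ k < norm z"
        using real_arch_pow_inv[OF z(1), of "1/2"] by auto
      define k where "k = (LEAST k. (1/2) ^ k < norm z)"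
      have k: "(1/2) ^ k < norm z" "\<And>j. j < k \<Longrightarrow> norm z \<le> (1/2) ^ j"
        unfolding k_def using LeastI_ex[OF ex] not_less_Least[of _ "\<lambda>k. (1/2) ^ k < norm z"]
        by (simp_all add: not_less)
      have "k \<noteq> 0" using k(1) z by (intro notI) simp
      then obtain j where j: "k = Suc j" by (cases k) auto
      have "inverse (norm z) \<le> inverse ((1/2) ^ k)"
        using k(1) by (intro le_imp_inverse_le) auto
      also have "\<dots> = 2 ^ Suc j" by (simp add: j power_divide field_simps)
      finally have le: "inverse (norm z) \<le> 2 ^ Suc j" .
      have zj: "z \<in> cball 0 ((1/2) ^ j)" "z \<in> cball 0 1" using k(2)[of j] j z by auto
      have "ennreal (indicator (cball 0 1) z * inverse (norm z)) \<le>
          ennreal (2 ^ Suc j) * indicator (cball 0 ((1/2) ^ j)) z"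
        unfolding indicator_simps(1)[OF zj(1)] indicator_simps(1)[OF zj(2)] mult_1 mult_1_right
        by (rule ennreal_leI[OF le])
      also have "\<dots> \<le> (\<Sum>k. ennreal (2 ^ Suc k) * indicator (cball 0 ((1/2) ^ k)) z)"
        by (rule le_suminf)
      finally show ?thesis .
    qed auto
  qed
  also have "\<dots> = (\<Sum>k. ennreal (2 ^ Suc k) * emeasure lborel (cball (0::complex) ((1/2) ^ k)))"
  proof -
    have [measurable]: "cball (0::complex) ((1/2) ^ k) \<in> sets borel" for k :: nat by simp
    show ?thesis
      by (subst nn_integral_suminf) (measurable, simp add: nn_integral_cmult_indicator)
  qed
  also have "\<dots> = (\<Sum>k. ennreal (2 * pi * (1/2) ^ k))"
  proof (rule suminf_cong)
    fix k
    have "2 ^ Suc k * (pi * ((1/2) ^ k)\<^sup>2) = 2 * pi * (1/2) ^ k"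
      by (simp add: power2_eq_square power_divide field_simps)
    then show "ennreal (2 ^ Suc k) * emeasure lborel (cball (0::complex) ((1/2) ^ k)) =
        ennreal (2 * pi * (1/2) ^ k)"
      by (simp add: emeasure_cball unit_ball_vol_2 ennreal_mult[symmetric])
  qed
  also have "\<dots> = ennreal (\<Sum>k. 2 * pi * (1/2) ^ k)"
    by (rule suminf_ennreal2) (auto intro!: summable_mult summable_geometric)
  also have "\<dots> < \<infinity>" by simp
  finally show ?thesis .
qed

text \<open>Within distance 1 of \<open>c\<close> a translate of the integrand over the unit disc is
  the bound, elsewhere 1 is; neither contribution depends on \<open>c\<close>. This uniformity makes
  the double integral along a path finite.\<close>

lemma nn_integral_inverse_dist_bound:
  obtains M :: ennreal where "M < \<infinity>"
    "\<And>c::complex. (\<integral>\<^sup>+z. ennreal (indicator (cball 0 R) z * inverse (norm (z - c))) \<partial>lborel) \<le> M"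
proof
  have [measurable]: "cball (0::complex) R \<in> sets borel" "cball (0::complex) 1 \<in> sets borel" by simp_all
  let ?J = "\<lambda>z::complex. ennreal (indicator (cball 0 1) z * inverse (norm z))"
  let ?M = "(\<integral>\<^sup>+z. ?J z \<partial>lborel) + emeasure lborel (cball (0::complex) R)"
  show "?M < \<infinity>"
    using nn_integral_inverse_norm_finite emeasure_lborel_cball_finite by auto
  fix c :: complex
  have "(\<integral>\<^sup>+z. ennreal (indicator (cball 0 R) z * inverse (norm (z - c))) \<partial>lborel) \<le>
        (\<integral>\<^sup>+z. ?J (z + (- c)) + indicator (cball 0 R) z \<partial>lborel)"
  proof (rule nn_integral_mono)
    fix z :: complex
    show "ennreal (indicator (cball 0 R) z * inverse (norm (z - c))) \<le> ?J (z + (- c)) + indicator (cball 0 R) z"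
    proof (cases "norm (z - c) \<le> 1")
      case True then show ?thesis by (auto simp: indicator_def)
    next
      case False
      then have "inverse (norm (z - c)) \<le> 1" by (intro inverse_le_1_iff[THEN iffD2]) auto
      then show ?thesis using False by (auto simp: indicator_def)
    qed
  qed
  also have "\<dots> = (\<integral>\<^sup>+z. ?J (z + (- c)) \<partial>lborel) + emeasure lborel (cball (0::complex) R)"
    by (subst nn_integral_add) (simp_all add: nn_integral_indicator)
  also have "(\<integral>\<^sup>+z. ?J (z + (- c)) \<partial>lborel) = (\<integral>\<^sup>+z. ?J z \<partial>lborel)"
    by (rule nn_integral_lborel_shift) measurable
  finally show "(\<integral>\<^sup>+z. ennreal (indicator (cball 0 R) z * inverse (norm (z - c))) \<partial>lborel) \<le> ?M" .
qed

text \<open>Points with \<open>\<gamma> t = \<zeta>\<close> cause no trouble: both the kernel and the junk value of \<open>1 / 0\<close>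
  are 0 there.\<close>

lemma cauchy_pompeiu_path:
  fixes g \<gamma> :: "real \<Rightarrow> complex"
  assumes f: "C1_wirtinger UNIV f a b" and supp: "\<And>z. z \<notin> cball 0 R \<Longrightarrow> f z = 0"
    and m: "g \<in> borel_measurable borel" "\<gamma> \<in> borel_measurable borel"
    and B: "\<And>t. norm (g t) \<le> B" and g0: "\<And>t. t \<notin> {0..1} \<Longrightarrow> g t = 0"
  shows "cauchy_const * (LINT t|lborel. f (\<gamma> t) * g t) =
         (LINT \<zeta>|lborel. b \<zeta> * (LINT t|lborel. 1 / (\<gamma> t - \<zeta>) * g t))"
proof -
  have b0: "\<And>z. z \<notin> cball 0 R \<Longrightarrow> b z = 0" using C1_wirtinger_support(2)[OF f supp] by auto
  have cf: "continuous_on UNIV f" "continuous_on UNIV b"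
    using f C1_wirtinger_continuous_on[OF f] by (auto simp: C1_wirtinger_def)
  have [measurable]: "f \<in> borel_measurable borel" "b \<in> borel_measurable borel"
    using cf by (auto intro!: borel_measurable_continuous_onI)
  note [measurable] = m
  obtain Mf where Mf: "Mf > 0" "\<And>z. norm (f z) \<le> Mf" using bounded_compact_support[OF cf(1) supp] by metis
  obtain Mb where Mb: "Mb > 0" "\<And>z. norm (b z) \<le> Mb" using bounded_compact_support[OF cf(2) b0] by metis
  have B0: "0 \<le> B" using B[of 0] norm_ge_zero order_trans by blast
  define e :: "nat \<Rightarrow> real" where "e n = inverse (real (Suc n))" for n
  have e: "\<And>n. e n > 0" "e \<longlonglongrightarrow> 0"
    using LIMSEQ_inverse_real_of_nat unfolding e_def[abs_def] by auto
  have [measurable]: "cauchy_kernel (e n) \<in> borel_measurable borel"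
      "cauchy_kernel_bar (e n) \<in> borel_measurable borel" for n
    using continuous_on_cauchy_kernel[OF e(1)] by (auto intro!: borel_measurable_continuous_onI)
  define H where "H n = (\<lambda>(t, \<zeta>). g t * (b \<zeta> * cauchy_kernel (e n) (\<zeta> - \<gamma> t)))" for n
  define H0 where "H0 = (\<lambda>(t, \<zeta>). g t * (b \<zeta> * inverse (\<zeta> - \<gamma> t)))"
  \<comment> \<open>Integrable on the product because its inner integral is bounded uniformly in
    \<open>t\<close>; it dominates all \<open>H n\<close>.\<close>
  define w where "w = (\<lambda>(t, \<zeta>). indicator {0..1} t * (B * Mb) * (indicator (cball 0 R) \<zeta> * inverse (norm (\<zeta> - \<gamma> t))))"
  have [measurable]: "cball (0::complex) R \<in> sets borel" by simp
  have wm [measurable]: "w \<in> borel_measurable (lborel \<Otimes>\<^sub>M lborel)" unfolding w_def by measurable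
  have w0: "0 \<le> w p" for p using B0 Mb by (cases p) (auto simp: w_def)
  have wint: "integrable (lborel \<Otimes>\<^sub>M lborel) w"
  proof (rule integrableI_bounded)
    obtain M where M: "M < \<infinity>"
      "\<And>c::complex. (\<integral>\<^sup>+z. ennreal (indicator (cball 0 R) z * inverse (norm (z - c))) \<partial>lborel) \<le> M"
      using nn_integral_inverse_dist_bound by metis
    have "(\<integral>\<^sup>+p. ennreal (norm (w p)) \<partial>(lborel \<Otimes>\<^sub>M lborel)) =
        (\<integral>\<^sup>+t. (\<integral>\<^sup>+\<zeta>. ennreal (norm (w (t, \<zeta>))) \<partial>lborel) \<partial>lborel)"
      by (rule lborel.nn_integral_fst[symmetric]) measurable
    also have "\<dots> \<le> (\<integral>\<^sup>+t. (ennreal (B * Mb) * M) * indicator {0..1::real} t \<partial>lborel)"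
    proof (rule nn_integral_mono)
      fix t :: real
      have "(\<integral>\<^sup>+\<zeta>. ennreal (norm (w (t, \<zeta>))) \<partial>lborel) =
         (\<integral>\<^sup>+\<zeta>. ennreal (indicator {0..1} t * (B * Mb)) * ennreal (indicator (cball 0 R) \<zeta> * inverse (norm (\<zeta> - \<gamma> t))) \<partial>lborel)"
        using w0 B0 Mb(1) by (intro nn_integral_cong) (simp add: w_def ennreal_mult[symmetric])
      also have "\<dots> = ennreal (indicator {0..1} t * (B * Mb)) * (\<integral>\<^sup>+\<zeta>. ennreal (indicator (cball 0 R) \<zeta> * inverse (norm (\<zeta> - \<gamma> t))) \<partial>lborel)"
        by (rule nn_integral_cmult) measurable
      also have "\<dots> \<le> ennreal (indicator {0..1} t * (B * Mb)) * M"
        by (intro mult_left_mono M(2)) auto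
      finally show "(\<integral>\<^sup>+\<zeta>. ennreal (norm (w (t, \<zeta>))) \<partial>lborel) \<le> (ennreal (B * Mb) * M) * indicator {0..1} t"
        by (auto simp: indicator_def)
    qed
    also have "\<dots> = ennreal (B * Mb) * M"
      by (subst nn_integral_cmult_indicator) auto
    also have "\<dots> < \<infinity>" using M(1) by (simp add: ennreal_mult_less_top)
    finally show "(\<integral>\<^sup>+p. ennreal (norm (w p)) \<partial>(lborel \<Otimes>\<^sub>M lborel)) < \<infinity>" .
  qed measurable
  have Hm: "H n \<in> borel_measurable (lborel \<Otimes>\<^sub>M lborel)" for n unfolding H_def by measurable
  have H0m: "H0 \<in> borel_measurable (lborel \<Otimes>\<^sub>M lborel)" unfolding H0_def by measurable
  have Hb: "norm (H n p) \<le> w p" for n p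
  proof (cases p)
    case (Pair t \<zeta>)
    have "norm (g t * (b \<zeta> * cauchy_kernel (e n) (\<zeta> - \<gamma> t))) \<le> B * (Mb * inverse (norm (\<zeta> - \<gamma> t)))"
      unfolding norm_mult using B0 Mb
      by (intro mult_mono B Mb norm_cauchy_kernel_le mult_nonneg_nonneg) auto
    then show ?thesis using Pair g0[of t] b0[of \<zeta>] w0[of p]
      by (cases "t \<in> {0..1} \<and> \<zeta> \<in> cball 0 R") (auto simp: H_def w_def mult.assoc)
  qed
  have Hlim: "(\<lambda>n. H n p) \<longlonglongrightarrow> H0 p" for p
  proof (cases p)
    case (Pair t \<zeta>)
    show ?thesis
    proof (cases "\<zeta> = \<gamma> t")
      case True
      then show ?thesis by (simp add: Pair H_def H0_def cauchy_kernel_def)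
    next
      case False
      have "eventually (\<lambda>n. e n < 2/3 * norm (\<zeta> - \<gamma> t)) sequentially"
        using e(2) False by (intro order_tendstoD) auto
      then have "eventually (\<lambda>n. H n p = H0 p) sequentially"
        by eventually_elim (use e(1) in \<open>simp add: Pair H_def H0_def cauchy_kernel_far\<close>)
      then show ?thesis by (rule tendsto_eventually)
    qed
  qed
  have Hint: "integrable (lborel \<Otimes>\<^sub>M lborel) (H n)" for n
    by (rule Bochner_Integration.integrable_bound[OF wint Hm]) (use Hb w0 in auto)
  have H0int: "integrable (lborel \<Otimes>\<^sub>M lborel) H0"
    by (rule integrable_dominated_convergence[where s=H, OF H0m Hm wint]) (use Hb Hlim in auto)
  have "(\<lambda>n. integral\<^sup>L (lborel \<Otimes>\<^sub>M lborel) (H n)) \<longlonglongrightarrow> integral\<^sup>L (lborel \<Otimes>\<^sub>M lborel) H0"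
    by (rule integral_dominated_convergence[where s=H, OF H0m Hm wint]) (use Hb Hlim in auto)
  moreover have "(\<lambda>n. integral\<^sup>L (lborel \<Otimes>\<^sub>M lborel) (H n)) \<longlonglongrightarrow> - (cauchy_const * (LINT t|lborel. f (\<gamma> t) * g t))"
  proof -
    \<comment> \<open>Inner integration over the plane: by parts, the kernel turns into the
      approximate identity centred at \<open>\<gamma> t\<close>.\<close>
    have eq: "integral\<^sup>L (lborel \<Otimes>\<^sub>M lborel) (H n) =
        (LINT t|lborel. - (g t * (LINT \<zeta>|lborel. f \<zeta> * cauchy_kernel_bar (e n) (\<zeta> - \<gamma> t))))" for n
    proof -
      have "integral\<^sup>L (lborel \<Otimes>\<^sub>M lborel) (H n) = (LINT t|lborel. LINT \<zeta>|lborel. H n (t, \<zeta>))"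
        by (rule lborel_pair.integral_fst'[OF Hint, symmetric])
      also have "\<dots> = (LINT t|lborel. g t * (LINT \<zeta>|lborel. b \<zeta> * cauchy_kernel (e n) (\<zeta> - \<gamma> t)))"
        by (simp add: H_def)
      also have "\<dots> = (LINT t|lborel. - (g t * (LINT \<zeta>|lborel. f \<zeta> * cauchy_kernel_bar (e n) (\<zeta> - \<gamma> t))))"
        using cauchy_kernel_by_parts[OF f supp e(1)] by simp
      finally show ?thesis .
    qed
    have "(\<lambda>n. LINT t|lborel. - (g t * (LINT \<zeta>|lborel. f \<zeta> * cauchy_kernel_bar (e n) (\<zeta> - \<gamma> t))))
        \<longlonglongrightarrow> (LINT t|lborel. - (g t * (f (\<gamma> t) * cauchy_const)))"
    proof (rule integral_dominated_convergence[where w="\<lambda>t. indicator {0..1} t *\<^sub>R (B * (Mf * (81 * pi / 4)))"])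
      show "integrable lborel (\<lambda>t::real. indicator {0..1} t *\<^sub>R (B * (Mf * (81 * pi / 4))))"
        by (intro borel_integrable_compact) auto
      show "(\<lambda>t. - (g t * (LINT \<zeta>|lborel. f \<zeta> * cauchy_kernel_bar (e n) (\<zeta> - \<gamma> t)))) \<in> borel_measurable lborel" for n
        by measurable
      show "(\<lambda>t. - (g t * (f (\<gamma> t) * cauchy_const))) \<in> borel_measurable lborel"
        by measurable
      show "AE t in lborel. (\<lambda>n. - (g t * (LINT \<zeta>|lborel. f \<zeta> * cauchy_kernel_bar (e n) (\<zeta> - \<gamma> t))))
          \<longlonglongrightarrow> - (g t * (f (\<gamma> t) * cauchy_const))"
        by (intro AE_I2 tendsto_intros cauchy_kernel_bar_tendsto cf e)
      show "AE t in lborel. norm (- (g t * (LINT \<zeta>|lborel. f \<zeta> * cauchy_kernel_bar (e n) (\<zeta> - \<gamma> t))))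
          \<le> indicator {0..1} t *\<^sub>R (B * (Mf * (81 * pi / 4)))" for n
      proof (rule AE_I2)
        fix t
        have "(\<lambda>\<zeta>. f \<zeta> * cauchy_kernel_bar (e n) (\<zeta> - \<gamma> t)) \<in> borel_measurable borel" by measurable
        from integral_lborel_shift[OF this, of "\<gamma> t"]
        have "norm (LINT \<zeta>|lborel. f \<zeta> * cauchy_kernel_bar (e n) (\<zeta> - \<gamma> t)) \<le> Mf * (81 * pi / 4)"
          using cauchy_kernel_bar_integral_bound[OF e(1), of "\<lambda>\<zeta>. f (\<zeta> + \<gamma> t)" n Mf] Mf(2)
          by (simp add: measurable_compose[of "\<lambda>\<zeta>. \<zeta> + \<gamma> t" borel borel f])
        then have "norm (- (g t * (LINT \<zeta>|lborel. f \<zeta> * cauchy_kernel_bar (e n) (\<zeta> - \<gamma> t)))) \<le> B * (Mf * (81 * pi / 4))"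
          unfolding norm_minus_cancel norm_mult using B B0 by (intro mult_mono) auto
        then show "norm (- (g t * (LINT \<zeta>|lborel. f \<zeta> * cauchy_kernel_bar (e n) (\<zeta> - \<gamma> t))))
          \<le> indicator {0..1} t *\<^sub>R (B * (Mf * (81 * pi / 4)))"
          using g0[of t] by (cases "t \<in> {0..1}") auto
      qed
    qed
    also have "(LINT t|lborel. - (g t * (f (\<gamma> t) * cauchy_const))) = - (cauchy_const * (LINT t|lborel. f (\<gamma> t) * g t))"
      by (simp add: mult_ac flip: integral_mult_right_zero)
    finally show ?thesis by (simp only: eq)
  qed
  ultimately have "integral\<^sup>L (lborel \<Otimes>\<^sub>M lborel) H0 = - (cauchy_const * (LINT t|lborel. f (\<gamma> t) * g t))"
    by (rule LIMSEQ_unique)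
  \<comment> \<open>Inner integration over the path: for fixed \<zeta> it is a Cauchy
    integral.\<close>
  moreover have "integral\<^sup>L (lborel \<Otimes>\<^sub>M lborel) H0 = - (LINT \<zeta>|lborel. b \<zeta> * (LINT t|lborel. 1 / (\<gamma> t - \<zeta>) * g t))"
  proof -
    have "integral\<^sup>L (lborel \<Otimes>\<^sub>M lborel) H0 = (LINT \<zeta>|lborel. LINT t|lborel. H0 (t, \<zeta>))"
      using lborel_pair.integral_snd[of "\<lambda>t \<zeta>. H0 (t, \<zeta>)"] H0int by simp
    also have "\<dots> = (LINT \<zeta>|lborel. LINT t|lborel. - (b \<zeta> * (1 / (\<gamma> t - \<zeta>) * g t)))"
    proof -
      have "g t * (b \<zeta> * inverse (\<zeta> - \<gamma> t)) = - (b \<zeta> * (1 / (\<gamma> t - \<zeta>) * g t))" for t \<zeta>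
        by (metis (no_types, lifting) divide_inverse inverse_minus_eq minus_diff_eq mult.commute
            mult.left_commute mult_1 mult_minus_right)
      then show ?thesis by (simp add: H0_def)
    qed
    finally show ?thesis
      by (simp only: Bochner_Integration.integral_minus integral_mult_right_zero)
  qed
  ultimately show ?thesis by simp
qed

section \<open>Piecewise smooth paths\<close>

text \<open>A bounded Borel version of the derivative of \<open>\<gamma>\<close>, extended by 0.
  With it contour integrals become Lebesgue integrals over the real line, ready for Fubini and
  dominated convergence.\<close>

definition path_density :: "(real \<Rightarrow> complex) \<Rightarrow> (real \<Rightarrow> complex) \<Rightarrow> bool" where
  "path_density \<gamma> g \<longleftrightarrow> g \<in> borel_measurable borel \<and> (\<exists>B. \<forall>t. norm (g t) \<le> B) \<and>
     (\<forall>t. t \<notin> {0..1} \<longrightarrow> g t = 0) \<and>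
     (\<exists>S. finite S \<and> (\<forall>t\<in>{0..1} - S. (\<gamma> has_vector_derivative g t) (at t)))"

text \<open>The extra point \<open>t 0\<close> covers \<open>m = 0\<close>, where the union is empty
  but the interval is a point.\<close>

lemma partition_cover:
  fixes t :: "nat \<Rightarrow> real"
  assumes "\<And>k. k < m \<Longrightarrow> t k < t (Suc k)"
  shows "{t 0..t m} = insert (t 0) (\<Union>k<m. {t k..t (Suc k)})"
  using assms
proof (induction m)
  case (Suc m)
  have le: "t 0 \<le> t m"
  proof -
    have "k \<le> m \<Longrightarrow> t 0 \<le> t k" for k
    proof (induction k)
      case (Suc k)
      then show ?case using Suc.prems Suc.IH \<open>\<And>k. k < Suc m \<Longrightarrow> t k < t (Suc k)\<close>[of k] by simp
    qed simp
    then show ?thesis by simp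
  qed
  have "{t 0..t (Suc m)} = {t 0..t m} \<union> {t m..t (Suc m)}"
    using le Suc.prems[of m] by (auto simp: ivl_disj_un_two_touch)
  then show ?case using Suc by (auto simp: lessThan_Suc)
qed auto

text \<open>\<open>U\<close> is the union of the open pieces and \<open>S\<close> consists of break
  points. The bound on the derivative comes from its continuous one-sided extension to each closed
  piece.\<close>

lemma piecewise_smooth_path_cases:
  assumes "piecewise_smooth_path \<gamma>"
  obtains S U B where "finite S" "open U" "{0..1} - S \<subseteq> U" "U \<subseteq> {0..1}"
    "continuous_on {0..1} \<gamma>" "\<And>s. s \<in> U \<Longrightarrow> (\<gamma> has_vector_derivative vector_derivative \<gamma> (at s)) (at s)"
    "continuous_on U (\<lambda>s. vector_derivative \<gamma> (at s))"
    "\<And>s. s \<in> U \<Longrightarrow> vector_derivative \<gamma> (at s) \<noteq> 0 \<and> norm (vector_derivative \<gamma> (at s)) \<le> B"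
proof -
  obtain m t where t: "t 0 = 0" "t m = 1" "\<And>k. k < m \<Longrightarrow> t k < t (Suc k)"
    and "\<forall>k<m. \<exists>D. continuous_on {t k..t (Suc k)} D \<and>
       (\<forall>x\<in>{t k..t (Suc k)}. D x \<noteq> 0 \<and>
          (\<gamma> has_vector_derivative D x) (at x within {t k..t (Suc k)}))"
    using assms unfolding piecewise_smooth_path_def by blast
  then obtain D where D: "\<And>k. k < m \<Longrightarrow> continuous_on {t k..t (Suc k)} (D k)"
    "\<And>k x. k < m \<Longrightarrow> x \<in> {t k..t (Suc k)} \<Longrightarrow> D k x \<noteq> 0"
    "\<And>k x. k < m \<Longrightarrow> x \<in> {t k..t (Suc k)} \<Longrightarrow> (\<gamma> has_vector_derivative D k x) (at x within {t k..t (Suc k)})"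
    by metis
  define U where "U = (\<Union>k<m. {t k<..<t (Suc k)})"
  define S where "S = {0..1} - U"
  have cov: "{0..1} = insert 0 (\<Union>k<m. {t k..t (Suc k)})"
    using partition_cover[of m t] t by simp
  have m0: "m > 0" using t by (intro gr0I) auto
  have cov': "{0..1} = (\<Union>k<m. {t k..t (Suc k)})"
    using cov t(1) t(3)[OF m0] m0 by (auto intro!: bexI[of _ 0])
  have "S \<subseteq> t ` {..m}"
  proof
    fix s assume "s \<in> S"
    then obtain k where k: "k < m" "s \<in> {t k..t (Suc k)}" "s \<notin> {t k<..<t (Suc k)}"
      unfolding S_def cov' U_def by blast
    then have "s = t k \<or> s = t (Suc k)" by auto
    then show "s \<in> t ` {..m}" using k(1) by auto
  qed
  then have finS: "finite S" by (rule finite_subset) auto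
  have US: "U \<subseteq> {0..1}" unfolding cov' U_def by (intro UN_mono) auto
  have vd: "(\<gamma> has_vector_derivative D k s) (at s)" if "k < m" "s \<in> {t k<..<t (Suc k)}" for k s
  proof -
    have "s \<in> {t k..t (Suc k)}" "at s within {t k..t (Suc k)} = at s"
      using that at_within_Icc_at by auto
    then show ?thesis using D(3)[OF that(1), of s] by simp
  qed
  have eq: "vector_derivative \<gamma> (at s) = D k s" if "k < m" "s \<in> {t k<..<t (Suc k)}" for k s
    using vd[OF that] by (rule vector_derivative_at)
  have "\<forall>k\<in>{..<m}. \<exists>B. \<forall>x\<in>{t k..t (Suc k)}. norm (D k x) \<le> B"
  proof
    fix k assume "k \<in> {..<m}"
    then have "compact (D k ` {t k..t (Suc k)})" using D(1) by (intro compact_continuous_image) auto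
    then show "\<exists>B. \<forall>x\<in>{t k..t (Suc k)}. norm (D k x) \<le> B"
      using compact_imp_bounded bounded_iff by (metis imageI)
  qed
  then obtain B where B: "\<And>k x. k < m \<Longrightarrow> x \<in> {t k..t (Suc k)} \<Longrightarrow> norm (D k x) \<le> B k"
    by (metis lessThan_iff)
  have cont: "continuous_on {0..1} \<gamma>"
    unfolding cov'
  proof (rule continuous_on_closed_Union)
    fix k assume k: "k \<in> {..<m}"
    show "continuous_on {t k..t (Suc k)} \<gamma>"
      unfolding continuous_on_eq_continuous_within
    proof
      fix x assume "x \<in> {t k..t (Suc k)}"
      from D(3)[OF _ this] k show "continuous (at x within {t k..t (Suc k)}) \<gamma>"
        by (auto intro: has_vector_derivative_continuous)
    qed
  qed auto
  show ?thesis
  proof (rule that[of S U "Max (B ` {..<m})"])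
    show "continuous_on U (\<lambda>s. vector_derivative \<gamma> (at s))"
      unfolding U_def
    proof (rule continuous_on_open_UN)
      fix k assume k: "k \<in> {..<m}"
      then have "continuous_on {t k<..<t (Suc k)} (D k)"
        using D(1)[of k] by (auto intro: continuous_on_subset)
      then show "continuous_on {t k<..<t (Suc k)} (\<lambda>s. vector_derivative \<gamma> (at s))"
        by (rule continuous_on_eq) (use eq k in auto)
    qed auto
    fix s assume "s \<in> U"
    then obtain k where k: "k < m" "s \<in> {t k<..<t (Suc k)}" unfolding U_def by blast
    show "(\<gamma> has_vector_derivative vector_derivative \<gamma> (at s)) (at s)"
      using vd[OF k] eq[OF k] by simp
    have "B k \<le> Max (B ` {..<m})" using k(1) by (intro Max_ge) auto
    then show "vector_derivative \<gamma> (at s) \<noteq> 0 \<and> norm (vector_derivative \<gamma> (at s)) \<le> Max (B ` {..<m})"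
      using D(2)[OF k(1), of s] B[OF k(1), of s] k(2) eq[OF k] by auto
  qed (use finS cont US in \<open>auto simp: S_def U_def\<close>)
qed

lemma piecewise_smooth_path_valid: "piecewise_smooth_path \<gamma> \<Longrightarrow> valid_path \<gamma>"
proof -
  assume "piecewise_smooth_path \<gamma>"
  then obtain S U where *: "finite S" "{0..1} - S \<subseteq> U" "continuous_on {0..1} \<gamma>"
    "\<And>s. s \<in> U \<Longrightarrow> (\<gamma> has_vector_derivative vector_derivative \<gamma> (at s)) (at s)"
    "continuous_on U (\<lambda>s. vector_derivative \<gamma> (at s))"
    by (rule piecewise_smooth_path_cases) blast
  have "\<gamma> C1_differentiable_on ({0..1} - S)"
    unfolding C1_differentiable_on_def
    by (rule exI[of _ "\<lambda>s. vector_derivative \<gamma> (at s)"])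
      (use *(2,4) continuous_on_subset[OF *(5,2)] in auto)
  then show "valid_path \<gamma>"
    using *(1,3) unfolding valid_path_def piecewise_C1_differentiable_on_def by blast
qed

lemma piecewise_smooth_path_density:
  assumes "piecewise_smooth_path \<gamma>"
  obtains g where "path_density \<gamma> g"
proof -
  obtain S U B where *: "finite S" "open U" "{0..1} - S \<subseteq> U" "U \<subseteq> {0..1}"
    "\<And>s. s \<in> U \<Longrightarrow> (\<gamma> has_vector_derivative vector_derivative \<gamma> (at s)) (at s)"
    "continuous_on U (\<lambda>s. vector_derivative \<gamma> (at s))"
    "\<And>s. s \<in> U \<Longrightarrow> vector_derivative \<gamma> (at s) \<noteq> 0 \<and> norm (vector_derivative \<gamma> (at s)) \<le> B"
    using piecewise_smooth_path_cases[OF assms] by metis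
  define g where "g s = indicator U s *\<^sub>R vector_derivative \<gamma> (at s)" for s
  show ?thesis
  proof
    have "g \<in> borel_measurable borel"
      unfolding g_def[abs_def] using *(2,6) by (intro borel_measurable_continuous_on_indicator) auto
    moreover have "norm (g s) \<le> max 0 B" for s
      using *(7)[of s] by (auto simp: g_def indicator_def)
    moreover have "g s = 0" if "s \<notin> {0..1}" for s
    proof -
      have "s \<notin> U" using that *(4) by blast
      then show ?thesis by (simp add: g_def)
    qed
    moreover have "(\<gamma> has_vector_derivative g s) (at s)" if "s \<in> {0..1} - S" for s
      using that *(3) *(5)[of s] by (auto simp: g_def)
    ultimately show "path_density \<gamma> g"
      unfolding path_density_def using *(1) by blast
  qed
qed

lemma path_density_contour_integral:
  assumes d: "path_density \<gamma> g" and p: "path \<gamma>" and f: "continuous_on (path_image \<gamma>) f"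
  shows "integrable lborel (\<lambda>t. f (\<gamma> t) * g t)"
    and "(f has_contour_integral (LINT t|lborel. f (\<gamma> t) * g t)) \<gamma>"
proof -
  obtain B S where g: "g \<in> borel_measurable borel" "\<And>t. norm (g t) \<le> B" "\<And>t. t \<notin> {0..1} \<Longrightarrow> g t = 0"
    "finite S" "\<And>t. t \<in> {0..1} - S \<Longrightarrow> (\<gamma> has_vector_derivative g t) (at t)"
    using d unfolding path_density_def by blast
  have cont: "continuous_on {0..1} (\<lambda>t. f (\<gamma> t))"
    using p f unfolding path_def path_image_def by (intro continuous_on_compose2[OF f]) (auto simp: path_image_def)
  have "bounded ((\<lambda>t. f (\<gamma> t)) ` {0..1})"
    by (intro compact_imp_bounded compact_continuous_image cont) auto
  then obtain M where M: "\<And>t. t \<in> {0..1} \<Longrightarrow> norm (f (\<gamma> t)) \<le> M"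
    unfolding bounded_iff by blast
  have m: "(\<lambda>t. indicator {0..1} t *\<^sub>R f (\<gamma> t)) \<in> borel_measurable borel"
    by (intro borel_measurable_continuous_on_indicator cont) auto
  have eq: "(indicator {0..1} t *\<^sub>R f (\<gamma> t)) * g t = f (\<gamma> t) * g t" for t
    using g(3)[of t] by (cases "t \<in> {0..1}") auto
  have M0: "0 \<le> M" by (rule order_trans[OF norm_ge_zero M[of 0]]) simp
  show int: "integrable lborel (\<lambda>t. f (\<gamma> t) * g t)"
  proof (rule integrableI_bounded_set[where A="{0..1}" and B="M * B"])
    have "(\<lambda>t. (indicator {0..1} t *\<^sub>R f (\<gamma> t)) * g t) \<in> borel_measurable lborel"
      using m g(1) by measurable
    then show "(\<lambda>t. f (\<gamma> t) * g t) \<in> borel_measurable lborel" unfolding eq .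
    show "AE t in lborel. t \<in> {0..1} \<longrightarrow> norm (f (\<gamma> t) * g t) \<le> M * B"
    proof (intro AE_I2 impI)
      fix t :: real assume "t \<in> {0..1}"
      then show "norm (f (\<gamma> t) * g t) \<le> M * B"
        unfolding norm_mult by (intro mult_mono M g(2) M0 norm_ge_zero)
    qed
  qed (use g(3) in auto)
  have "(\<lambda>t. if t \<in> {0..1} then f (\<gamma> t) * g t else 0) = (\<lambda>t. f (\<gamma> t) * g t)"
    using g(3) by auto
  then have "((\<lambda>t. if t \<in> {0..1} then f (\<gamma> t) * g t else 0) has_integral
      (LINT t|lborel. f (\<gamma> t) * g t)) UNIV"
    using has_integral_integral_lborel[OF int] by simp
  then have "((\<lambda>t. f (\<gamma> t) * g t) has_integral (LINT t|lborel. f (\<gamma> t) * g t)) {0..1}"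
    by (rule has_integral_restrict_UNIV[THEN iffD1])
  then show "(f has_contour_integral (LINT t|lborel. f (\<gamma> t) * g t)) \<gamma>"
    unfolding has_contour_integral
    by (rule has_integral_spike_finite[OF g(4), rotated]) (simp only: vector_derivative_at[OF g(5)])
qed

lemma path_density_contour_integral_eq:
  "path_density \<gamma> g \<Longrightarrow> path \<gamma> \<Longrightarrow> continuous_on (path_image \<gamma>) f \<Longrightarrow>
    contour_integral \<gamma> f = (LINT t|lborel. f (\<gamma> t) * g t)"
  by (intro contour_integral_unique path_density_contour_integral)

text \<open>The integral identity for the winding number holds off the path only; as the path is a
  null set, this is enough under an area integral.\<close>

lemma piecewise_smooth_path_null:
  assumes "piecewise_smooth_path \<gamma>"
  shows "path_image \<gamma> \<in> null_sets lborel"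
proof -
  obtain S U where *: "finite S" "{0..1} - S \<subseteq> U" "U \<subseteq> {0..1}" "continuous_on {0..1} \<gamma>"
    "\<And>s. s \<in> U \<Longrightarrow> (\<gamma> has_vector_derivative vector_derivative \<gamma> (at s)) (at s)"
    using piecewise_smooth_path_cases[OF assms] by metis
  have "negligible (\<gamma> ` U)"
  proof (rule negligible_differentiable_image_lowdim)
    show "\<gamma> differentiable_on U"
      using *(5) unfolding differentiable_on_def
      by (meson differentiable_at_withinI differentiableI_vector)
  qed simp
  moreover have "negligible (\<gamma> ` S)" using *(1) by (intro negligible_finite) auto
  moreover have "path_image \<gamma> \<subseteq> \<gamma> ` U \<union> \<gamma> ` S" using *(2) by (auto simp: path_image_def)
  ultimately have "negligible (path_image \<gamma>)" by (meson negligible_Un negligible_subset)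
  moreover have "path_image \<gamma> \<in> sets lborel"
    using *(4) by (simp add: path_def compact_path_image borel_compact)
  ultimately show ?thesis
    by (simp add: negligible_iff_null_sets null_sets_completion_iff)
qed

section \<open>Green's formula for compactly supported functions\<close>

lemma green_compact_support_aux:
  assumes \<gamma>: "piecewise_smooth_path \<gamma>" and \<Omega>: "\<Omega> \<in> sets borel"
    and wn: "\<And>\<zeta>. \<zeta> \<notin> path_image \<gamma> \<Longrightarrow> winding_number \<gamma> \<zeta> = indicator \<Omega> \<zeta>"
    and f: "C1_wirtinger UNIV f a b" and supp: "\<And>z. z \<notin> cball 0 R \<Longrightarrow> f z = 0"
  shows "cauchy_const * contour_integral \<gamma> f = 2 * pi * \<i> * (LINT \<zeta>:\<Omega>|lborel. b \<zeta>)"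
proof -
  have vp: "valid_path \<gamma>" using \<gamma> by (rule piecewise_smooth_path_valid)
  then have p: "path \<gamma>" by (rule valid_path_imp_path)
  obtain g where d: "path_density \<gamma> g" using piecewise_smooth_path_density[OF \<gamma>] by blast
  obtain B S where g: "g \<in> borel_measurable borel" "\<And>t. norm (g t) \<le> B" "\<And>t. t \<notin> {0..1} \<Longrightarrow> g t = 0"
    using d unfolding path_density_def by blast
  \<comment> \<open>Outside the unit interval \<open>\<gamma>\<close> is arbitrary and need not be
    measurable; there \<open>g\<close> is 0, so the change affects no integral.\<close>
  define \<gamma>' where "\<gamma>' t = indicator {0..1} t *\<^sub>R \<gamma> t" for t :: real
  have \<gamma>'m: "\<gamma>' \<in> borel_measurable borel"
    unfolding \<gamma>'_def[abs_def] using p by (intro borel_measurable_continuous_on_indicator) (auto simp: path_def)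
  have eq: "h (\<gamma>' t) * g t = h (\<gamma> t) * g t" for h t
    using g(3)[of t] by (cases "t \<in> {0..1}") (auto simp: \<gamma>'_def)
  have cf: "continuous_on (path_image \<gamma>) f"
    using C1_wirtinger_continuous_on[OF f] by (rule continuous_on_subset) auto
  have bm: "b \<in> borel_measurable borel"
    using f unfolding C1_wirtinger_def by (intro borel_measurable_continuous_onI) auto
  have "cauchy_const * contour_integral \<gamma> f = cauchy_const * (LINT t|lborel. f (\<gamma>' t) * g t)"
    unfolding eq path_density_contour_integral_eq[OF d p cf] ..
  also have "\<dots> = (LINT \<zeta>|lborel. b \<zeta> * (LINT t|lborel. 1 / (\<gamma>' t - \<zeta>) * g t))"
    by (rule cauchy_pompeiu_path[OF f supp g(1) \<gamma>'m g(2,3)])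
  \<comment> \<open>Off the path the inner integral is 2 pi i times the winding number.\<close>
  also have "\<dots> = (LINT \<zeta>|lborel. 2 * pi * \<i> * (indicator \<Omega> \<zeta> *\<^sub>R b \<zeta>))"
  proof (rule integral_cong_AE)
    show "AE \<zeta> in lborel. b \<zeta> * (LINT t|lborel. 1 / (\<gamma>' t - \<zeta>) * g t) = 2 * pi * \<i> * (indicator \<Omega> \<zeta> *\<^sub>R b \<zeta>)"
    proof (rule AE_I'[OF piecewise_smooth_path_null[OF \<gamma>]], rule subsetI, rule ccontr)
      fix \<zeta> assume z: "\<zeta> \<in> {\<zeta> \<in> space lborel. b \<zeta> * (LINT t|lborel. 1 / (\<gamma>' t - \<zeta>) * g t) \<noteq> 2 * pi * \<i> * (indicator \<Omega> \<zeta> *\<^sub>R b \<zeta>)}"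
        and n: "\<zeta> \<notin> path_image \<gamma>"
      have "continuous_on (path_image \<gamma>) (\<lambda>w. 1 / (w - \<zeta>))"
        using n by (auto intro!: continuous_intros)
      from path_density_contour_integral_eq[OF d p this]
      have "(LINT t|lborel. 1 / (\<gamma>' t - \<zeta>) * g t) = contour_integral \<gamma> (\<lambda>w. 1 / (w - \<zeta>))"
        by (simp only: eq[of "\<lambda>w. 1 / (w - \<zeta>)"])
      also have "\<dots> = 2 * pi * \<i> * indicator \<Omega> \<zeta>"
        using winding_number_valid_path[OF vp n] wn[OF n] by simp
      finally show False using z by (cases "\<zeta> \<in> \<Omega>") auto
    qed
    have [measurable]: "(\<lambda>\<zeta>. LINT t|lborel. 1 / (\<gamma>' t - \<zeta>) * g t) \<in> borel_measurable borel"
      using \<gamma>'m g(1) by measurable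
    show "(\<lambda>\<zeta>. b \<zeta> * (LINT t|lborel. 1 / (\<gamma>' t - \<zeta>) * g t)) \<in> borel_measurable lborel"
      using bm by measurable
    show "(\<lambda>\<zeta>. 2 * pi * \<i> * (indicator \<Omega> \<zeta> *\<^sub>R b \<zeta>)) \<in> borel_measurable lborel"
      using bm \<Omega> by measurable
  qed
  also have "\<dots> = 2 * pi * \<i> * (LINT \<zeta>:\<Omega>|lborel. b \<zeta>)"
    unfolding set_lebesgue_integral_def by (rule integral_mult_right_zero)
  finally show ?thesis .
qed

lemma piecewise_smooth_circlepath:
  assumes "r > 0" shows "piecewise_smooth_path (circlepath z r)"
proof -
  let ?D = "\<lambda>x. 2 * pi * \<i> * r * exp (2 * of_real pi * \<i> * of_real x)"
  have "continuous_on {0..1} ?D" by (intro continuous_intros)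
  moreover have "?D x \<noteq> 0 \<and> (circlepath z r has_vector_derivative ?D x) (at x within {0..1})" for x
    using assms has_vector_derivative_circlepath by simp
  ultimately show ?thesis
    unfolding piecewise_smooth_path_def
    by (intro exI[of _ 1] exI[of _ real]) (auto intro!: exI[of _ ?D])
qed

lemma winding_number_circlepath_indicator:
  assumes "r > 0" "\<zeta> \<notin> path_image (circlepath z r)"
  shows "winding_number (circlepath z r) \<zeta> = indicator (ball z r) \<zeta>"
proof (cases "\<zeta> \<in> ball z r")
  case True
  then show ?thesis by (simp add: winding_number_circlepath dist_norm norm_minus_commute)
next
  case False
  then have "\<zeta> \<notin> cball z r" using assms by auto
  then have "winding_number (circlepath z r) \<zeta> = 0"
    using assms(1) by (intro winding_number_zero_outside[of _ "cball z r"]) auto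
  then show ?thesis using False by simp
qed

text \<open>The conjugate function on the unit disc is the test case. On the circle it equals 1/z,
  so the contour integral is 2 pi i, while its d-bar derivative 1 integrates to the area pi. The
  bump only provides compact support.\<close>

lemma cauchy_const_eq: "cauchy_const = pi"
proof -
  have c: "C1_wirtinger UNIV cnj (\<lambda>_. 0) (\<lambda>_. 1)"
    unfolding C1_wirtinger_def by (auto intro!: bounded_linear_imp_has_derivative bounded_linear_cnj)
  have "cauchy_const * contour_integral (circlepath 0 1) (\<lambda>z. cnj z * bump 0 1 z) =
      2 * pi * \<i> * (LINT \<zeta>:ball 0 1|lborel. 1 * bump 0 1 \<zeta> + cnj \<zeta> * bump_bar 0 1 \<zeta>)"
  proof (rule green_compact_support_aux[OF piecewise_smooth_circlepath _ _ C1_wirtinger_mult[OF c C1_wirtinger_bump]])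
    show "cnj z * bump 0 1 z = 0" if "z \<notin> cball 0 2" for z
      using that bump_eq_0[of 1 z 0] by auto
  qed (auto intro: winding_number_circlepath_indicator)
  also have "(LINT \<zeta>:ball 0 1|lborel. 1 * bump 0 1 \<zeta> + cnj \<zeta> * bump_bar 0 1 \<zeta>) =
      (LINT \<zeta>:ball (0::complex) 1|lborel. 1)"
    by (rule set_lebesgue_integral_cong) (auto simp: bump_eq_1)
  also have "\<dots> = pi"
    by (simp add: set_lebesgue_integral_def content_ball unit_ball_vol_2 scaleR_conv_of_real)
  also have "contour_integral (circlepath 0 1) (\<lambda>z. cnj z * bump 0 1 z) =
      contour_integral (circlepath 0 1) (\<lambda>z. 1 / (z - 0))"
  proof (rule contour_integral_eq)
    fix z :: complex assume "z \<in> path_image (circlepath 0 1)"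
    then have "norm z = 1" by simp
    then show "cnj z * bump 0 1 z = 1 / (z - 0)"
      using complex_norm_square[of z] by (auto simp: bump_eq_1 eq_divide_eq mult.commute)
  qed
  also have "\<dots> = 2 * pi * \<i>"
    by (subst contour_integral_circlepath) auto
  finally show ?thesis by simp
qed

lemma green_compact_support:
  assumes \<gamma>: "piecewise_smooth_path \<gamma>" and \<Omega>: "\<Omega> \<in> sets borel"
    and wn: "\<And>\<zeta>. \<zeta> \<notin> path_image \<gamma> \<Longrightarrow> winding_number \<gamma> \<zeta> = indicator \<Omega> \<zeta>"
    and f: "C1_wirtinger UNIV f a b" and supp: "\<And>z. z \<notin> cball 0 R \<Longrightarrow> f z = 0"
  shows "contour_integral \<gamma> f = 2 * \<i> * (LINT \<zeta>:\<Omega>|lborel. b \<zeta>)"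
  using green_compact_support_aux[OF assms] by (simp add: cauchy_const_eq)

section \<open>The boundary near a smooth point\<close>

text \<open>The segment property from the theory of Sobolev spaces: one \<open>\<nu>\<close> must
  serve all points of the closure near \<open>p\<close>. Off the closure it holds vacuously for
  small \<open>d\<close>, and in the interior \<open>\<nu> = 0\<close> will do.\<close>

definition has_segment :: "complex set \<Rightarrow> complex \<Rightarrow> real \<Rightarrow> bool" where
  "has_segment \<Omega> p d \<longleftrightarrow> d > 0 \<and>
     (\<exists>\<nu>. \<forall>z\<in>closure \<Omega> \<inter> ball p d. \<forall>e. 0 < e \<and> e < d \<longrightarrow> z + of_real e * \<nu> \<in> \<Omega>)"

definition C1_closure ::
    "complex set \<Rightarrow> (complex \<Rightarrow> complex) \<Rightarrow> (complex \<Rightarrow> complex) \<Rightarrow> (complex \<Rightarrow> complex) \<Rightarrow> bool"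
  where
  "C1_closure \<Omega> f a b \<longleftrightarrow> continuous_on (closure \<Omega>) f \<and> continuous_on (closure \<Omega>) a \<and>
     continuous_on (closure \<Omega>) b \<and> C1_wirtinger \<Omega> f a b"

lemma C1_closure_mult:
  assumes "C1_closure \<Omega> f a b" "C1_wirtinger UNIV G a' b'"
  shows "C1_closure \<Omega> (\<lambda>z. f z * G z) (\<lambda>z. a z * G z + f z * a' z) (\<lambda>z. b z * G z + f z * b' z)"
  using assms C1_wirtinger_mult[of \<Omega> f a b G a' b'] C1_wirtinger_subset[OF assms(2), of \<Omega>]
    C1_wirtinger_continuous_on[OF assms(2)]
  unfolding C1_closure_def C1_wirtinger_def
  by (auto intro!: continuous_intros intro: continuous_on_subset)

locale jordan_domain =
  fixes \<gamma> :: "real \<Rightarrow> complex" and \<Omega> :: "complex set"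
  assumes bounded: "bounded \<Omega>" and opn: "open \<Omega>"
    and boundary: "positively_oriented_boundary \<gamma> \<Omega>"
begin

lemma piecewise_smooth: "piecewise_smooth_path \<gamma>"
  and simple: "simple_path \<gamma>"
  and closed_path: "pathfinish \<gamma> = pathstart \<gamma>"
  and path_image: "path_image \<gamma> = frontier \<Omega>"
  and winding: "z \<in> \<Omega> \<Longrightarrow> winding_number \<gamma> z = 1"
  using boundary unfolding positively_oriented_boundary_def by auto

lemma path: "path \<gamma>" using simple by (rule simple_path_imp_path)

lemma compact_closure: "compact (closure \<Omega>)"
  using bounded by (simp add: compact_closure)

lemma path_image_closure: "path_image \<gamma> \<subseteq> closure \<Omega>"
  by (auto simp: path_image frontier_def)

lemma disjoint_frontier: "\<Omega> \<inter> frontier \<Omega> = {}"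
  using opn by (simp add: frontier_def interior_open disjoint_iff)

lemma winding_outside: "z \<in> outside (path_image \<gamma>) \<Longrightarrow> winding_number \<gamma> z = 0"
  using path closed_path by (rule winding_number_zero_in_outside)

lemma disjoint_outside: "\<Omega> \<inter> outside (path_image \<gamma>) = {}"
  using winding winding_outside by fastforce

text \<open>Green's formula also needs winding number 0 off \<Omega>. The inside of the Jordan curve
  is connected, meets \<Omega> and avoids its frontier, hence lies in \<Omega>; what remains is the
  outside.\<close>

lemma winding_indicator:
  assumes "z \<notin> path_image \<gamma>"
  shows "winding_number \<gamma> z = indicator \<Omega> z"
proof (cases "z \<in> \<Omega>")
  case False
  note J = Jordan_inside_outside[OF simple closed_path]
  have conn: "connected (inside (path_image \<gamma>))"
    and un: "inside (path_image \<gamma>) \<union> outside (path_image \<gamma>) = - path_image \<gamma>"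
    using J by simp_all
  have "path_image \<gamma> \<noteq> {}" by simp
  then have "\<Omega> \<noteq> {}" using path_image by auto
  moreover have "\<Omega> \<subseteq> inside (path_image \<gamma>)"
    using un disjoint_outside disjoint_frontier unfolding path_image by blast
  ultimately have ne: "inside (path_image \<gamma>) \<inter> \<Omega> \<noteq> {}" by blast
  have "inside (path_image \<gamma>) \<inter> frontier \<Omega> = {}"
    using inside_no_overlap[of "path_image \<gamma>"] path_image by simp
  then have "inside (path_image \<gamma>) \<subseteq> \<Omega>"
    using connected_Int_frontier[OF conn ne] by blast
  then have "z \<in> outside (path_image \<gamma>)"
    using False assms un by blast
  then show ?thesis using False winding_outside by simp
qed (simp add: winding)

text \<open>\<open>F N\<close> straightens the boundary by moving from the curve along the normal
  \<open>N\<close>. Invariance of domain makes the images of open boxes open, so no inverse function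
  theorem is involved. The half boxes have connected images that avoid the frontier, so each lies in
  \<Omega> or misses it. Since both \<Omega> and the outside accumulate at the point, exactly one
  lies in \<Omega>, and the normal pointing to it is the required direction.\<close>

lemma segment_at_smooth_point:
  assumes U: "open U" "t0 \<in> U" "U \<subseteq> {0..1}"
    and der: "\<And>s. s \<in> U \<Longrightarrow> (\<gamma> has_vector_derivative D s) (at s)"
    and cont: "continuous_on U D" and nz: "D t0 \<noteq> 0"
  shows "\<exists>d. has_segment \<Omega> (\<gamma> t0) d"
proof -
  have "continuous_on U (\<lambda>s. Re (D s * cnj (D t0)))"
    by (intro continuous_intros cont)
  then have op: "open (U \<inter> (\<lambda>s. Re (D s * cnj (D t0))) -` {0<..})"
    by (rule continuous_open_preimage) (use U in auto)
  have "Re (D t0 * cnj (D t0)) > 0"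
    using nz by (metis Re_complex_of_real complex_norm_square of_real_power zero_less_norm_iff zero_less_power)
  then have "t0 \<in> U \<inter> (\<lambda>s. Re (D s * cnj (D t0))) -` {0<..}"
    using U by auto
  then obtain d where d: "d > 0" "ball t0 d \<subseteq> U \<inter> (\<lambda>s. Re (D s * cnj (D t0))) -` {0<..}"
    using op open_contains_ball by blast
  have dU: "s \<in> U" "Re (D s * cnj (D t0)) > 0" if "\<bar>s - t0\<bar> < d" for s
    using d(2) that by (auto simp: subset_iff dist_real_def abs_minus_commute)
  \<comment> \<open>The tangential coordinate increases strictly near \<open>t0\<close>, so the arc
    is a graph over the tangent; this makes \<open>F\<close> injective on the strip
    \<open>W\<close>.\<close>
  have mono: "Re (\<gamma> x * cnj (D t0)) < Re (\<gamma> y * cnj (D t0))"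
    if "\<bar>x - t0\<bar> < d" "\<bar>y - t0\<bar> < d" "x < y" for x y
  proof (rule DERIV_pos_imp_increasing[OF \<open>x < y\<close>])
    fix s assume "x \<le> s" "s \<le> y"
    then have s: "\<bar>s - t0\<bar> < d" using that by linarith
    have "bounded_linear (\<lambda>z. Re (z * cnj (D t0)))"
      by (intro bounded_linear_compose[OF bounded_linear_Re] bounded_linear_mult_left)
    from bounded_linear.has_vector_derivative[OF this der[OF dU(1)[OF s]]]
    have "((\<lambda>s. Re (\<gamma> s * cnj (D t0))) has_real_derivative Re (D s * cnj (D t0))) (at s)"
      by (simp add: has_real_derivative_iff_has_vector_derivative)
    then show "\<exists>y. ((\<lambda>s. Re (\<gamma> s * cnj (D t0))) has_real_derivative y) (at s) \<and> 0 < y"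
      using dU(2)[OF s] by blast
  qed
  have loop_free: "s = t0" if "s \<in> {0..1}" "\<gamma> s = \<gamma> t0" for s
  proof -
    have "0 < t0 \<and> t0 < 1"
    proof -
      have "t0 \<in> interior {0..1}" using U interior_maximal by blast
      then show ?thesis by simp
    qed
    then show ?thesis
      using simple that unfolding simple_path_def loop_free_def by force
  qed
  \<comment> \<open>The rest of the curve is compact and misses \<open>\<gamma> t0\<close>, so a
    small ball around this point meets only the arc near \<open>t0\<close>.\<close>
  define K where "K = \<gamma> ` ({0..1} - {t0 - d<..<t0 + d})"
  have "compact ({0..1} - {t0 - d<..<t0 + d})"
    by (rule compact_diff) auto
  then have "compact K"
    unfolding K_def using path
    by (intro compact_continuous_image) (auto simp: path_def intro: continuous_on_subset)
  moreover have "\<gamma> t0 \<notin> K"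
    using loop_free d(1) unfolding K_def by force
  ultimately obtain \<eta> where \<eta>: "\<eta> > 0" "ball (\<gamma> t0) \<eta> \<subseteq> - K"
    using compact_imp_closed open_Compl open_contains_ball by (metis ComplI)
  define F where "F \<nu> w = \<gamma> (Re w) + of_real (Im w) * \<nu>" for \<nu> w
  define N where "N = \<i> * D t0"
  have N: "Re (N * cnj (D t0)) = 0" "N \<noteq> 0"
    using nz by (auto simp: N_def)
  define W where "W = {w. \<bar>Re w - t0\<bar> < d}"
  have contF: "continuous_on W (F \<nu>)" for \<nu>
  proof -
    have "continuous_on U \<gamma>"
      using path U(3) unfolding path_def by (rule continuous_on_subset)
    then show ?thesis
      unfolding F_def W_def using dU(1)
      by (auto intro!: continuous_intros continuous_on_compose2[of U \<gamma> _ Re])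
  qed
  have inj: "inj_on (F \<nu>) W" if \<nu>: "Re (\<nu> * cnj (D t0)) = 0" "\<nu> \<noteq> 0" for \<nu>
  proof (rule inj_onI)
    fix v w assume vw: "v \<in> W" "w \<in> W" "F \<nu> v = F \<nu> w"
    have "Re (F \<nu> v * cnj (D t0)) = Re (\<gamma> (Re v) * cnj (D t0))" for v
    proof -
      have "Re (of_real (Im v) * \<nu> * cnj (D t0)) = Im v * Re (\<nu> * cnj (D t0))"
        by (simp add: algebra_simps)
      then show ?thesis using \<nu>(1) by (simp add: F_def distrib_right)
    qed
    then have "Re (\<gamma> (Re v) * cnj (D t0)) = Re (\<gamma> (Re w) * cnj (D t0))"
      using vw(3) by metis
    moreover have "\<bar>Re v - t0\<bar> < d" "\<bar>Re w - t0\<bar> < d" using vw(1,2) by (auto simp: W_def)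
    ultimately have R: "Re v = Re w"
      using mono[of "Re v" "Re w"] mono[of "Re w" "Re v"] by linarith
    then have "of_real (Im v) * \<nu> = of_real (Im w) * \<nu>"
      using vw(3) by (simp add: F_def)
    then have "of_real (Im v) = (of_real (Im w) :: complex)"
      using \<nu>(2) mult_right_cancel by blast
    then show "v = w" using R by (simp add: complex_eq_iff)
  qed
  define w0 where "w0 = complex_of_real t0"
  have w0: "w0 \<in> W" "F \<nu> w0 = \<gamma> t0" for \<nu>
    using d(1) by (auto simp: w0_def W_def F_def)
  have opW: "open W"
    unfolding W_def by (intro open_Collect_less continuous_intros)
  have "open (W \<inter> F N -` ball (\<gamma> t0) \<eta>)"
    using contF opW by (intro continuous_open_preimage) auto
  moreover have "w0 \<in> W \<inter> F N -` ball (\<gamma> t0) \<eta>"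
    using w0 \<eta>(1) by auto
  ultimately obtain s1 where s1: "s1 > 0" "ball w0 s1 \<subseteq> W \<inter> F N -` ball (\<gamma> t0) \<eta>"
    using open_contains_ball by blast
  \<comment> \<open>Half of \<open>s1\<close>, because the box of half-width \<open>s\<close> is
    compared with the ball through |Re| + |Im|.\<close>
  define s where "s = s1 / 2"
  define Q where "Q c = {w. \<bar>Re w - t0\<bar> < s \<and> \<bar>Im w\<bar> < c}" for c
  define Qp where "Qp = {w. \<bar>Re w - t0\<bar> < s \<and> 0 < Im w \<and> Im w < s}"
  define Qm where "Qm = {w. \<bar>Re w - t0\<bar> < s \<and> - s < Im w \<and> Im w < 0}"
  have s0: "s > 0" using s1 by (simp add: s_def)
  have Q1: "Q s \<subseteq> ball w0 s1"
  proof
    fix w assume "w \<in> Q s"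
    then have "\<bar>Re (w - w0)\<bar> + \<bar>Im (w - w0)\<bar> < s1"
      by (simp add: Q_def w0_def s_def)
    then have "norm (w - w0) < s1" using cmod_le[of "w - w0"] by linarith
    then show "w \<in> ball w0 s1" by (simp add: dist_norm norm_minus_commute)
  qed
  have QW: "Q s \<subseteq> W" "Qp \<subseteq> Q s" "Qm \<subseteq> Q s" "Q (s / 2) \<subseteq> Q s"
    using Q1 s1 s0 by (auto simp: Q_def Qp_def Qm_def)
  have box: "{w. \<bar>Re w - t0\<bar> < s \<and> x < Im w \<and> Im w < y} = box (Complex (t0 - s) x) (Complex (t0 + s) y)" for x y
    by (auto simp: box_def Basis_complex_def)
  have Qb: "Q c = box (Complex (t0 - s) (- c)) (Complex (t0 + s) c)" for c
    unfolding Q_def box[symmetric] by auto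
  have opQ: "open (Q c)" "open Qp" "open Qm" "connected Qp" "connected Qm" for c
    unfolding Qb Qp_def Qm_def box by (auto simp: convex_connected convex_box)
  \<comment> \<open>A boundary point in the image of the box belongs to the near arc, and
    injectivity then puts its coordinate on the real axis.\<close>
  have im: "Im w = 0" if h: "w \<in> Q s" "F N w \<in> path_image \<gamma>" for w
  proof -
    obtain x where x: "x \<in> {0..1}" "F N w = \<gamma> x" using h(2) by (auto simp: path_image_def)
    have "F N w \<in> ball (\<gamma> t0) \<eta>" using that(1) Q1 s1(2) by blast
    then have "\<gamma> x \<notin> K" using \<eta>(2) x(2) by auto
    then have "\<bar>x - t0\<bar> < d" using x(1) unfolding K_def by (auto simp: abs_less_iff)
    then have "complex_of_real x \<in> W" by (simp add: W_def)
    moreover have "F N (complex_of_real x) = F N w" using x by (simp add: F_def)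
    ultimately have "complex_of_real x = w"
      using inj[OF N] that(1) QW(1) by (meson inj_onD subsetD)
    then show ?thesis by auto
  qed
  have fr: "F N ` Qp \<inter> frontier \<Omega> = {}" "F N ` Qm \<inter> frontier \<Omega> = {}"
    using im QW(2,3) path_image by (auto simp: Qp_def Qm_def)
  have QF: "F N ` Q s \<subseteq> F N ` Qp \<union> F N ` Qm \<union> frontier \<Omega>"
  proof
    fix z assume "z \<in> F N ` Q s"
    then obtain w where w: "w \<in> Q s" "z = F N w" by blast
    show "z \<in> F N ` Qp \<union> F N ` Qm \<union> frontier \<Omega>"
    proof (cases "Im w = 0")
      case True
      have "w \<in> W" using w(1) QW(1) by blast
      then have "Re w \<in> {0..1}" using dU(1)[of "Re w"] U(3) by (auto simp: W_def)
      then have "z \<in> path_image \<gamma>" using True w(2) by (auto simp: F_def path_image_def)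
      then show ?thesis using path_image by simp
    next
      case False
      then have "w \<in> Qp \<or> w \<in> Qm" using w(1) by (auto simp: Q_def Qp_def Qm_def)
      then show ?thesis using w(2) by blast
    qed
  qed
  have opF: "open (F \<nu> ` V)" if "V \<subseteq> W" "open V" "Re (\<nu> * cnj (D t0)) = 0" "\<nu> \<noteq> 0" for \<nu> V
    using that inj[of \<nu>] contF[of \<nu>]
    by (intro invariance_of_domain) (auto intro: continuous_on_subset inj_on_subset)
  have conn: "connected (F N ` Qp)" "connected (F N ` Qm)"
    using opQ QW by (auto intro!: connected_continuous_image continuous_on_subset[OF contF])
  have alt: "A \<subseteq> \<Omega> \<or> A \<inter> \<Omega> = {}" if "connected A" "A \<inter> frontier \<Omega> = {}" for A
    using connected_Int_frontier[OF that(1), of \<Omega>] that(2) by blast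
  have w0Q: "w0 \<in> Q c" if "c > 0" for c using that s0 by (auto simp: w0_def Q_def)
  have opFQ: "open (F N ` Q s)" using opF[of "Q s" N] QW opQ N by simp
  have pQ: "\<gamma> t0 \<in> F N ` Q s" using w0Q[OF s0] w0(2) by (metis imageI)
  have p: "\<gamma> t0 \<in> frontier \<Omega>" using U path_image by (auto simp: path_image_def)
  have meet1: "\<Omega> \<inter> F N ` Q s \<noteq> {}"
  proof -
    have "\<gamma> t0 \<in> closure \<Omega>" using p by (simp add: frontier_def)
    then show ?thesis using opFQ pQ open_Int_closure_eq_empty[of "F N ` Q s" \<Omega>] by blast
  qed
  \<comment> \<open>By the Jordan curve theorem every point of the curve is a limit of outside
    points.\<close>
  have meet2: "outside (path_image \<gamma>) \<inter> F N ` Q s \<noteq> {}"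
  proof -
    have "frontier (outside (path_image \<gamma>)) = path_image \<gamma>"
      using Jordan_inside_outside[OF simple closed_path] by blast
    then have "\<gamma> t0 \<in> closure (outside (path_image \<gamma>))" using p path_image by (auto simp: frontier_def)
    then show ?thesis using opFQ pQ open_Int_closure_eq_empty[of "F N ` Q s" "outside (path_image \<gamma>)"] by blast
  qed
  have out_fr: "outside (path_image \<gamma>) \<inter> frontier \<Omega> = {}"
    using path_image outside_no_overlap by blast
  have m1: "F N ` Qp \<inter> \<Omega> \<noteq> {} \<or> F N ` Qm \<inter> \<Omega> \<noteq> {}"
    using meet1 QF disjoint_frontier by fast
  have "F N ` Qp \<inter> outside (path_image \<gamma>) \<noteq> {} \<or> F N ` Qm \<inter> outside (path_image \<gamma>) \<noteq> {}"
    using meet2 QF out_fr by fast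
  then have m2: "\<not> F N ` Qp \<subseteq> \<Omega> \<or> \<not> F N ` Qm \<subseteq> \<Omega>"
    using disjoint_outside by fast
  have cases: "F N ` Qp \<subseteq> \<Omega> \<and> F N ` Qm \<inter> \<Omega> = {} \<or> F N ` Qm \<subseteq> \<Omega> \<and> F N ` Qp \<inter> \<Omega> = {}"
    using alt[OF conn(1) fr(1)] alt[OF conn(2) fr(2)] m1 m2 by argo
  \<comment> \<open>A shift along \<open>\<nu>\<close> adds to the imaginary coordinate. Points of
    the closure have a nonnegative one, as the lower half box has an open image that misses
    \<Omega>; half of \<open>s\<close> is left as room for the shift.\<close>
  have seg: "\<exists>d. has_segment \<Omega> (\<gamma> t0) d"
    if \<nu>: "Re (\<nu> * cnj (D t0)) = 0" "\<nu> \<noteq> 0" and Qpm: "F \<nu> ` Qp \<subseteq> \<Omega>" "F \<nu> ` Qm \<inter> \<Omega> = {}" for \<nu>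
  proof -
    have "open (F \<nu> ` Q (s / 2))" using opF[of "Q (s/2)" \<nu>] QW opQ \<nu> by auto
    moreover have "\<gamma> t0 \<in> F \<nu> ` Q (s / 2)" using w0Q[of "s/2"] s0 w0(2) by (metis half_gt_zero imageI)
    ultimately obtain e where e: "e > 0" "ball (\<gamma> t0) e \<subseteq> F \<nu> ` Q (s / 2)"
      using open_contains_ball by blast
    have opm: "open (F \<nu> ` Qm)" using opF[of Qm \<nu>] QW opQ \<nu> by auto
    have "z + of_real x * \<nu> \<in> \<Omega>" if z: "z \<in> closure \<Omega>" "z \<in> ball (\<gamma> t0) e" and x: "0 < x" "x < s / 2" for z x
    proof -
      obtain w where w: "w \<in> Q (s / 2)" "z = F \<nu> w" using z e by blast
      have "z \<notin> F \<nu> ` Qm" using opm Qpm(2) z(1) open_Int_closure_eq_empty[of "F \<nu> ` Qm" \<Omega>] by blast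
      then have "w \<notin> Qm" using w(2) by blast
      then have "Im w \<ge> 0" using w(1) s0 by (auto simp: Q_def Qm_def)
      then have "w + of_real x * \<i> \<in> Qp" using w(1) x by (auto simp: Q_def Qp_def)
      moreover have "F \<nu> (w + of_real x * \<i>) = z + of_real x * \<nu>"
        using w(2) by (simp add: F_def algebra_simps)
      ultimately show ?thesis using Qpm(1) by (metis imageI subsetD)
    qed
    then have "has_segment \<Omega> (\<gamma> t0) (min e (s / 2))"
      using e(1) s0 unfolding has_segment_def by (intro conjI exI[of _ \<nu>]) auto
    then show ?thesis by blast
  qed
  \<comment> \<open>If \<Omega> lies on the other side, reversing the normal amounts to conjugating
    the coordinates.\<close>
  have flip: "F (- N) ` Qp = F N ` Qm" "F (- N) ` Qm = F N ` Qp"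
  proof -
    have *: "F (- N) w = F N (cnj w)" for w by (simp add: F_def)
    have sub: "cnj ` Qp \<subseteq> Qm" "cnj ` Qm \<subseteq> Qp"
      by (auto simp: Qp_def Qm_def)
    have "Qm \<subseteq> cnj ` Qp" "Qp \<subseteq> cnj ` Qm"
      using image_mono[OF sub(1), of cnj] image_mono[OF sub(2), of cnj] by (simp_all add: image_image)
    with sub have "cnj ` Qp = Qm" "cnj ` Qm = Qp" by blast+
    then show "F (- N) ` Qp = F N ` Qm" "F (- N) ` Qm = F N ` Qp"
      unfolding * by (metis image_image)+
  qed
  show ?thesis
    using cases seg[OF N] seg[of "- N"] N flip by auto
qed

text \<open>The exceptions are the images of the break points. They include the base point of the
  curve, since an open \<open>U\<close> inside the unit interval contains neither 0 nor 1.\<close>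

lemma segment_property:
  obtains E where "finite E" "\<And>p. p \<notin> E \<Longrightarrow> \<exists>d. has_segment \<Omega> p d"
proof -
  obtain S U where *: "finite S" "open U" "{0..1} - S \<subseteq> U" "U \<subseteq> {0..1}"
    "\<And>s. s \<in> U \<Longrightarrow> (\<gamma> has_vector_derivative vector_derivative \<gamma> (at s)) (at s)"
    "continuous_on U (\<lambda>s. vector_derivative \<gamma> (at s))"
    "\<And>s. s \<in> U \<Longrightarrow> vector_derivative \<gamma> (at s) \<noteq> 0"
    using piecewise_smooth_path_cases[OF piecewise_smooth] by metis
  show ?thesis
  proof (rule that[of "\<gamma> ` S"])
    fix p assume p: "p \<notin> \<gamma> ` S"
    consider "p \<in> \<Omega>" | "p \<notin> closure \<Omega>" | "p \<in> path_image \<gamma>"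
      using opn by (auto simp: path_image frontier_def interior_open)
    then show "\<exists>d. has_segment \<Omega> p d"
    proof cases
      case 1
      then obtain d where d: "d > 0" "ball p d \<subseteq> \<Omega>" using opn open_contains_ball by blast
      then have "has_segment \<Omega> p d"
        unfolding has_segment_def by (auto intro!: exI[of _ 0])
      then show ?thesis ..
    next
      case 2
      then obtain d where d: "d > 0" "ball p d \<subseteq> - closure \<Omega>"
        using open_contains_ball by (metis ComplI closed_closure open_Compl)
      then have "has_segment \<Omega> p d"
        unfolding has_segment_def by blast
      then show ?thesis ..
    next
      case 3
      then obtain t0 where "t0 \<in> {0..1}" "p = \<gamma> t0" by (auto simp: path_image_def)
      then have "t0 \<in> U" using p *(3) by blast
      then show ?thesis
        using segment_at_smooth_point[OF *(2) _ *(4) *(5) *(6) *(7)] \<open>p = \<gamma> t0\<close> by blast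
    qed
  qed (use *(1) in auto)
qed

end

section \<open>Green's formula on a Jordan domain\<close>

context jordan_domain
begin

abbreviation green :: "(complex \<Rightarrow> complex) \<Rightarrow> (complex \<Rightarrow> complex) \<Rightarrow> bool" where
  "green f b \<equiv> contour_integral \<gamma> f = 2 * \<i> * (LINT \<zeta>:\<Omega>|lborel. b \<zeta>)"

lemma Omega_borel: "\<Omega> \<in> sets borel"
  using opn by simp

lemma set_integrable_closure:
  fixes f :: "complex \<Rightarrow> complex"
  assumes "continuous_on (closure \<Omega>) f"
  shows "set_integrable lborel \<Omega> f"
proof -
  have "set_integrable lborel (closure \<Omega>) f"
    unfolding set_integrable_def by (rule borel_integrable_compact[OF compact_closure assms])
  then show ?thesis
    by (rule set_integrable_subset) (use opn closure_subset in auto)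
qed

lemma contour_integrable_closure:
  assumes "continuous_on (closure \<Omega>) f"
  shows "f contour_integrable_on \<gamma>"
proof -
  obtain g where "path_density \<gamma> g" using piecewise_smooth_path_density[OF piecewise_smooth] .
  from path_density_contour_integral(2)[OF this path continuous_on_subset[OF assms path_image_closure]]
  show ?thesis by (auto simp: contour_integrable_on_def)
qed

lemma bounded_closure:
  fixes f :: "complex \<Rightarrow> complex"
  assumes "continuous_on (closure \<Omega>) f"
  obtains M where "M > 0" "\<And>z. z \<in> closure \<Omega> \<Longrightarrow> norm (f z) \<le> M"
proof -
  have "bounded (f ` closure \<Omega>)"
    by (intro compact_imp_bounded compact_continuous_image assms compact_closure)
  then obtain M where "M > 0" "\<forall>x\<in>f ` closure \<Omega>. norm x \<le> M" unfolding bounded_pos by blast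
  then show ?thesis by (intro that) auto
qed

text \<open>The radii fit together: \<open>h\<close> vanishes beyond 3/2 * r, the segment property
  reaches at least to 2 * r, and a shift of at most r/4 cannot bridge the gap.\<close>

lemma shift_tendsto:
  fixes h :: "complex \<Rightarrow> complex"
  assumes h: "continuous_on (closure \<Omega>) h" and h0: "\<And>z. 3/2 * r \<le> cmod (z - p) \<Longrightarrow> h z = 0"
    and r: "r > 0" "2 * r \<le> d"
    and seg: "\<And>z e. z \<in> closure \<Omega> \<Longrightarrow> z \<in> ball p d \<Longrightarrow> 0 < e \<Longrightarrow> e < d \<Longrightarrow> z + of_real e * \<nu> \<in> \<Omega>"
    and e: "\<And>n. 0 < e n" "\<And>n. e n < d" "\<And>n. e n * norm \<nu> \<le> r / 4" "e \<longlonglongrightarrow> 0"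
    and z: "z \<in> closure \<Omega>"
  shows "(\<lambda>n. if z + of_real (e n) * \<nu> \<in> \<Omega> then h (z + of_real (e n) * \<nu>) else 0) \<longlonglongrightarrow> h z"
proof (cases "z \<in> ball p d")
  case True
  have "z + of_real (e n) * \<nu> \<in> \<Omega>" for n using seg[OF z True] e by blast
  moreover have "(\<lambda>n. z + of_real (e n) * \<nu>) \<longlonglongrightarrow> z + of_real 0 * \<nu>"
    by (intro tendsto_intros e)
  ultimately have "(\<lambda>n. h (z + of_real (e n) * \<nu>)) \<longlonglongrightarrow> h z"
    using h z unfolding continuous_on_sequentially comp_def
    using closure_subset[of \<Omega>] by (simp add: subset_iff)
  then show ?thesis using \<open>\<And>n. z + of_real (e n) * \<nu> \<in> \<Omega>\<close> by simp
next
  case False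
  have "h (z + of_real (e n) * \<nu>) = 0" for n
  proof (rule h0)
    have "2 * r \<le> cmod (z - p)" using False r(2) by (auto simp: dist_norm norm_minus_commute)
    moreover have "cmod (of_real (e n) * \<nu>) \<le> r / 4" using e(1,3)[of n] by (simp add: norm_mult)
    moreover have "cmod (z - p) \<le> cmod (z + of_real (e n) * \<nu> - p) + cmod (of_real (e n) * \<nu>)"
      using norm_triangle_ineq4[of "z + of_real (e n) * \<nu> - p" "of_real (e n) * \<nu>"] by simp
    ultimately show "3/2 * r \<le> cmod (z + of_real (e n) * \<nu> - p)" using r by linarith
  qed
  moreover have "h z = 0"
    using False r by (intro h0) (auto simp: dist_norm norm_minus_commute)
  ultimately show ?thesis by (simp only: if_cancel tendsto_const)
qed

text \<open>Pushing the closure into \<open>\<Omega>\<close> along the segment direction turns a localised function into one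
  that is \<open>C\<^sup>1\<close> on a neighbourhood of the closure.\<close>

lemma green_shifted:
  assumes F: "C1_wirtinger \<Omega> F a b"
    and zero: "\<And>z. 3/2 * r \<le> cmod (z - p) \<Longrightarrow> F z = 0 \<and> a z = 0 \<and> b z = 0"
    and r: "r > 0" "2 * r \<le> d"
    and seg: "\<And>z e. z \<in> closure \<Omega> \<Longrightarrow> z \<in> ball p d \<Longrightarrow> 0 < e \<Longrightarrow> e < d \<Longrightarrow> z + of_real e * \<nu> \<in> \<Omega>"
    and e: "0 < e" "e < d" "e * norm \<nu> \<le> r / 4"
  defines "F' \<equiv> \<lambda>z. if z + of_real e * \<nu> \<in> \<Omega> then F (z + of_real e * \<nu>) else 0"
    and "b' \<equiv> \<lambda>z. if z + of_real e * \<nu> \<in> \<Omega> then b (z + of_real e * \<nu>) else 0"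
  shows "green F' b'" "continuous_on (closure \<Omega>) F'" "continuous_on (closure \<Omega>) b'"
proof -
  define a' where "a' z = (if z + of_real e * \<nu> \<in> \<Omega> then a (z + of_real e * \<nu>) else 0)" for z
  \<comment> \<open>\<open>F'\<close> is C^1 on \<open>W1\<close> as a translate and on
    \<open>W2\<close> as 0; the strict inequality makes \<open>W2\<close> open. Together they cover
    the closure of \<Omega>.\<close>
  define W1 where "W1 = {z. z + of_real e * \<nu> \<in> \<Omega>}"
  define W2 where "W2 = {z. 3/2 * r < cmod (z + of_real e * \<nu> - p)}"
  have op: "open W1" "open W2"
  proof -
    have "W1 = (\<lambda>z. z + of_real e * \<nu>) -` \<Omega>" by (auto simp: W1_def)
    then show "open W1" using opn by (auto intro!: continuous_open_vimage continuous_intros)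
    show "open W2" unfolding W2_def by (intro open_Collect_less continuous_intros)
  qed
  have "C1_wirtinger W1 (\<lambda>z. F (z + of_real e * \<nu>)) (\<lambda>z. a (z + of_real e * \<nu>)) (\<lambda>z. b (z + of_real e * \<nu>))"
    using C1_wirtinger_shift[OF F] by (simp add: W1_def)
  then have "C1_wirtinger W1 F' a' b'"
    by (rule C1_wirtinger_cong[OF _ op(1)]) (auto simp: F'_def a'_def b'_def W1_def)
  moreover have "C1_wirtinger W2 F' a' b'"
    by (rule C1_wirtinger_cong[OF C1_wirtinger_const[of _ 0] op(2)])
      (use zero in \<open>auto simp: F'_def a'_def b'_def W2_def\<close>)
  ultimately have C: "C1_wirtinger (W1 \<union> W2) F' a' b'" using op by (rule C1_wirtinger_Un)
  have sub: "closure \<Omega> \<subseteq> W1 \<union> W2"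
  proof
    fix z assume z: "z \<in> closure \<Omega>"
    show "z \<in> W1 \<union> W2"
    proof (cases "z \<in> ball p d")
      case True
      then show ?thesis using seg z e by (auto simp: W1_def)
    next
      case False
      then have "2 * r \<le> cmod (z - p)" using r(2) by (auto simp: dist_norm norm_minus_commute)
      moreover have "cmod (of_real e * \<nu>) \<le> r / 4" using e by (simp add: norm_mult)
      moreover have "cmod (z - p) \<le> cmod (z + of_real e * \<nu> - p) + cmod (of_real e * \<nu>)"
        using norm_triangle_ineq4[of "z + of_real e * \<nu> - p" "of_real e * \<nu>"] by simp
      ultimately have "3/2 * r < cmod (z + of_real e * \<nu> - p)" using r by linarith
      then show ?thesis by (simp add: W2_def)
    qed
  qed
  show "continuous_on (closure \<Omega>) F'" "continuous_on (closure \<Omega>) b'"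
    using C sub C1_wirtinger_continuous_on[OF C] unfolding C1_wirtinger_def
    by (blast intro: continuous_on_subset)+
  \<comment> \<open>A cutoff supported in \<open>W1 \<union> W2\<close> turns \<open>F'\<close> into
    a compactly supported C^1 function on the plane without changing it on the closure of
    \<Omega>.\<close>
  obtain G aG bG R where G: "C1_wirtinger UNIV G aG bG" "\<And>z. z \<in> closure \<Omega> \<Longrightarrow> G z = 1 \<and> bG z = 0"
    "\<And>z. z \<notin> cball 0 R \<Longrightarrow> G z = 0 \<and> aG z = 0 \<and> bG z = 0"
    "\<exists>V. open V \<and> - (W1 \<union> W2) \<subseteq> V \<and> (\<forall>z\<in>V. G z = 0 \<and> aG z = 0 \<and> bG z = 0)"
  proof (rule cutoff_compact[OF compact_closure open_Un[OF op] sub])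
    fix G aG bG R
    assume *: "C1_wirtinger UNIV G aG bG" "\<And>z. z \<in> closure \<Omega> \<Longrightarrow> G z = 1 \<and> bG z = 0"
      "\<And>z. z \<notin> cball 0 R \<Longrightarrow> G z = 0 \<and> aG z = 0 \<and> bG z = 0"
      "\<exists>V. open V \<and> - (W1 \<union> W2) \<subseteq> V \<and> (\<forall>z\<in>V. G z = 0 \<and> aG z = 0 \<and> bG z = 0)"
    show thesis by (rule that[OF *])
  qed
  obtain V where V: "open V" "- (W1 \<union> W2) \<subseteq> V" "\<And>z. z \<in> V \<Longrightarrow> G z = 0 \<and> aG z = 0 \<and> bG z = 0"
    using G(4) by blast
  have H: "C1_wirtinger (W1 \<union> W2) (\<lambda>z. F' z * G z) (\<lambda>z. a' z * G z + F' z * aG z) (\<lambda>z. b' z * G z + F' z * bG z)"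
    by (rule C1_wirtinger_mult[OF C C1_wirtinger_subset[OF G(1)]]) auto
  moreover have "C1_wirtinger V (\<lambda>z. F' z * G z) (\<lambda>z. a' z * G z + F' z * aG z) (\<lambda>z. b' z * G z + F' z * bG z)"
    by (rule C1_wirtinger_cong[OF C1_wirtinger_const[of _ 0] V(1)]) (use V(3) in auto)
  ultimately have "C1_wirtinger ((W1 \<union> W2) \<union> V) (\<lambda>z. F' z * G z) (\<lambda>z. a' z * G z + F' z * aG z) (\<lambda>z. b' z * G z + F' z * bG z)"
    using open_Un[OF op] V(1) by (rule C1_wirtinger_Un)
  moreover have "(W1 \<union> W2) \<union> V = UNIV" using V(2) by blast
  ultimately have "C1_wirtinger UNIV (\<lambda>z. F' z * G z) (\<lambda>z. a' z * G z + F' z * aG z) (\<lambda>z. b' z * G z + F' z * bG z)"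
    by simp
  then have "contour_integral \<gamma> (\<lambda>z. F' z * G z) = 2 * \<i> * (LINT \<zeta>:\<Omega>|lborel. b' \<zeta> * G \<zeta> + F' \<zeta> * bG \<zeta>)"
    by (rule green_compact_support[OF piecewise_smooth Omega_borel winding_indicator, rotated])
      (use G(3) in auto)
  moreover have "contour_integral \<gamma> (\<lambda>z. F' z * G z) = contour_integral \<gamma> F'"
  proof (rule contour_integral_eq)
    fix z assume "z \<in> path_image \<gamma>"
    then have "z \<in> closure \<Omega>" using path_image_closure by blast
    then show "F' z * G z = F' z" using G(2) by simp
  qed
  moreover have "(LINT \<zeta>:\<Omega>|lborel. b' \<zeta> * G \<zeta> + F' \<zeta> * bG \<zeta>) = (LINT \<zeta>:\<Omega>|lborel. b' \<zeta>)"
  proof (rule set_lebesgue_integral_cong)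
    show "\<forall>z. z \<in> \<Omega> \<longrightarrow> b' z * G z + F' z * bG z = b' z"
    proof (intro allI impI)
      fix z assume "z \<in> \<Omega>"
      then have "z \<in> closure \<Omega>" using closure_subset by blast
      then show "b' z * G z + F' z * bG z = b' z" using G(2) by simp
    qed
  qed (use opn in auto)
  ultimately show "green F' b'" by simp
qed

text \<open>Limit of \<open>green_shifted\<close> for shifts tending to 0, by dominated convergence
  on the path and on \<Omega>; the translates share the bounds of the original.\<close>

lemma green_local:
  assumes f: "C1_closure \<Omega> f a b" and p: "has_segment \<Omega> p d" and r: "r > 0" "2 * r \<le> d"
  shows "green (\<lambda>z. f z * bump p r z) (\<lambda>z. b z * bump p r z + f z * bump_bar p r z)"
proof -
  define F where "F z = f z * bump p r z" for z
  define aF where "aF z = a z * bump p r z + f z * cnj (bump_bar p r z)" for z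
  define bF where "bF z = b z * bump p r z + f z * bump_bar p r z" for z
  have CF: "C1_closure \<Omega> F aF bF"
    using C1_closure_mult[OF f C1_wirtinger_bump[of p r]] unfolding F_def aF_def bF_def .
  then have C: "C1_wirtinger \<Omega> F aF bF" and cF: "continuous_on (closure \<Omega>) F" and cb: "continuous_on (closure \<Omega>) bF"
    unfolding C1_closure_def by auto
  have zero: "3/2 * r \<le> cmod (z - p) \<Longrightarrow> F z = 0 \<and> aF z = 0 \<and> bF z = 0" for z
    using bump_eq_0[OF r(1), of z p] by (auto simp: F_def aF_def bF_def)
  obtain \<nu> where d: "d > 0" and seg: "\<And>z e. z \<in> closure \<Omega> \<Longrightarrow> z \<in> ball p d \<Longrightarrow> 0 < e \<Longrightarrow> e < d \<Longrightarrow> z + of_real e * \<nu> \<in> \<Omega>"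
    using p unfolding has_segment_def by blast
  \<comment> \<open>Small enough for the segment property and for the shift bound r/4; the added 1
    guards against \<open>\<nu> = 0\<close>.\<close>
  define c where "c = min (d / 2) (r / (4 * (norm \<nu> + 1)))"
  have c: "c > 0" "c < d" "c * norm \<nu> \<le> r / 4"
  proof -
    have n: "norm \<nu> + 1 > 0" by (simp add: add_nonneg_pos)
    show "c > 0" using d r n by (simp add: c_def)
    have "c \<le> d / 2" unfolding c_def by (rule min.cobounded1)
    then show "c < d" using d by linarith
    have "c * norm \<nu> \<le> r / (4 * (norm \<nu> + 1)) * (norm \<nu> + 1)"
      using r n by (intro mult_mono) (auto simp: c_def)
    also have "\<dots> = r / 4" using n by (simp add: divide_simps)
    finally show "c * norm \<nu> \<le> r / 4" .
  qed
  define e where "e n = c * inverse (real (Suc n))" for n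
  have ec: "0 < e n" "e n \<le> c" for n
    using c(1) by (auto simp: e_def intro!: mult_left_le simp: field_simps)
  have e: "0 < e n" "e n < d" "e n * norm \<nu> \<le> r / 4" for n
    using ec[of n] c mult_right_mono[OF ec(2)[of n], of "norm \<nu>"] by auto
  have e0: "e \<longlonglongrightarrow> 0"
    using tendsto_mult_right_zero[OF LIMSEQ_inverse_real_of_nat, of c] unfolding e_def[abs_def] .
  define Fn where "Fn n z = (if z + of_real (e n) * \<nu> \<in> \<Omega> then F (z + of_real (e n) * \<nu>) else 0)" for n z
  define bn where "bn n z = (if z + of_real (e n) * \<nu> \<in> \<Omega> then bF (z + of_real (e n) * \<nu>) else 0)" for n z
  have G: "green (Fn n) (bn n)" "continuous_on (closure \<Omega>) (Fn n)" "continuous_on (closure \<Omega>) (bn n)" for n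
    using green_shifted[OF C zero r seg e(1,2,3)[of n]] unfolding Fn_def bn_def by auto
  obtain M where M: "M > 0" "\<And>z. z \<in> closure \<Omega> \<Longrightarrow> norm (F z) \<le> M" by (rule bounded_closure[OF cF], rule that; blast)
  obtain M' where M': "M' > 0" "\<And>z. z \<in> closure \<Omega> \<Longrightarrow> norm (bF z) \<le> M'" by (rule bounded_closure[OF cb], rule that; blast)
  have Fn_le: "norm (Fn n z) \<le> M" "norm (bn n z) \<le> M'" for n z
    using M M' closure_subset[of \<Omega>] by (auto simp: Fn_def bn_def)
  have lim: "(\<lambda>n. Fn n z) \<longlonglongrightarrow> F z" "(\<lambda>n. bn n z) \<longlonglongrightarrow> bF z" if "z \<in> closure \<Omega>" for z
    unfolding Fn_def bn_def
    by (rule shift_tendsto[OF _ _ r seg e e0 that]; use cF cb zero in blast)+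
  obtain g where g: "path_density \<gamma> g" using piecewise_smooth_path_density[OF piecewise_smooth] .
  obtain Bg where Bg: "\<And>t. norm (g t) \<le> Bg" "\<And>t. t \<notin> {0..1} \<Longrightarrow> g t = 0"
    using g unfolding path_density_def by blast
  note dens = path_density_contour_integral[OF g path continuous_on_subset[OF _ path_image_closure]]
  note densq = path_density_contour_integral_eq[OF g path continuous_on_subset[OF _ path_image_closure]]
  have Bg0: "0 \<le> Bg" by (rule order_trans[OF norm_ge_zero Bg(1)[of 0]])
  have "(\<lambda>n. contour_integral \<gamma> (Fn n)) \<longlonglongrightarrow> contour_integral \<gamma> F"
    unfolding densq[OF G(2)] densq[OF cF]
  proof (rule integral_dominated_convergence[where w="\<lambda>t. indicator {0..1} t *\<^sub>R (M * Bg)"])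
    show "integrable lborel (\<lambda>t::real. indicator {0..1} t *\<^sub>R (M * Bg))"
      by (intro borel_integrable_compact) auto
    show "AE t in lborel. (\<lambda>n. Fn n (\<gamma> t) * g t) \<longlonglongrightarrow> F (\<gamma> t) * g t"
    proof (rule AE_I2)
      fix t
      show "(\<lambda>n. Fn n (\<gamma> t) * g t) \<longlonglongrightarrow> F (\<gamma> t) * g t"
      proof (cases "t \<in> {0..1}")
        case True
        then have "\<gamma> t \<in> closure \<Omega>" using path_image_closure by (auto simp: path_image_def)
        then show ?thesis by (intro tendsto_intros lim)
      next
        case False
        show ?thesis unfolding Bg(2)[OF False] by simp
      qed
    qed
    show "AE t in lborel. norm (Fn n (\<gamma> t) * g t) \<le> indicator {0..1} t *\<^sub>R (M * Bg)" for n
    proof (rule AE_I2)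
      fix t
      have "norm (Fn n (\<gamma> t) * g t) \<le> M * Bg"
        unfolding norm_mult using M(1) by (intro mult_mono Fn_le Bg) auto
      then show "norm (Fn n (\<gamma> t) * g t) \<le> indicator {0..1} t *\<^sub>R (M * Bg)"
        using Bg(2)[of t] by (cases "t \<in> {0..1}") auto
    qed
    show "(\<lambda>t. F (\<gamma> t) * g t) \<in> borel_measurable lborel"
      by (rule borel_measurable_integrable[OF dens(1)[OF cF]])
    show "(\<lambda>t. Fn n (\<gamma> t) * g t) \<in> borel_measurable lborel" for n
      by (rule borel_measurable_integrable[OF dens(1)[OF G(2)]])
  qed
  moreover have "(\<lambda>n. contour_integral \<gamma> (Fn n)) \<longlonglongrightarrow> 2 * \<i> * (LINT \<zeta>:\<Omega>|lborel. bF \<zeta>)"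
    unfolding G(1)
  proof (intro tendsto_intros)
    show "(\<lambda>n. LINT \<zeta>:\<Omega>|lborel. bn n \<zeta>) \<longlonglongrightarrow> (LINT \<zeta>:\<Omega>|lborel. bF \<zeta>)"
      unfolding set_lebesgue_integral_def
    proof (rule integral_dominated_convergence[where w="\<lambda>z. indicator (closure \<Omega>) z *\<^sub>R M'"])
      show "integrable lborel (\<lambda>z. indicator (closure \<Omega>) z *\<^sub>R M')"
        by (intro borel_integrable_compact compact_closure) auto
      show "AE z in lborel. (\<lambda>n. indicator \<Omega> z *\<^sub>R bn n z) \<longlonglongrightarrow> indicator \<Omega> z *\<^sub>R bF z"
      proof (rule AE_I2)
        fix z show "(\<lambda>n. indicator \<Omega> z *\<^sub>R bn n z) \<longlonglongrightarrow> indicator \<Omega> z *\<^sub>R bF z"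
          using lim(2)[of z] closure_subset[of \<Omega>] by (cases "z \<in> \<Omega>") auto
      qed
      show "AE z in lborel. norm (indicator \<Omega> z *\<^sub>R bn n z) \<le> indicator (closure \<Omega>) z *\<^sub>R M'" for n
      proof (rule AE_I2)
        fix z show "norm (indicator \<Omega> z *\<^sub>R bn n z) \<le> indicator (closure \<Omega>) z *\<^sub>R M'"
          using Fn_le(2)[of n z] closure_subset[of \<Omega>] M'(1) by (cases "z \<in> \<Omega>") (auto simp: indicator_def)
      qed
      show "(\<lambda>z. indicator \<Omega> z *\<^sub>R bF z) \<in> borel_measurable lborel"
        using set_integrable_closure[OF cb] unfolding set_integrable_def by (rule borel_measurable_integrable)
      show "(\<lambda>z. indicator \<Omega> z *\<^sub>R bn n z) \<in> borel_measurable lborel" for n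
        using set_integrable_closure[OF G(3)] unfolding set_integrable_def by (rule borel_measurable_integrable)
    qed
  qed
  ultimately have "green F bF" by (rule LIMSEQ_unique)
  then show ?thesis unfolding F_def bF_def .
qed

lemma green_add:
  assumes "C1_closure \<Omega> f a b" "C1_closure \<Omega> f' a' b'" "green f b" "green f' b'"
  shows "green (\<lambda>z. f z + f' z) (\<lambda>z. b z + b' z)"
proof -
  have c: "f contour_integrable_on \<gamma>" "f' contour_integrable_on \<gamma>"
    "set_integrable lborel \<Omega> b" "set_integrable lborel \<Omega> b'"
    using assms(1,2) contour_integrable_closure set_integrable_closure unfolding C1_closure_def by auto
  show ?thesis
    unfolding contour_integral_add[OF c(1,2)] set_integral_add(2)[OF c(3,4)] assms(3,4)
    by (simp add: algebra_simps)
qed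

lemma green_cong:
  assumes "green f b" "\<And>z. z \<in> path_image \<gamma> \<Longrightarrow> f z = f' z" "\<And>z. z \<in> \<Omega> \<Longrightarrow> b z = b' z"
  shows "green f' b'"
proof -
  have "contour_integral \<gamma> f = contour_integral \<gamma> f'"
    by (rule contour_integral_eq[OF assms(2)])
  moreover have "(LINT \<zeta>:\<Omega>|lborel. b \<zeta>) = (LINT \<zeta>:\<Omega>|lborel. b' \<zeta>)"
    by (rule set_lebesgue_integral_cong) (use opn assms(3) in auto)
  ultimately show ?thesis using assms(1) by simp
qed

text \<open>Induction on the number of discs, with a partition of unity produced on the way:
  \<open>f\<close> times the bump is local to one disc, and \<open>f\<close> times its complement
  vanishes on that disc, so only the remaining discs are left.\<close>

lemma green_finite_cover:
  assumes "finite P" and "\<And>p. p \<in> P \<Longrightarrow> r p > 0 \<and> has_segment \<Omega> p (2 * r p)"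
    and "C1_closure \<Omega> f a b"
    and "\<And>z. z \<in> closure \<Omega> \<Longrightarrow> (\<And>p. p \<in> P \<Longrightarrow> z \<notin> cball p (r p)) \<Longrightarrow> f z = 0"
  shows "green f b"
  using assms
proof (induction P arbitrary: f a b rule: finite_induct)
  case empty
  have z: "f z = 0" if "z \<in> closure \<Omega>" for z using empty(3)[OF that] by auto
  have C: "C1_wirtinger \<Omega> f a b" using empty(2) by (simp add: C1_closure_def)
  have "C1_wirtinger \<Omega> f (\<lambda>_. 0) (\<lambda>_. 0)"
    by (rule C1_wirtinger_cong[OF C1_wirtinger_const[of _ 0] opn]) (use z closure_subset[of \<Omega>] in auto)
  then have b: "b z = 0" if "z \<in> \<Omega>" for z using C1_wirtinger_unique(2)[OF C _ that] by blast
  have "green (\<lambda>_. 0) (\<lambda>_. 0)" by (simp add: set_lebesgue_integral_def)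
  then show ?case
    by (rule green_cong) (use z b path_image_closure in auto)
next
  case (insert p P)
  have p: "r p > 0" "has_segment \<Omega> p (2 * r p)" using insert.prems(1) by auto
  note f = insert.prems(2)
  let ?\<beta> = "bump p (r p)" and ?b = "bump_bar p (r p)"
  have C: "C1_wirtinger UNIV (\<lambda>z. 1 - ?\<beta> z) (\<lambda>z. 0 - cnj (?b z)) (\<lambda>z. 0 - ?b z)"
    by (intro C1_wirtinger_diff C1_wirtinger_const C1_wirtinger_bump)
  have 1: "green (\<lambda>z. f z * ?\<beta> z) (\<lambda>z. b z * ?\<beta> z + f z * ?b z)"
    using green_local[OF f p(2,1)] by simp
  have 2: "green (\<lambda>z. f z * (1 - ?\<beta> z)) (\<lambda>z. b z * (1 - ?\<beta> z) + f z * (0 - ?b z))"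
  proof (rule insert.IH[OF _ C1_closure_mult[OF f C]])
    fix z assume z: "z \<in> closure \<Omega>" "\<And>q. q \<in> P \<Longrightarrow> z \<notin> cball q (r q)"
    show "f z * (1 - ?\<beta> z) = 0"
    proof (cases "z \<in> cball p (r p)")
      case True
      then have "?\<beta> z = 1" by (intro bump_eq_1) (auto simp: dist_norm norm_minus_commute)
      then show ?thesis by simp
    next
      case False
      then have "f z = 0" using z by (intro insert.prems(3)) auto
      then show ?thesis by simp
    qed
  qed (use insert.prems(1) in auto)
  show ?case
    by (rule green_cong[OF green_add[OF C1_closure_mult[OF f C1_wirtinger_bump] C1_closure_mult[OF f C] 1 2]])
      (auto simp: algebra_simps)
qed

text \<open>Removing from the closure the discs on which \<open>f\<close> vanishes leaves a compact
  set of points with the segment property, and finitely many of their neighbourhoods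
  suffice.\<close>

lemma green_vanishing_at_corners:
  assumes E: "finite E" "\<And>p. p \<notin> E \<Longrightarrow> \<exists>d. has_segment \<Omega> p d"
    and f: "C1_closure \<Omega> f a b"
    and van: "\<And>p. p \<in> E \<Longrightarrow> \<exists>r>0. \<forall>z\<in>closure \<Omega> \<inter> ball p r. f z = 0"
  shows "green f b"
proof -
  obtain s where s: "\<And>p. p \<in> E \<Longrightarrow> s p > 0 \<and> (\<forall>z\<in>closure \<Omega> \<inter> ball p (s p). f z = 0)"
    using van by metis
  obtain d where d: "\<And>p. p \<notin> E \<Longrightarrow> has_segment \<Omega> p (d p)" using E(2) by metis
  define K where "K = closure \<Omega> - (\<Union>p\<in>E. ball p (s p))"
  have K: "compact K" unfolding K_def by (intro compact_diff compact_closure) auto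
  have dpos: "d p > 0" if "p \<notin> E" for p using d[OF that] by (simp add: has_segment_def)
  have KE: "p \<notin> E" if "p \<in> K" for p using that s by (force simp: K_def)
  have "K \<subseteq> (\<Union>p\<in>K. ball p (d p / 2))" using KE dpos by force
  then obtain P where P: "P \<subseteq> K" "finite P" "K \<subseteq> (\<Union>p\<in>P. ball p (d p / 2))"
    using compactE_image[OF K, of K "\<lambda>p. ball p (d p / 2)"] by (metis open_ball)
  show ?thesis
  proof (rule green_finite_cover[OF P(2) _ f, of "\<lambda>p. d p / 2"])
    fix p assume "p \<in> P"
    then have "p \<notin> E" using P(1) KE by blast
    then show "d p / 2 > 0 \<and> has_segment \<Omega> p (2 * (d p / 2))" using d[of p] dpos[of p] by simp
  next
    fix z assume z: "z \<in> closure \<Omega>" "\<And>p. p \<in> P \<Longrightarrow> z \<notin> cball p (d p / 2)"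
    then have "z \<notin> K" using P(3) ball_subset_cball by blast
    then obtain p where "p \<in> E" "z \<in> ball p (s p)" using z(1) by (auto simp: K_def)
    then show "f z = 0" using s[of p] z(1) by blast
  qed
qed

text \<open>A simple path can repeat only its end points. Hence a corner is hit at almost no
  parameter, as the limit in \<open>green_corner_limit\<close> requires.\<close>

lemma finite_path_fiber: "finite {t\<in>{0..1}. \<gamma> t = e}"
proof (cases "\<exists>x\<in>{0..1}. \<gamma> x = e")
  case True
  then obtain x where x: "x \<in> {0..1}" "\<gamma> x = e" by blast
  have "{t\<in>{0..1}. \<gamma> t = e} \<subseteq> {x, 0, 1}"
    using simple x unfolding simple_path_def loop_free_def by blast
  then show ?thesis by (rule finite_subset) auto
next
  case False
  then have "{t\<in>{0..1}. \<gamma> t = e} = {}" by blast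
  then show ?thesis by (simp only: finite.emptyI)
qed

text \<open>Corners are removable: the error made by cutting off a disc of radius \<open>\<rho>\<close> has a gradient of size
  \<open>1 / \<rho>\<close> on an area of order \<open>\<rho>\<^sup>2\<close>.\<close>

lemma green_corner_limit:
  assumes f: "C1_closure \<Omega> f a b"
    and G: "\<And>r. r > 0 \<Longrightarrow> green (\<lambda>z. f z * (1 - bump e r z)) (\<lambda>z. b z * (1 - bump e r z) + f z * (0 - bump_bar e r z))"
  shows "green f b"
proof -
  define r :: "nat \<Rightarrow> real" where "r n = inverse (real (Suc n))" for n
  have r: "r n > 0" "r \<longlonglongrightarrow> 0" for n
    using LIMSEQ_inverse_real_of_nat unfolding r_def[abs_def] by auto
  have cf: "continuous_on (closure \<Omega>) f" "continuous_on (closure \<Omega>) b" using f by (auto simp: C1_closure_def)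
  have cbump: "continuous_on S (bump e (r n))" "continuous_on S (bump_bar e (r n))" for S n
    using C1_wirtinger_bump[of e "r n"] C1_wirtinger_continuous_on[OF C1_wirtinger_bump[of e "r n"]]
    unfolding C1_wirtinger_def by (auto intro: continuous_on_subset)
  obtain M where M: "M > 0" "\<And>z. z \<in> closure \<Omega> \<Longrightarrow> norm (f z) \<le> M" by (rule bounded_closure[OF cf(1)], rule that; blast)
  obtain g where g: "path_density \<gamma> g" using piecewise_smooth_path_density[OF piecewise_smooth] .
  have g0: "\<And>t. t \<notin> {0..1} \<Longrightarrow> g t = 0" using g unfolding path_density_def by blast
  note dens = path_density_contour_integral[OF g path continuous_on_subset[OF _ path_image_closure]]
  note densq = path_density_contour_integral_eq[OF g path continuous_on_subset[OF _ path_image_closure]]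
  have cn: "continuous_on (closure \<Omega>) (\<lambda>z. f z * (1 - bump e (r n) z))"
     "continuous_on (closure \<Omega>) (\<lambda>z. b z * (1 - bump e (r n) z))"
     "continuous_on (closure \<Omega>) (\<lambda>z. f z * (0 - bump_bar e (r n) z))" for n
    by (intro continuous_intros cf cbump)+
  have lim: "(\<lambda>n. h * (1 - bump e (r n) z)) \<longlonglongrightarrow> h" if "z \<noteq> e" for h z
  proof -
    have "eventually (\<lambda>n. r n < 2/3 * cmod (z - e)) sequentially"
      using r(2) that by (intro order_tendstoD) auto
    then have "eventually (\<lambda>n. h * (1 - bump e (r n) z) = h) sequentially"
      by eventually_elim (use r(1) in \<open>simp add: bump_eq_0\<close>)
    then show ?thesis by (rule tendsto_eventually)
  qed
  have le: "norm (h * (1 - bump e (r n) z)) \<le> norm h" for h z n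
    unfolding norm_mult using norm_one_minus_bump_le[of e "r n" z] by (intro mult_left_le) auto
  have L1: "(\<lambda>n. contour_integral \<gamma> (\<lambda>z. f z * (1 - bump e (r n) z))) \<longlonglongrightarrow> contour_integral \<gamma> f"
    unfolding densq[OF cn(1)] densq[OF cf(1)]
  proof (rule integral_dominated_convergence[where w="\<lambda>t. norm (f (\<gamma> t) * g t)"])
    show "integrable lborel (\<lambda>t. norm (f (\<gamma> t) * g t))" by (intro integrable_norm dens(1) cf)
    have "AE t in lborel. t \<notin> {t\<in>{0..1}. \<gamma> t = e}"
      using finite_path_fiber[of e] by (intro AE_not_in finite_imp_null_set_lborel)
    then show "AE t in lborel. (\<lambda>n. f (\<gamma> t) * (1 - bump e (r n) (\<gamma> t)) * g t) \<longlonglongrightarrow> f (\<gamma> t) * g t"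
    proof eventually_elim
      case (elim t)
      show ?case
      proof (cases "t \<in> {0..1}")
        case True
        then show ?thesis using elim by (intro tendsto_intros lim) auto
      next
        case False
        show ?thesis unfolding g0[OF False] by simp
      qed
    qed
    show "AE t in lborel. norm (f (\<gamma> t) * (1 - bump e (r n) (\<gamma> t)) * g t) \<le> norm (f (\<gamma> t) * g t)" for n
      unfolding norm_mult[of _ "g _"] by (intro AE_I2 mult_right_mono le) auto
    show "(\<lambda>t. f (\<gamma> t) * g t) \<in> borel_measurable lborel"
      by (intro borel_measurable_integrable dens(1) cf)
    show "(\<lambda>t. f (\<gamma> t) * (1 - bump e (r n) (\<gamma> t)) * g t) \<in> borel_measurable lborel" for n
      by (rule borel_measurable_integrable[OF dens(1)[OF cn(1)]])
  qed
  have L2: "(\<lambda>n. LINT \<zeta>:\<Omega>|lborel. b \<zeta> * (1 - bump e (r n) \<zeta>)) \<longlonglongrightarrow> (LINT \<zeta>:\<Omega>|lborel. b \<zeta>)"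
    unfolding set_lebesgue_integral_def
  proof (rule integral_dominated_convergence[where w="\<lambda>z. norm (indicator \<Omega> z *\<^sub>R b z)"])
    show "integrable lborel (\<lambda>z. norm (indicator \<Omega> z *\<^sub>R b z))"
      using set_integrable_closure[OF cf(2)] unfolding set_integrable_def by (rule integrable_norm)
    have "AE z in lborel. z \<notin> {e}"
      by (intro AE_not_in finite_imp_null_set_lborel) auto
    then show "AE z in lborel. (\<lambda>n. indicator \<Omega> z *\<^sub>R (b z * (1 - bump e (r n) z))) \<longlonglongrightarrow> indicator \<Omega> z *\<^sub>R b z"
      by eventually_elim (intro tendsto_intros lim; simp)
    show "AE z in lborel. norm (indicator \<Omega> z *\<^sub>R (b z * (1 - bump e (r n) z))) \<le> norm (indicator \<Omega> z *\<^sub>R b z)" for n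
      unfolding norm_scaleR by (intro AE_I2 mult_left_mono le) auto
    show "(\<lambda>z. indicator \<Omega> z *\<^sub>R b z) \<in> borel_measurable lborel"
      using set_integrable_closure[OF cf(2)] unfolding set_integrable_def by (rule borel_measurable_integrable)
    show "(\<lambda>z. indicator \<Omega> z *\<^sub>R (b z * (1 - bump e (r n) z))) \<in> borel_measurable lborel" for n
      using set_integrable_closure[OF cn(2)] unfolding set_integrable_def by (rule borel_measurable_integrable)
  qed
  \<comment> \<open>The bound is M * 9/r on a disc of area pi * (3/2 * r)^2, hence linear in
    r.\<close>
  have L3: "(\<lambda>n. LINT \<zeta>:\<Omega>|lborel. f \<zeta> * (0 - bump_bar e (r n) \<zeta>)) \<longlonglongrightarrow> 0"
  proof (rule Lim_null_comparison)
    show "eventually (\<lambda>n. norm (LINT \<zeta>:\<Omega>|lborel. f \<zeta> * (0 - bump_bar e (r n) \<zeta>)) \<le> M * 9 * (9 / 4) * pi * r n) sequentially"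
    proof (rule always_eventually, rule allI)
      fix n
      have "norm (LINT \<zeta>:\<Omega>|lborel. f \<zeta> * (0 - bump_bar e (r n) \<zeta>)) \<le>
          (LINT \<zeta>::complex|lborel. indicator (cball e (3/2 * r n)) \<zeta> *\<^sub>R (M * (9 / r n)))"
        unfolding set_lebesgue_integral_def
      proof (rule Bochner_Integration.integral_norm_bound_integral)
        show "integrable lborel (\<lambda>\<zeta>. indicator \<Omega> \<zeta> *\<^sub>R (f \<zeta> * (0 - bump_bar e (r n) \<zeta>)))"
          using set_integrable_closure[OF cn(3)] unfolding set_integrable_def .
        show "integrable lborel (\<lambda>\<zeta>::complex. indicator (cball e (3/2 * r n)) \<zeta> *\<^sub>R (M * (9 / r n)))"
          by (intro borel_integrable_compact) auto
        fix z
        show "norm (indicator \<Omega> z *\<^sub>R (f z * (0 - bump_bar e (r n) z))) \<le> indicator (cball e (3/2 * r n)) z *\<^sub>R (M * (9 / r n))"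
        proof (cases "z \<in> \<Omega> \<and> z \<in> cball e (3/2 * r n)")
          case True
          then have "norm (f z) \<le> M" using M(2)[of z] closure_subset[of \<Omega>] by blast
          then have "norm (f z * (0 - bump_bar e (r n) z)) \<le> M * (9 / r n)"
            unfolding norm_mult using norm_bump_bar_le[OF r(1), of e n z] M(1) by (intro mult_mono) auto
          then show ?thesis using True by simp
        next
          case False
          then have "z \<notin> \<Omega> \<or> bump_bar e (r n) z = 0"
            using bump_eq_0(2)[OF r(1), of n z e] by (auto simp: dist_norm norm_minus_commute)
          then show ?thesis using M(1) r(1)[of n] by auto
        qed
      qed
      also have "\<dots> = M * (9 / r n) * (pi * (3/2 * r n)\<^sup>2)"
        using r(1)[of n] by (simp add: content_cball unit_ball_vol_2)
      also have "\<dots> = M * 9 * (9 / 4) * pi * r n"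
        using r(1)[of n] by (simp add: power2_eq_square field_simps)
      finally show "norm (LINT \<zeta>:\<Omega>|lborel. f \<zeta> * (0 - bump_bar e (r n) \<zeta>)) \<le> M * 9 * (9 / 4) * pi * r n" .
    qed
    show "(\<lambda>n. M * 9 * (9 / 4) * pi * r n) \<longlonglongrightarrow> 0" by (rule tendsto_mult_right_zero[OF r(2)])
  qed
  have "contour_integral \<gamma> (\<lambda>z. f z * (1 - bump e (r n) z)) = 2 * \<i> * ((LINT \<zeta>:\<Omega>|lborel. b \<zeta> * (1 - bump e (r n) \<zeta>)) +
      (LINT \<zeta>:\<Omega>|lborel. f \<zeta> * (0 - bump_bar e (r n) \<zeta>)))" for n
    unfolding G[OF r(1)] using set_integral_add(2)[OF set_integrable_closure[OF cn(2)] set_integrable_closure[OF cn(3)]] by simp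
  moreover have "(\<lambda>n. 2 * \<i> * ((LINT \<zeta>:\<Omega>|lborel. b \<zeta> * (1 - bump e (r n) \<zeta>)) +
      (LINT \<zeta>:\<Omega>|lborel. f \<zeta> * (0 - bump_bar e (r n) \<zeta>)))) \<longlonglongrightarrow> 2 * \<i> * ((LINT \<zeta>:\<Omega>|lborel. b \<zeta>) + 0)"
    by (intro tendsto_intros L2 L3)
  ultimately show ?thesis using LIMSEQ_unique[OF L1] by simp
qed

text \<open>Induction over the set \<open>E1\<close> of corners near which \<open>f\<close> need not
  vanish: multiplying by \<open>1 - bump e r\<close> removes one of them and keeps the zeros near
  the others.\<close>

theorem green_formula:
  assumes "C1_closure \<Omega> f a b"
  shows "contour_integral \<gamma> f = 2 * \<i> * (LINT \<zeta>:\<Omega>|lborel. b \<zeta>)"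
proof -
  obtain E where E: "finite E" "\<And>p. p \<notin> E \<Longrightarrow> \<exists>d. has_segment \<Omega> p d"
    using segment_property by blast
  have "green f b" if "finite E1" "E1 \<subseteq> E" "C1_closure \<Omega> f a b"
    "\<And>p. p \<in> E - E1 \<Longrightarrow> \<exists>r>0. \<forall>z\<in>closure \<Omega> \<inter> ball p r. f z = 0" for E1 f a b
    using that
  proof (induction E1 arbitrary: f a b rule: finite_induct)
    case empty
    then show ?case using green_vanishing_at_corners[OF E] by simp
  next
    case (insert e E1)
    show ?case
    proof (rule green_corner_limit[OF insert.prems(2), of e])
      fix r :: real assume r: "r > 0"
      have C: "C1_wirtinger UNIV (\<lambda>z. 1 - bump e r z) (\<lambda>z. 0 - cnj (bump_bar e r z)) (\<lambda>z. 0 - bump_bar e r z)"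
        by (intro C1_wirtinger_diff C1_wirtinger_const C1_wirtinger_bump)
      show "green (\<lambda>z. f z * (1 - bump e r z)) (\<lambda>z. b z * (1 - bump e r z) + f z * (0 - bump_bar e r z))"
      proof (rule insert.IH[OF _ C1_closure_mult[OF insert.prems(2) C]])
        fix p assume p: "p \<in> E - E1"
        show "\<exists>r'>0. \<forall>z\<in>closure \<Omega> \<inter> ball p r'. f z * (1 - bump e r z) = 0"
        proof (cases "p = e")
          case True
          have "f z * (1 - bump e r z) = 0" if "z \<in> ball e r" for z
            using that bump_eq_1(1)[of z e r] by (simp add: dist_norm norm_minus_commute)
          then show ?thesis using True r by blast
        next
          case False
          then have "p \<in> E - insert e E1" using p by blast
          then obtain s where "s > 0" "\<forall>z\<in>closure \<Omega> \<inter> ball p s. f z = 0" using insert.prems(3) by blast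
          then show ?thesis by (intro exI[of _ s]) auto
        qed
      qed (use insert.prems(1) in auto)
    qed
  qed
  from this[OF E(1) subset_refl assms] show ?thesis by simp
qed

end

section \<open>Minimal polynomial, resolvent and Hermite interpolation\<close>

lemma matrix_add_rdistrib: "((A + B) ** C) = (A ** C) + ((B :: 'a::semiring_1^'n^'m) ** C)"
  by (vector matrix_matrix_mult_def sum.distrib[symmetric] field_simps)

lemma matrix_diff_rdistrib: "((A - B) ** C) = (A ** C) - ((B :: 'a::ring_1^'n^'m) ** C)"
  by (vector matrix_matrix_mult_def sum_subtractf[symmetric] left_diff_distrib)

lemma matrix_diff_ldistrib: "(C ** (A - B)) = (C ** A) - (C ** (B :: 'a::ring_1^'n^'m))"
  by (vector matrix_matrix_mult_def sum_subtractf[symmetric] right_diff_distrib)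

lemma matrix_mul_zero_left [simp]: "(0 :: 'a::semiring_1^'n^'m) ** A = 0"
  by (vector matrix_matrix_mult_def)

lemma matrix_mul_zero_right [simp]: "(A :: 'a::semiring_1^'n^'m) ** 0 = 0"
  by (vector matrix_matrix_mult_def)

lemma mat_mult_entry: "(mat c ** (M :: 'a::comm_semiring_1^'n^'m)) $ i $ j = c * M $ i $ j"
  by (simp add: matrix_matrix_mult_def mat_def if_distrib[where f="\<lambda>x. x * _"] cong: if_cong)

lemma mult_mat_entry: "((M :: 'a::comm_semiring_1^'n^'m) ** mat c) $ i $ j = c * M $ i $ j"
  by (simp add: matrix_matrix_mult_def mat_def if_distrib[where f="\<lambda>x. _ * x"] mult.commute cong: if_cong)

lemma mat_commute: "mat c ** (M :: 'a::comm_semiring_1^'n^'n) = M ** mat c"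
  by (simp add: vec_eq_iff mat_mult_entry mult_mat_entry)

lemma mat_add: "mat (a + b) = mat a + (mat b :: 'a::monoid_add^'n^'n)"
  by (simp add: vec_eq_iff mat_def)

lemma mat_mult: "mat (a * b) = mat a ** (mat b :: 'a::comm_semiring_1^'n^'n)"
  by (simp add: vec_eq_iff mat_mult_entry) (simp add: mat_def)

lemma mat_vector_mult: "mat c *v (v :: 'a::comm_semiring_1^'n) = c *s v"
  by (simp add: vec_eq_iff matrix_vector_mult_def mat_def if_distrib[where f="\<lambda>x. x * _"] cong: if_cong)

text \<open>Scaling as a product with a scalar matrix turns the identities below into computations
  with an associative product.\<close>

lemma cscale_eq_mat_mult: "c *\<^sub>c M = mat c ** M"
  by (simp add: vec_eq_iff cscale_def mat_mult_entry)

lemma poly_matrix_upto: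
  assumes "degree p \<le> N"
  shows "poly_matrix p A = (\<Sum>k\<le>N. mat (coeff p k) ** matrix_pow A k)"
proof -
  have "(\<Sum>k\<le>N. mat (coeff p k) ** matrix_pow A k) = (\<Sum>k\<le>degree p. mat (coeff p k) ** matrix_pow A k)"
    by (rule sum.mono_neutral_right) (use assms in \<open>auto simp: coeff_eq_0\<close>)
  then show ?thesis by (simp add: poly_matrix_def cscale_eq_mat_mult)
qed

lemma poly_matrix_0 [simp]: "poly_matrix 0 A = 0"
  by (simp add: poly_matrix_def cscale_eq_mat_mult)

lemma matrix_mul_sum_right: "A ** (\<Sum>k\<in>S. f k) = (\<Sum>k\<in>S. (A :: 'a::semiring_1^'n^'m) ** f k)"
  by (induction S rule: infinite_finite_induct) (simp_all add: matrix_add_ldistrib)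

text \<open>Horner's rule; with it polynomial evaluation is handled by induction on
  \<open>pCons\<close> instead of manipulating coefficient sums.\<close>

lemma poly_matrix_pCons: "poly_matrix (pCons c p) A = mat c + A ** poly_matrix p A"
proof -
  have "poly_matrix (pCons c p) A = (\<Sum>k\<le>Suc (degree p). mat (coeff (pCons c p) k) ** matrix_pow A k)"
    by (rule poly_matrix_upto) (simp add: degree_pCons_le)
  also have "\<dots> = mat c + (\<Sum>k\<le>degree p. mat (coeff p k) ** (A ** matrix_pow A k))"
    by (subst sum.atMost_Suc_shift) simp
  also have "(\<Sum>k\<le>degree p. mat (coeff p k) ** (A ** matrix_pow A k)) = A ** poly_matrix p A"
    unfolding poly_matrix_upto[OF order_refl] matrix_mul_sum_right
    by (simp add: matrix_mul_assoc mat_commute[of _ A])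
  finally show ?thesis .
qed

lemma poly_matrix_add: "poly_matrix (p + q) A = poly_matrix p A + poly_matrix q A"
  by (induction p q rule: poly_induct2) (simp_all add: poly_matrix_pCons mat_add matrix_add_ldistrib)

lemma poly_matrix_smult: "poly_matrix (smult c p) A = mat c ** poly_matrix p A"
  by (induction p) (simp_all add: poly_matrix_pCons mat_mult matrix_add_ldistrib matrix_mul_assoc mat_commute[of c A])

lemma poly_matrix_mult: "poly_matrix (p * q) A = poly_matrix p A ** poly_matrix q A"
  by (induction p) (simp_all add: poly_matrix_pCons poly_matrix_add poly_matrix_smult
      matrix_add_rdistrib matrix_mul_assoc)

lemma poly_matrix_diff: "poly_matrix (p - q) A = poly_matrix p A - poly_matrix q A"
  using poly_matrix_add[of "p - q" q A] by simp

lemma poly_matrix_commute: "A ** poly_matrix p A = poly_matrix p A ** A"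
  by (induction p) (simp_all add: poly_matrix_pCons matrix_add_ldistrib matrix_add_rdistrib
      matrix_mul_assoc mat_commute)

lemma poly_matrix_const: "poly_matrix [:c:] A = mat c"
  by (simp add: poly_matrix_pCons)

lemma poly_matrix_1: "poly_matrix 1 A = mat 1"
  by (simp only: one_pCons poly_matrix_const)

lemma poly_matrix_linear: "poly_matrix [:- l, 1:] A = A - mat l"
  by (simp add: poly_matrix_pCons) (simp add: vec_eq_iff mat_def)

lemma poly_matrix_eigenvector:
  assumes "A *v v = l *s v"
  shows "poly_matrix p A *v v = poly p l *s v"
proof (induction p)
  case (pCons c p)
  have "poly_matrix (pCons c p) A *v v = c *s v + A *v (poly_matrix p A *v v)"
    by (simp only: poly_matrix_pCons matrix_vector_mult_add_rdistrib mat_vector_mult matrix_vector_mul_assoc)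
  also have "\<dots> = c *s v + poly p l *s (l *s v)"
    by (simp only: pCons.IH vector_scalar_commute assms)
  also have "\<dots> = poly (pCons c p) l *s v"
    by (simp add: vec_eq_iff algebra_simps)
  finally show ?case .
qed simp

section \<open>Minimal polynomial and eigenvalues\<close>

lemma annihilating_polynomial_exists:
  fixes A :: "complex^'n^'n"
  shows "\<exists>p. p \<noteq> 0 \<and> poly_matrix p A = 0"
\<comment> \<open>If two powers coincide, the set of powers may be too small for a dimension count,
  but then a difference of two monomials annihilates \<open>A\<close>. Otherwise more powers than
  the real dimension are linearly dependent.\<close>
proof (cases "inj (matrix_pow A)")
  case False
  then obtain i j where ij: "i \<noteq> j" "matrix_pow A i = matrix_pow A j" by (auto simp: inj_def)
  have mono: "poly_matrix (monom 1 k) A = matrix_pow A k" for k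
    by (induction k) (simp_all add: monom_Suc poly_matrix_pCons monom_0 poly_matrix_1)
  have "poly_matrix (monom 1 i - monom 1 j) A = 0" using ij by (simp add: poly_matrix_diff mono)
  moreover have "monom 1 i - monom 1 j \<noteq> (0 :: complex poly)"
    using ij(1) by (auto simp: poly_eq_iff)
  ultimately show ?thesis by blast
next
  case True
  define D where "D = DIM(complex^'n^'n)"
  have inj: "inj_on (matrix_pow A) {..D}" using True by (rule inj_on_subset) auto
  have "dependent (matrix_pow A ` {..D})"
  proof (rule dependent_biggerset)
    have "card (matrix_pow A ` {..D}) = Suc D" using card_image[OF inj] by simp
    then show "DIM(complex^'n^'n) < card (matrix_pow A ` {..D})" by (simp only: D_def lessI)
  qed
  then obtain u where u: "\<exists>v\<in>matrix_pow A ` {..D}. u v \<noteq> 0" "(\<Sum>v\<in>matrix_pow A ` {..D}. u v *\<^sub>R v) = 0"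
    by (subst (asm) real_vector.dependent_finite) auto
  define p where "p = (\<Sum>k\<le>D. monom (complex_of_real (u (matrix_pow A k))) k)"
  have c: "coeff p k = (if k \<le> D then of_real (u (matrix_pow A k)) else 0)" for k
    by (simp add: p_def coeff_sum)
  have deg: "degree p \<le> D" by (rule degree_le) (simp add: c)
  have "p \<noteq> 0"
  proof -
    obtain k where "k \<le> D" "u (matrix_pow A k) \<noteq> 0" using u(1) by auto
    then have "coeff p k \<noteq> 0" by (simp add: c)
    then show ?thesis by auto
  qed
  moreover have "poly_matrix p A = (\<Sum>k\<le>D. u (matrix_pow A k) *\<^sub>R matrix_pow A k)"
    unfolding poly_matrix_upto[OF deg] c
    by (rule sum.cong[OF refl], simp add: vec_eq_iff mat_mult_entry) (simp add: scaleR_conv_of_real)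
  then have "poly_matrix p A = 0" using u(2) by (simp add: sum.reindex[OF inj])
  ultimately show ?thesis by blast
qed

lemma minimal_polynomial_props:
  fixes A :: "complex^'n^'n"
  shows "lead_coeff (minimal_polynomial A) = 1" "poly_matrix (minimal_polynomial A) A = 0"
    "\<And>q. q \<noteq> 0 \<Longrightarrow> poly_matrix q A = 0 \<Longrightarrow> degree (minimal_polynomial A) \<le> degree q"
proof -
  let ?P = "\<lambda>m. lead_coeff m = 1 \<and> poly_matrix m A = 0 \<and>
        (\<forall>q. q \<noteq> 0 \<and> poly_matrix q A = 0 \<longrightarrow> degree m \<le> degree q)"
  define d where "d = (LEAST d. \<exists>p. p \<noteq> 0 \<and> poly_matrix p A = 0 \<and> degree p = d)"
  have ex: "\<exists>d p. p \<noteq> 0 \<and> poly_matrix p A = 0 \<and> degree p = d"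
    using annihilating_polynomial_exists by blast
  obtain p where p: "p \<noteq> 0" "poly_matrix p A = 0" "degree p = d"
    using LeastI_ex[OF ex] unfolding d_def by blast
  have least: "d \<le> degree q" if "q \<noteq> 0" "poly_matrix q A = 0" for q
    unfolding d_def by (rule Least_le) (use that in blast)
  define m where "m = smult (inverse (lead_coeff p)) p"
  have m: "?P m"
    using p least by (auto simp: m_def poly_matrix_smult)
  have uniq: "m' = m" if "?P m'" for m'
  proof (rule ccontr)
    assume "m' \<noteq> m"
    then have nz: "m' - m \<noteq> 0" by simp
    have "m' \<noteq> 0" "m \<noteq> 0" using that m by auto
    then have deg: "degree m' = degree m" using that m by (metis le_antisym)
    \<comment> \<open>Subtracting two monic polynomials lowers the degree, except in degree 0, where
      no lower degree exists.\<close>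
    have "degree (m' - m) < degree m \<or> degree m = 0"
    proof (cases "degree m = 0")
      case False
      have "degree (m' - m) \<le> degree m" using degree_diff_le_max[of m' m] deg by simp
      moreover have "coeff (m' - m) (degree m) = 0" using that m deg by simp
      ultimately have "degree (m' - m) \<noteq> degree m" using nz by (metis leading_coeff_0_iff)
      then show ?thesis using \<open>degree (m' - m) \<le> degree m\<close> by simp
    qed simp
    moreover have "degree m \<le> degree (m' - m)"
      using m that nz by (auto simp: poly_matrix_diff)
    ultimately have "degree m = 0" by simp
    then have "m' = m" using deg that m by (metis degree_eq_zeroE coeff_pCons_0 degree_pCons_0)
    then show False using \<open>m' \<noteq> m\<close> by simp
  qed
  have "minimal_polynomial A = m"
    unfolding minimal_polynomial_def by (rule the_equality, rule m, rule uniq)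
  then show "lead_coeff (minimal_polynomial A) = 1" "poly_matrix (minimal_polynomial A) A = 0"
    "\<And>q. q \<noteq> 0 \<Longrightarrow> poly_matrix q A = 0 \<Longrightarrow> degree (minimal_polynomial A) \<le> degree q"
    using m by auto
qed

lemma minimal_polynomial_nonzero [simp]: "minimal_polynomial A \<noteq> 0"
  using minimal_polynomial_props(1)[of A] by auto

lemma degree_minimal_polynomial_pos: "degree (minimal_polynomial A) > 0"
proof (rule ccontr)
  assume "\<not> ?thesis"
  then obtain c where c: "minimal_polynomial A = [:c:]" by (auto elim: degree_eq_zeroE)
  then have "c = 1" using minimal_polynomial_props(1)[of A] by simp
  then have "mat 1 = (0 :: complex^'a^'a)"
    using minimal_polynomial_props(2)[of A] c by (simp add: poly_matrix_const)
  then show False by (simp add: vec_eq_iff mat_def) (metis zero_neq_one)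
qed

lemma poly_matrix_proper_divisor:
  assumes "minimal_polynomial A = [:- l, 1:] * q"
  shows "poly_matrix q A \<noteq> 0"
proof
  assume 0: "poly_matrix q A = 0"
  have "q \<noteq> 0" using assms minimal_polynomial_nonzero[of A] by auto
  then have "degree (minimal_polynomial A) \<le> degree q" using 0 minimal_polynomial_props(3) by blast
  moreover have "degree (minimal_polynomial A) = Suc (degree q)"
    unfolding assms using \<open>q \<noteq> 0\<close> by (subst degree_mult_eq) auto
  ultimately show False by simp
qed

lemma eigenvalues_eq_roots: "l \<in> eigenvalues A \<longleftrightarrow> poly (minimal_polynomial A) l = 0"
proof
  assume "l \<in> eigenvalues A"
  then obtain v where v: "v \<noteq> 0" "A *v v = l *s v" by (auto simp: eigenvalues_def)
  from poly_matrix_eigenvector[OF v(2), of "minimal_polynomial A"]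
  have "poly (minimal_polynomial A) l *s v = 0" by (simp add: minimal_polynomial_props)
  then show "poly (minimal_polynomial A) l = 0" using v(1) by simp
next
  assume "poly (minimal_polynomial A) l = 0"
  then obtain q where q: "minimal_polynomial A = [:- l, 1:] * q" by (auto simp: poly_eq_0_iff_dvd)
  \<comment> \<open>By minimality \<open>q\<close> does not annihilate \<open>A\<close>, so some
    vector has a nonzero image under \<open>poly_matrix q A\<close>; this image is the
    eigenvector.\<close>
  obtain u where u: "poly_matrix q A *v u \<noteq> 0"
    using poly_matrix_proper_divisor[OF q] matrix_eq[of "poly_matrix q A" 0] by auto
  have "(A - mat l) *v (poly_matrix q A *v u) = 0"
    using minimal_polynomial_props(2)[of A] unfolding q poly_matrix_mult poly_matrix_linear
    by (simp add: matrix_vector_mul_assoc)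
  then have "A *v (poly_matrix q A *v u) = l *s (poly_matrix q A *v u)"
    by (simp add: matrix_vector_mult_diff_rdistrib mat_vector_mult)
  then show "l \<in> eigenvalues A" unfolding eigenvalues_def using u by blast
qed

lemma finite_eigenvalues: "finite (eigenvalues A)"
proof -
  have "eigenvalues A = {l. poly (minimal_polynomial A) l = 0}" by (auto simp: eigenvalues_eq_roots)
  then show ?thesis by (simp add: poly_roots_finite)
qed

text \<open>Independence of a nilpotent chain: \<open>N\<^sup>i w\<close> is not killed by \<open>N\<^sup>k\<^sup>-\<^sup>1\<^sup>-\<^sup>i\<close>, whereas the later
  members of the chain are.\<close>

lemma nilpotent_chain_length:
  fixes N :: "complex^'n^'n"
  assumes nz: "matrix_pow N k *v w \<noteq> 0" and z: "matrix_pow N (Suc k) *v w = 0"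
  shows "Suc k \<le> CARD('n)"
proof -
  have pow_add: "matrix_pow N (i + j) = matrix_pow N i ** matrix_pow N j" for i j
    by (induction i) (simp_all add: matrix_mul_assoc)
  have zero: "matrix_pow N j *v w = 0" if "Suc k \<le> j" for j
  proof -
    have "matrix_pow N j = matrix_pow N (j - Suc k) ** matrix_pow N (Suc k)"
      using pow_add[of "j - Suc k" "Suc k"] that by simp
    then show ?thesis using z by (simp only: matrix_vector_mul_assoc[symmetric] matrix_vector_mult_0_right)
  qed
  \<comment> \<open>The chain is built from its end: the last \<open>i\<close> members are
    independent.\<close>
  have "vec.independent ((\<lambda>j. matrix_pow N j *v w) ` {Suc k - i..k}) \<and>
      card ((\<lambda>j. matrix_pow N j *v w) ` {Suc k - i..k}) = i" if "i \<le> Suc k" for i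
    using that
  proof (induction i)
    case 0
    then show ?case by (simp add: vec.independent_empty)
  next
    case (Suc i)
    let ?S = "(\<lambda>j. matrix_pow N j *v w) ` {Suc k - i..k}"
    let ?j = "k - i"
    have "{Suc k - Suc i..k} = insert ?j {Suc k - i..k}" using Suc.prems by auto
    then have eq: "(\<lambda>j. matrix_pow N j *v w) ` {Suc k - Suc i..k} = insert (matrix_pow N ?j *v w) ?S"
      by simp
    have "?S \<subseteq> {x. matrix_pow N i *v x = 0}"
    proof
      fix x assume "x \<in> ?S"
      then obtain j where j: "Suc k - i \<le> j" "j \<le> k" "x = matrix_pow N j *v w" by auto
      have "matrix_pow N i *v x = matrix_pow N (i + j) *v w"
        by (simp add: j(3) pow_add matrix_vector_mul_assoc)
      also have "\<dots> = 0" by (rule zero) (use j Suc.prems in linarith)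
      finally show "x \<in> {x. matrix_pow N i *v x = 0}" by simp
    qed
    moreover have "vec.subspace {x. matrix_pow N i *v x = 0}"
      unfolding vec.subspace_def
      by (auto simp: matrix_vector_right_distrib vector_scalar_commute)
    ultimately have "vec.span ?S \<subseteq> {x. matrix_pow N i *v x = 0}" by (rule vec.span_minimal)
    moreover have "matrix_pow N i *v (matrix_pow N ?j *v w) \<noteq> 0"
      using nz pow_add[of i ?j] Suc.prems by (simp add: matrix_vector_mul_assoc)
    ultimately have notin: "matrix_pow N ?j *v w \<notin> vec.span ?S" by blast
    have "matrix_pow N ?j *v w \<notin> ?S"
    proof
      assume "matrix_pow N ?j *v w \<in> ?S"
      then show False using notin vec.span_base by (rule_tac notE)
    qed
    then have "card (insert (matrix_pow N ?j *v w) ?S) = Suc (card ?S)"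
      by (rule card_insert_disjoint[OF finite_imageI[OF finite_atLeastAtMost]])
    moreover have IH: "vec.independent ?S \<and> card ?S = i" using Suc.prems by (intro Suc.IH) simp
    ultimately show ?case
      unfolding eq using vec.independent_insertI[OF notin conjunct1[OF IH]] by argo
  qed
  note chain = this[OF order_refl, unfolded diff_self_eq_0]
  note ind = conjunct1[OF chain] and c = conjunct2[OF chain]
  from vec.independent_card_le_dim[OF subset_UNIV ind] show ?thesis
    unfolding c vec_dim_card .
qed

text \<open>Write the minimal polynomial as (x - l)^(k+1) q. By minimality (A - l)^k q(A) is not 0,
  so for some v the vector q(A) v generates a nilpotent chain of length k + 1. Hence the
  interpolation conditions involve derivatives up to order n - 1 only.\<close>

lemma order_minimal_polynomial_le:
  fixes A :: "complex^'n^'n"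
  shows "order l (minimal_polynomial A) \<le> CARD('n)"
proof (cases "order l (minimal_polynomial A)")
  case (Suc k)
  obtain q where q: "minimal_polynomial A = [:- l, 1:] ^ Suc k * q"
    using order_1[of l "minimal_polynomial A"] Suc by auto
  have pow: "poly_matrix ([:- l, 1:] ^ j) A = matrix_pow (A - mat l) j" for j
    by (induction j) (simp_all only: power_0 power_Suc poly_matrix_mult poly_matrix_linear
        poly_matrix_1 matrix_pow.simps)
  have "minimal_polynomial A = [:- l, 1:] * ([:- l, 1:] ^ k * q)" unfolding q by (simp only: power_Suc mult.assoc)
  from poly_matrix_proper_divisor[OF this]
  have "matrix_pow (A - mat l) k ** poly_matrix q A \<noteq> 0" by (simp add: poly_matrix_mult pow)
  then obtain v where "(matrix_pow (A - mat l) k ** poly_matrix q A) *v v \<noteq> 0"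
    using matrix_eq[of "matrix_pow (A - mat l) k ** poly_matrix q A" 0] by auto
  then have nz: "matrix_pow (A - mat l) k *v (poly_matrix q A *v v) \<noteq> 0"
    by (simp add: matrix_vector_mul_assoc)
  have "matrix_pow (A - mat l) (Suc k) ** poly_matrix q A = 0"
    using minimal_polynomial_props(2)[of A] unfolding q poly_matrix_mult pow .
  then have "matrix_pow (A - mat l) (Suc k) *v (poly_matrix q A *v v) = 0"
    by (simp only: matrix_vector_mul_assoc matrix_vector_mult_0)
  from nilpotent_chain_length[OF nz this] show ?thesis using Suc by simp
qed simp

section \<open>The resolvent as a rational function\<close>

lemma poly_matrix_remainder:
  fixes A :: "complex^'n^'n"
  obtains Q where "\<And>z. mat (poly p z) - poly_matrix p A = (\<chi> i j. poly (Q i j) z) ** (mat z - A)"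
    "\<And>i j. Q i j = 0 \<or> degree (Q i j) < degree p"
proof -
  have "\<exists>Q. (\<forall>z. mat (poly p z) - poly_matrix p A = (\<chi> i j. poly (Q i j) z) ** (mat z - A)) \<and>
     (\<forall>i j. Q i j = 0 \<or> degree (Q i j) < degree p)"
  proof (induction p)
    case 0
    have "(\<chi> i j. poly 0 z) = (0 :: complex^'n^'n)" for z :: complex by (simp add: vec_eq_iff)
    then show ?case by (intro exI[of _ "\<lambda>_ _. 0"]) simp
  next
    case (pCons c p)
    from pCons.IH obtain Q
      where Q: "\<forall>z. mat (poly p z) - poly_matrix p A = (\<chi> i j. poly (Q i j) z) ** (mat z - A)"
        "\<forall>i j. Q i j = 0 \<or> degree (Q i j) < degree p" by (elim exE conjE)
    note Q = Q(1)[rule_format] Q(2)[rule_format]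
    \<comment> \<open>Synthetic division by z - A with matrix coefficients: the new quotient is p(A)
      + z Q(z).\<close>
    define Q' where "Q' i j = pCons (poly_matrix p A $ i $ j) (Q i j)" for i j
    have "mat (poly (pCons c p) z) - poly_matrix (pCons c p) A = (\<chi> i j. poly (Q' i j) z) ** (mat z - A)" for z
    proof -
      let ?P = "poly_matrix p A" and ?Q = "(\<chi> i j. poly (Q i j) z) :: complex^'n^'n"
      have "(\<chi> i j. poly (Q' i j) z) = ?P + mat z ** ?Q"
        by (simp only: vec_eq_iff vec_lambda_beta vector_add_component mat_mult_entry Q'_def poly_pCons) simp
      then have "(\<chi> i j. poly (Q' i j) z) ** (mat z - A) = ?P ** (mat z - A) + mat z ** (mat (poly p z) - ?P)"
        unfolding Q by (simp add: matrix_add_rdistrib matrix_mul_assoc)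
      also have "\<dots> = mat z ** mat (poly p z) - A ** ?P"
        by (simp add: matrix_diff_ldistrib poly_matrix_commute mat_commute[of z ?P])
      also have "\<dots> = mat (poly (pCons c p) z) - poly_matrix (pCons c p) A"
        by (simp add: poly_matrix_pCons mat_add mat_mult)
      finally show ?thesis by simp
    qed
    moreover have "Q' i j = 0 \<or> degree (Q' i j) < degree (pCons c p)" for i j
    proof (cases "p = 0")
      case True
      then show ?thesis using Q(2)[of i j] by (simp add: Q'_def)
    next
      case False
      have "degree (Q' i j) \<le> degree p"
        using Q(2)[of i j] degree_pCons_le[of "poly_matrix p A $ i $ j" "Q i j"]
        by (auto simp: Q'_def)
      then show ?thesis using False by simp
    qed
    ultimately show ?case by blast
  qed
  then show ?thesis using that by blast
qed

text \<open>For the minimal polynomial m the remainder m(A) vanishes, so m(z) I = Q(z) (z I - A),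
  and Q(z) / m(z) inverts z I - A.\<close>

lemma resolvent_rational:
  fixes A :: "complex^'n^'n"
  obtains q where
    "\<And>z i j. z \<notin> eigenvalues A \<Longrightarrow> resolvent A z $ i $ j = poly (q i j) z / poly (minimal_polynomial A) z"
    "\<And>i j. q i j = 0 \<or> degree (q i j) < degree (minimal_polynomial A)"
    "\<And>z. z \<notin> eigenvalues A \<Longrightarrow> (mat z - A) ** resolvent A z = mat 1"

proof -
  let ?m = "minimal_polynomial A"
  obtain Q where Q: "\<And>z. mat (poly ?m z) - poly_matrix ?m A = (\<chi> i j. poly (Q i j) z) ** (mat z - A)"
    "\<And>i j. Q i j = 0 \<or> degree (Q i j) < degree ?m"
    using poly_matrix_remainder[of ?m A] by blast
  have main: "resolvent A z = mat (1 / poly ?m z) ** (\<chi> i j. poly (Q i j) z) \<and> (mat z - A) ** resolvent A z = mat 1"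
    if "z \<notin> eigenvalues A" for z
  proof -
    have nz: "poly ?m z \<noteq> 0" using that by (simp add: eigenvalues_eq_roots)
    let ?R = "mat (1 / poly ?m z) ** (\<chi> i j. poly (Q i j) z)"
    have "?R ** (mat z - A) = mat (1 / poly ?m z) ** mat (poly ?m z)"
      using Q(1)[of z] by (simp add: minimal_polynomial_props matrix_mul_assoc[symmetric])
    then have 1: "?R ** (mat z - A) = mat 1" using nz by (simp add: mat_mult[symmetric])
    then have 2: "(mat z - A) ** ?R = mat 1" by (simp only: matrix_left_right_inverse)
    \<comment> \<open>\<open>matrix_inv\<close> is a choice among two-sided inverses, so one has to
      be exhibited.\<close>
    have ex: "\<exists>B. (mat z - A) ** B = mat 1 \<and> B ** (mat z - A) = mat 1" using 1 2 by blast
    have inv: "(mat z - A) ** resolvent A z = mat 1 \<and> resolvent A z ** (mat z - A) = mat 1"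
      unfolding resolvent_def matrix_inv_def by (rule someI_ex[OF ex])
    have "resolvent A z = (?R ** (mat z - A)) ** resolvent A z" unfolding 1 by simp
    also have "\<dots> = ?R ** ((mat z - A) ** resolvent A z)" by (simp only: matrix_mul_assoc)
    also have "\<dots> = ?R" using inv by simp
    finally show ?thesis using inv by simp
  qed
  show ?thesis
  proof (rule that[of Q])
    fix z assume z: "z \<notin> eigenvalues A"
    show "(mat z - A) ** resolvent A z = mat 1" using main[OF z] by blast
    show "resolvent A z $ i $ j = poly (Q i j) z / poly ?m z" for i j
      using main[OF z] by (simp add: mat_mult_entry)
  qed (rule Q(2))
qed

section \<open>Hermite interpolation\<close>

lemma higher_pderiv_order:
  fixes p :: "complex poly"
  assumes "p \<noteq> 0"
  shows "(\<forall>\<nu><order l p. poly ((pderiv ^^ \<nu>) p) l = 0) \<and> poly ((pderiv ^^ order l p) p) l \<noteq> 0"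
  using assms
proof (induction "order l p" arbitrary: p)
  case 0
  then show ?case by (simp add: order_root)
next
  case (Suc k)
  then have root: "poly p l = 0" using order_root by force
  have o: "order l p = Suc (order l (pderiv p))" using Suc.prems root by (rule order_pderiv)
  have "pderiv p \<noteq> 0"
  proof
    assume "pderiv p = 0"
    then obtain c where "p = [:c:]" using pderiv_iszero by blast
    then show False using root Suc.prems by simp
  qed
  moreover have k: "k = order l (pderiv p)" using o Suc.hyps(2) by simp
  ultimately have IH: "(\<forall>\<nu><k. poly ((pderiv ^^ \<nu>) (pderiv p)) l = 0) \<and> poly ((pderiv ^^ k) (pderiv p)) l \<noteq> 0"
    using Suc.hyps(1)[OF k] by simp
  show ?case
  proof (intro conjI allI impI)
    fix \<nu> assume "\<nu> < order l p"
    then show "poly ((pderiv ^^ \<nu>) p) l = 0"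
      using IH root Suc.hyps(2) by (cases \<nu>) (auto simp: funpow_swap1)
  next
    show "poly ((pderiv ^^ order l p) p) l \<noteq> 0"
      unfolding Suc.hyps(2)[symmetric] using IH by (simp add: funpow_swap1)
  qed
qed

lemma higher_pderiv_add: "(pderiv ^^ k) (p + q) = (pderiv ^^ k) p + (pderiv ^^ k) q"
  by (induction k) (simp_all add: pderiv_add)

lemma higher_pderiv_smult: "(pderiv ^^ k) (smult c p) = smult c ((pderiv ^^ k) p)"
  by (induction k) (simp_all add: pderiv_smult)

lemma order_ge_iff_higher_pderiv:
  fixes p :: "complex poly"
  assumes "\<And>\<nu>. \<nu> < k \<Longrightarrow> poly ((pderiv ^^ \<nu>) p) l = 0" "p \<noteq> 0"
  shows "k \<le> order l p"
  using higher_pderiv_order[OF assms(2), of l] assms(1) by (meson not_less)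

text \<open>The prescribed jets \<open>c\<close> are arbitrary and independent of \<open>m\<close>,
  so that an induction on \<open>m\<close> can keep them fixed.\<close>

definition hermite_conditions :: "complex poly \<Rightarrow> (nat \<Rightarrow> complex \<Rightarrow> complex) \<Rightarrow> complex poly \<Rightarrow> bool" where
  "hermite_conditions m c p \<longleftrightarrow>
     (\<forall>l. poly m l = 0 \<longrightarrow> (\<forall>\<nu> < order l m. poly ((pderiv ^^ \<nu>) p) l = c \<nu> l))"

lemma poly_complex_root_exists:
  fixes p :: "complex poly"
  assumes "degree p \<noteq> 0"
  shows "\<exists>z. poly p z = 0"
  by (rule fundamental_theorem_of_algebra_alt) (use assms in auto)

text \<open>Newton interpolation: the polynomial \<open>m / (x - l)\<close> has a nonzero derivative only in the one
  condition that \<open>m\<close> imposes in addition.\<close>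

lemma hermite_exists:
  assumes "m \<noteq> 0"
  shows "\<exists>p. (p = 0 \<or> degree p < degree m) \<and> hermite_conditions m c p"
  using assms
proof (induction "degree m" arbitrary: m)
  case 0
  then obtain c0 where "m = [:c0:]" "c0 \<noteq> 0" by (metis degree_eq_zeroE pCons_0_0)
  then have "poly m l \<noteq> 0" for l by simp
  then show ?case by (intro exI[of _ 0]) (auto simp: hermite_conditions_def)
next
  case (Suc d)
  then obtain l where l: "poly m l = 0"
    using poly_complex_root_exists[of m] by auto
  then obtain q where q: "m = [:- l, 1:] * q" by (auto simp: poly_eq_0_iff_dvd)
  have q0: "q \<noteq> 0" using q Suc.prems by auto
  have deg: "degree m = Suc (degree q)" unfolding q using q0 by (subst degree_mult_eq) auto
  have "d = degree q" using Suc.hyps(2) deg by simp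
  from Suc.hyps(1)[OF this q0] obtain p where p: "p = 0 \<or> degree p < degree q" "hermite_conditions q c p"
    by (elim exE conjE)
  define k where "k = order l q"
  have ol: "order l m = Suc k"
  proof -
    have "order l [:- l, 1:] = 1" using order_power_n_n[of l 1] by simp
    then show ?thesis using order_mult[of "[:- l, 1:]" q l] Suc.prems by (simp add: q k_def)
  qed
  have oo: "order l' m = order l' q" if "l' \<noteq> l" for l'
  proof -
    have "order l' [:- l, 1:] = 0" using that by (intro order_0I) simp
    then show ?thesis using order_mult[of "[:- l, 1:]" q l'] Suc.prems by (simp add: q)
  qed
  note hq = higher_pderiv_order[OF q0]
  \<comment> \<open>Solves the single new condition, the derivative of order \<open>k\<close> at
    \<open>l\<close>; the denominator is nonzero because \<open>k\<close> is the order of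
    \<open>l\<close> as a root of \<open>q\<close>.\<close>
  define \<alpha> where "\<alpha> = (c k l - poly ((pderiv ^^ k) p) l) / poly ((pderiv ^^ k) q) l"
  define p' where "p' = p + smult \<alpha> q"
  have val: "poly ((pderiv ^^ \<nu>) p') l' = poly ((pderiv ^^ \<nu>) p) l' + \<alpha> * poly ((pderiv ^^ \<nu>) q) l'" for \<nu> l'
    by (simp add: p'_def higher_pderiv_add higher_pderiv_smult)
  have cond: "poly ((pderiv ^^ \<nu>) p) l' = c \<nu> l'" if "\<nu> < order l' q" for \<nu> l'
    using p(2) that q0 by (auto simp: hermite_conditions_def order_root)
  have "hermite_conditions m c p'"
    unfolding hermite_conditions_def
  proof (intro allI impI)
    fix l' \<nu> assume "poly m l' = 0" and \<nu>: "\<nu> < order l' m"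
    show "poly ((pderiv ^^ \<nu>) p') l' = c \<nu> l'"
    proof (cases "\<nu> < order l' q")
      case True
      then show ?thesis using hq[of l'] cond by (simp add: val)
    next
      case False
      then have "l' = l" using \<nu> oo[of l'] by auto
      then have "\<nu> = k" using False \<nu> ol by (simp add: k_def)
      with \<open>l' = l\<close> show ?thesis using hq[of l] by (simp add: val \<alpha>_def k_def)
    qed
  qed
  moreover have "degree p' < degree m"
    unfolding p'_def deg using p(1) degree_smult_le[of \<alpha> q]
    by (intro le_imp_less_Suc degree_add_le) auto
  ultimately show ?case by blast
qed

lemma dvd_if_order_le:
  fixes m p :: "complex poly"
  assumes "m \<noteq> 0" "p \<noteq> 0" "\<And>l. order l m \<le> order l p"
  shows "m dvd p"
  using assms
proof (induction "degree m" arbitrary: m p)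
  case 0
  then have "is_unit m" by (simp add: is_unit_iff_degree)
  then show ?case by (rule unit_imp_dvd)
next
  case (Suc d)
  then obtain l where l: "poly m l = 0"
    using poly_complex_root_exists[of m] by auto
  then obtain q where q: "m = [:- l, 1:] * q" by (auto simp: poly_eq_0_iff_dvd)
  have "order l m \<noteq> 0" using l Suc.prems(1) order_root by blast
  then have "order l p \<noteq> 0" using Suc.prems(3)[of l] by simp
  then have "poly p l = 0" using order_root by blast
  then obtain p1 where p1: "p = [:- l, 1:] * p1" by (auto simp: poly_eq_0_iff_dvd)
  have nz: "q \<noteq> 0" "p1 \<noteq> 0" using q p1 Suc.prems by auto
  have "degree m = Suc (degree q)" unfolding q using nz by (subst degree_mult_eq) auto
  moreover have "order l' q \<le> order l' p1" for l'
    using Suc.prems(3)[of l'] order_mult[of "[:- l, 1:]" q l'] order_mult[of "[:- l, 1:]" p1 l']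
      Suc.prems(1,2) by (simp add: q p1)
  ultimately have "q dvd p1" using Suc.hyps nz by simp
  then show ?case unfolding q p1 by (rule mult_dvd_mono[OF dvd_refl])
qed

text \<open>The difference vanishes at each root of \<open>m\<close> to the order of that root, so
  \<open>m\<close> divides it, although its degree is too small for a nonzero multiple.\<close>

lemma hermite_unique:
  assumes "m \<noteq> 0" "degree p < degree m" "degree p' < degree m"
    "hermite_conditions m c p" "hermite_conditions m c p'"
  shows "p = p'"
proof (rule ccontr)
  assume "p \<noteq> p'"
  then have nz: "p - p' \<noteq> 0" by simp
  have "order l m \<le> order l (p - p')" for l
  proof (cases "poly m l = 0")
    case True
    show ?thesis
    proof (rule order_ge_iff_higher_pderiv[OF _ nz])
      fix \<nu> assume "\<nu> < order l m"
      then have "poly ((pderiv ^^ \<nu>) p) l = poly ((pderiv ^^ \<nu>) p') l"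
        using assms(4,5) True by (simp add: hermite_conditions_def)
      moreover have "(pderiv ^^ \<nu>) (p - p') = (pderiv ^^ \<nu>) p - (pderiv ^^ \<nu>) p'"
        using higher_pderiv_add[of \<nu> "p - p'" p'] by simp
      ultimately show "poly ((pderiv ^^ \<nu>) (p - p')) l = 0" by simp
    qed
  next
    case False
    then show ?thesis by (simp add: order_0I)
  qed
  then have "m dvd p - p'"
    using assms(1) nz by (intro dvd_if_order_le) auto
  then have "degree m \<le> degree (p - p')" using nz by (rule dvd_imp_degree_le)
  moreover have "degree (p - p') < degree m"
    using assms(2,3) degree_diff_le_max[of p p'] by (meson le_less_trans max_less_iff_conj)
  ultimately show False by simp
qed

lemma hermite_interpolant_props:
  shows "hermite_conditions (minimal_polynomial A) (\<lambda>\<nu>. (wirtinger ^^ \<nu>) \<phi>) (hermite_interpolant \<phi> A)"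
proof -
  let ?m = "minimal_polynomial A" and ?c = "\<lambda>\<nu>. (wirtinger ^^ \<nu>) \<phi>"
  obtain p where p: "p = 0 \<or> degree p < degree ?m" "hermite_conditions ?m ?c p"
    using hermite_exists[of ?m ?c] by auto
  have deg: "degree p < degree ?m" using p(1) degree_minimal_polynomial_pos[of A] by auto
  have "hermite_interpolant \<phi> A = p"
    unfolding hermite_interpolant_def
  proof (rule the_equality)
    show "degree p < degree ?m \<and> (\<forall>l. poly ?m l = 0 \<longrightarrow> (\<forall>\<nu><order l ?m. poly ((pderiv ^^ \<nu>) p) l = (wirtinger ^^ \<nu>) \<phi> l))"
      using deg p(2) by (simp add: hermite_conditions_def)
    fix p' assume "degree p' < degree ?m \<and> (\<forall>l. poly ?m l = 0 \<longrightarrow> (\<forall>\<nu><order l ?m. poly ((pderiv ^^ \<nu>) p') l = (wirtinger ^^ \<nu>) \<phi> l))"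
    then show "p' = p"
      using deg p(2) by (intro hermite_unique[of ?m _ _ ?c]) (auto simp: hermite_conditions_def)
  qed
  then show ?thesis using p(2) by simp
qed

section \<open>Derivatives as limits of Fourier coefficients\<close>

lemma C1_from_partials:
  fixes f fx fy :: "complex \<Rightarrow> complex"
  assumes opn: "open \<Omega>" and z: "z \<in> \<Omega>"
    and fx: "\<And>z. z \<in> \<Omega> \<Longrightarrow> ((\<lambda>t::real. f (z + of_real t)) has_vector_derivative fx z) (at 0)"
    and fy: "\<And>z. z \<in> \<Omega> \<Longrightarrow> ((\<lambda>t::real. f (z + \<i> * of_real t)) has_vector_derivative fy z) (at 0)"
    and cont: "continuous_on \<Omega> fy"
  shows "(f has_derivative (\<lambda>h. fx z * of_real (Re h) + fy z * of_real (Im h))) (at z)"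
  unfolding has_derivative_at_alt
proof (intro conjI allI impI)
  show "bounded_linear (\<lambda>h. fx z * of_real (Re h) + fy z * of_real (Im h))"
    by (intro bounded_linear_add
        bounded_linear_compose[OF bounded_linear_mult_right bounded_linear_compose[OF bounded_linear_of_real bounded_linear_Re]]
        bounded_linear_compose[OF bounded_linear_mult_right bounded_linear_compose[OF bounded_linear_of_real bounded_linear_Im]])
  fix e :: real assume e: "e > 0"
  obtain r where r: "r > 0" "ball z r \<subseteq> \<Omega>" using opn z open_contains_ball by blast
  have "continuous (at z) fy" using cont opn z continuous_on_eq_continuous_at by blast
  then obtain d1 where d1: "d1 > 0" "\<And>w. dist w z < d1 \<Longrightarrow> dist (fy w) (fy z) < e / 2"
    using e unfolding continuous_at_eps_delta by (metis half_gt_zero)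
  have "((\<lambda>t::real. f (z + of_real t)) has_derivative (\<lambda>t. t *\<^sub>R fx z)) (at 0)"
    using fx[OF z] by (simp add: has_vector_derivative_def)
  then obtain d2 where d2: "d2 > 0" "\<And>t::real. norm t < d2 \<Longrightarrow> norm (f (z + of_real t) - f z - t *\<^sub>R fx z) \<le> (e / 2) * norm t"
    using e unfolding has_derivative_at_alt by (metis diff_zero half_gt_zero of_real_0 add_0_right)
  define d where "d = min r (min d1 d2)"
  have d: "d > 0" "d \<le> r" "d \<le> d1" "d \<le> d2" using r d1 d2 by (auto simp: d_def)
  have "norm (f y - f z - (fx z * of_real (Re (y - z)) + fy z * of_real (Im (y - z)))) \<le> e * norm (y - z)"
    if y: "norm (y - z) < d" for y
  proof -
    define h where "h = y - z"
    \<comment> \<open>The increment goes horizontally from \<open>z\<close> to \<open>x\<close>,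
      where differentiability at \<open>z\<close> is enough, and then vertically, where the mean
      value inequality uses the continuity of \<open>fy\<close>.\<close>
    define x where "x = z + of_real (Re h)"
    have yx: "y = x + \<i> * of_real (Im h)" by (simp add: x_def h_def complex_eq_iff)
    have in_ball: "x + \<i> * of_real s \<in> ball z d" if "s \<in> closed_segment 0 (Im h)" for s
    proof -
      have "\<bar>s\<bar> \<le> \<bar>Im h\<bar>" using that by (auto simp: closed_segment_eq_real_ivl split: if_splits)
      then have "norm (Complex (Re h) s) \<le> norm h"
        unfolding complex_norm cmod_def by (simp add: abs_le_square_iff[symmetric])
      moreover have "x + \<i> * of_real s - z = Complex (Re h) s" by (simp add: x_def complex_eq_iff)
      ultimately have "norm (x + \<i> * of_real s - z) \<le> norm h" by simp
      then show ?thesis using y by (simp add: h_def dist_norm norm_minus_commute)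
    qed
    have "norm ((f (x + \<i> * of_real (Im h)) - Im h *\<^sub>R fy z) - (f (x + \<i> * of_real 0) - 0 *\<^sub>R fy z)) \<le> (e / 2) * norm (Im h - 0)"
    proof (rule differentiable_bound[where S="closed_segment 0 (Im h)" and f="\<lambda>s. f (x + \<i> * of_real s) - s *\<^sub>R fy z"])
      fix s assume s: "s \<in> closed_segment 0 (Im h)"
      let ?w = "x + \<i> * of_real s"
      have w: "?w \<in> \<Omega>" using in_ball[OF s] d r by (meson subset_ball subsetD)
      have "((\<lambda>t::real. f (?w + \<i> * of_real t)) has_vector_derivative fy ?w) (at 0)" by (rule fy[OF w])
      then have "((\<lambda>t. f (?w + \<i> * of_real (t - s))) has_vector_derivative fy ?w) (at s)"
      proof -
        have "((\<lambda>t. t - s) has_vector_derivative 1) (at s)" by (auto intro!: derivative_eq_intros)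
        from vector_diff_chain_at[OF this, of "\<lambda>t. f (?w + \<i> * of_real t)" "fy ?w"]
        show ?thesis using \<open>((\<lambda>t::real. f (?w + \<i> * of_real t)) has_vector_derivative fy ?w) (at 0)\<close>
          by (simp add: o_def)
      qed
      then have "((\<lambda>t. f (x + \<i> * of_real t)) has_vector_derivative fy ?w) (at s)"
        by (simp add: algebra_simps)
      then have "((\<lambda>t. f (x + \<i> * of_real t) - t *\<^sub>R fy z) has_derivative (\<lambda>t. t *\<^sub>R fy ?w - t *\<^sub>R fy z)) (at s)"
        unfolding has_vector_derivative_def
        by (intro has_derivative_diff has_derivative_scaleR_left has_derivative_ident)
      then show "((\<lambda>t. f (x + \<i> * of_real t) - t *\<^sub>R fy z) has_derivative (\<lambda>t. t *\<^sub>R fy ?w - t *\<^sub>R fy z)) (at s within closed_segment 0 (Im h))"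
        by (rule has_derivative_at_withinI)
      have "dist ?w z < d1" using in_ball[OF s] d by (simp add: dist_commute)
      then have "norm (fy ?w - fy z) \<le> e / 2" using d1(2)[of ?w] by (simp add: dist_norm)
      then show "onorm (\<lambda>t::real. t *\<^sub>R fy ?w - t *\<^sub>R fy z) \<le> e / 2"
      proof (intro onorm_le)
        fix t :: real
        have "norm (t *\<^sub>R fy ?w - t *\<^sub>R fy z) = norm (fy ?w - fy z) * \<bar>t\<bar>"
          by (simp add: scaleR_diff_right[symmetric])
        also have "\<dots> \<le> (e / 2) * \<bar>t\<bar>"
          using \<open>norm (fy ?w - fy z) \<le> e / 2\<close> by (rule mult_right_mono) simp
        finally show "norm (t *\<^sub>R fy ?w - t *\<^sub>R fy z) \<le> (e / 2) * norm t" by simp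
      qed
    qed auto
    then have 1: "norm (f y - f x - Im h *\<^sub>R fy z) \<le> (e / 2) * \<bar>Im h\<bar>"
      unfolding yx by (simp add: algebra_simps)
    have "norm (Re h) < d2" using y d abs_Re_le_cmod[of h] by (simp add: h_def)
    then have 2: "norm (f x - f z - Re h *\<^sub>R fx z) \<le> (e / 2) * \<bar>Re h\<bar>"
      unfolding x_def using d2(2)[of "Re h"] by simp
    have "f y - f z - (fx z * of_real (Re h) + fy z * of_real (Im h)) =
        (f y - f x - Im h *\<^sub>R fy z) + (f x - f z - Re h *\<^sub>R fx z)"
      by (simp add: scaleR_conv_of_real algebra_simps)
    then have "norm (f y - f z - (fx z * of_real (Re h) + fy z * of_real (Im h))) \<le>
        norm (f y - f x - Im h *\<^sub>R fy z) + norm (f x - f z - Re h *\<^sub>R fx z)"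
      by (simp only: norm_triangle_ineq)
    also have "\<dots> \<le> (e / 2) * \<bar>Im h\<bar> + (e / 2) * \<bar>Re h\<bar>" by (rule add_mono[OF 1 2])
    also have "\<dots> \<le> (e / 2) * norm h + (e / 2) * norm h"
      using e abs_Re_le_cmod[of h] abs_Im_le_cmod[of h] by (intro add_mono mult_left_mono) auto
    finally show ?thesis by (simp add: h_def)
  qed
  then show "\<exists>d>0. \<forall>y. norm (y - z) < d \<longrightarrow>
      norm (f y - f z - (fx z * of_real (Re (y - z)) + fy z * of_real (Im (y - z)))) \<le> e * norm (y - z)"
    using d(1) by blast
qed

lemma C_closure_continuous: "C_closure k \<Omega> f \<Longrightarrow> continuous_on (closure \<Omega>) f"
  by (cases k) auto

lemma C_closure_lincomb:
  "C_closure k \<Omega> f \<Longrightarrow> C_closure k \<Omega> g \<Longrightarrow> C_closure k \<Omega> (\<lambda>z. c * f z + d * g z)"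
proof (induction k arbitrary: f g)
  case 0
  then show ?case by (auto intro!: continuous_intros)
next
  case (Suc k)
  obtain fx fy where f: "\<forall>z\<in>\<Omega>. ((\<lambda>t::real. f (z + of_real t)) has_vector_derivative fx z) (at 0)"
    "\<forall>z\<in>\<Omega>. ((\<lambda>t::real. f (z + \<i> * of_real t)) has_vector_derivative fy z) (at 0)"
    "C_closure k \<Omega> fx" "C_closure k \<Omega> fy" using Suc.prems(1) by auto
  obtain gx gy where g: "\<forall>z\<in>\<Omega>. ((\<lambda>t::real. g (z + of_real t)) has_vector_derivative gx z) (at 0)"
    "\<forall>z\<in>\<Omega>. ((\<lambda>t::real. g (z + \<i> * of_real t)) has_vector_derivative gy z) (at 0)"
    "C_closure k \<Omega> gx" "C_closure k \<Omega> gy" using Suc.prems(2) by auto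
  have "continuous_on (closure \<Omega>) (\<lambda>z. c * f z + d * g z)"
    using Suc.prems by (auto intro!: continuous_intros)
  moreover have "\<forall>z\<in>\<Omega>. ((\<lambda>t::real. c * f (z + of_real t) + d * g (z + of_real t)) has_vector_derivative c * fx z + d * gx z) (at 0)"
    using f(1) g(1) by (auto intro!: has_vector_derivative_add has_vector_derivative_mult_right)
  moreover have "\<forall>z\<in>\<Omega>. ((\<lambda>t::real. c * f (z + \<i> * of_real t) + d * g (z + \<i> * of_real t)) has_vector_derivative c * fy z + d * gy z) (at 0)"
    using f(2) g(2) by (auto intro!: has_vector_derivative_add has_vector_derivative_mult_right)
  moreover have "C_closure k \<Omega> (\<lambda>z. c * fx z + d * gx z)" "C_closure k \<Omega> (\<lambda>z. c * fy z + d * gy z)"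
    using Suc.IH f g by auto
  ultimately show ?case
    unfolding C_closure.simps
    by (intro conjI exI[of _ "\<lambda>z. c * fx z + d * gx z"] exI[of _ "\<lambda>z. c * fy z + d * gy z"])
qed

lemma C_closure_mono: "C_closure k \<Omega> f \<Longrightarrow> j \<le> k \<Longrightarrow> C_closure j \<Omega> f"
proof (induction k arbitrary: j f)
  case (Suc k)
  show ?case
  proof (cases j)
    case 0
    then show ?thesis using Suc.prems by simp
  next
    case (Suc i)
    obtain fx fy where f: "\<forall>z\<in>\<Omega>. ((\<lambda>t::real. f (z + of_real t)) has_vector_derivative fx z) (at 0)"
      "\<forall>z\<in>\<Omega>. ((\<lambda>t::real. f (z + \<i> * of_real t)) has_vector_derivative fy z) (at 0)"
      "C_closure k \<Omega> fx" "C_closure k \<Omega> fy" "continuous_on (closure \<Omega>) f"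
      using Suc.prems(1) by auto
    have "C_closure i \<Omega> fx" "C_closure i \<Omega> fy"
      using Suc.IH f(3,4) Suc.prems(2) \<open>j = Suc i\<close> by auto
    then show ?thesis
      unfolding \<open>j = Suc i\<close> C_closure.simps by (intro conjI exI[of _ fx] exI[of _ fy] f)
  qed
qed simp

lemma has_vector_derivative_poly_line:
  fixes c z :: complex
  shows "((\<lambda>t::real. poly p (z + c * of_real t)) has_vector_derivative c * poly (pderiv p) z) (at 0)"
proof -
  have "((\<lambda>t::real. z + t *\<^sub>R c) has_vector_derivative c) (at 0)"
    by (auto intro!: derivative_eq_intros)
  then have "((\<lambda>t::real. z + c * of_real t) has_vector_derivative c) (at 0)"
    by (simp add: scaleR_conv_of_real mult.commute)
  from field_vector_diff_chain_at[OF this poly_DERIV[of p "z + c * of_real 0"]]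
  show ?thesis by (simp add: o_def)
qed

lemma C_closure_poly: "C_closure k \<Omega> (poly p)"
proof (induction k arbitrary: p)
  case 0
  then show ?case by (simp add: continuous_intros)
next
  case (Suc k)
  have "\<forall>z\<in>\<Omega>. ((\<lambda>t::real. poly p (z + of_real t)) has_vector_derivative poly (pderiv p) z) (at 0)"
    using has_vector_derivative_poly_line[of p _ 1] by simp
  moreover have "\<forall>z\<in>\<Omega>. ((\<lambda>t::real. poly p (z + \<i> * of_real t)) has_vector_derivative poly (smult \<i> (pderiv p)) z) (at 0)"
    using has_vector_derivative_poly_line[of p _ \<i>] by simp
  moreover have "continuous_on (closure \<Omega>) (poly p)" by (intro continuous_intros)
  ultimately show ?case
    unfolding C_closure.simps
    by (intro conjI exI[of _ "poly (pderiv p)"] exI[of _ "poly (smult \<i> (pderiv p))"] Suc)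
qed

lemma wirtinger_poly: "wirtinger (poly p) = poly (pderiv p)"
proof
  fix z
  have "partial_xi (poly p) z = poly (pderiv p) z" "partial_eta (poly p) z = \<i> * poly (pderiv p) z"
    unfolding partial_xi_def partial_eta_def
    using has_vector_derivative_poly_line[of p z 1] has_vector_derivative_poly_line[of p z \<i>]
    by (auto intro: vector_derivative_at)
  then show "wirtinger (poly p) z = poly (pderiv p) z"
    by (simp add: wirtinger_def)
qed

lemma higher_wirtinger_poly: "(wirtinger ^^ k) (poly p) = poly ((pderiv ^^ k) p)"
  by (induction k) (simp_all add: wirtinger_poly)

lemma wirtinger_cong:
  assumes "open \<Omega>" "z \<in> \<Omega>" "\<And>z. z \<in> \<Omega> \<Longrightarrow> f z = g z"
  shows "wirtinger f z = wirtinger g z"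
proof -
  have "vector_derivative (\<lambda>t::real. f (z + c * of_real t)) (at 0) = vector_derivative (\<lambda>t::real. g (z + c * of_real t)) (at 0)" for c
  proof (rule vector_derivative_cong_eq)
    have "open ((\<lambda>t::real. z + c * of_real t) -` \<Omega>)"
      using assms(1) by (auto intro!: continuous_open_vimage continuous_intros)
    moreover have "0 \<in> (\<lambda>t::real. z + c * of_real t) -` \<Omega>" using assms(2) by simp
    ultimately have "eventually (\<lambda>t. t \<in> (\<lambda>t::real. z + c * of_real t) -` \<Omega>) (nhds 0)"
      by (rule eventually_nhds_in_open)
    then show "eventually (\<lambda>t. t \<in> UNIV \<longrightarrow> f (z + c * of_real t) = g (z + c * of_real t)) (nhds (0::real))"
      by eventually_elim (use assms(3) in auto)
  qed auto
  from this[of 1] this[of \<i>] show ?thesis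
    by (simp add: wirtinger_def partial_xi_def partial_eta_def)
qed

lemma higher_wirtinger_cong:
  assumes "open \<Omega>" "z \<in> \<Omega>" "\<And>z. z \<in> \<Omega> \<Longrightarrow> f z = g z"
  shows "(wirtinger ^^ k) f z = (wirtinger ^^ k) g z"
  using assms(2,3)
proof (induction k arbitrary: z)
  case (Suc k)
  then show ?case using wirtinger_cong[OF assms(1), of z "(wirtinger ^^ k) f" "(wirtinger ^^ k) g"] by simp
qed simp

text \<open>\<open>a\<close> and \<open>b\<close> are built from the extended partial derivatives,
  so they carry boundary values. On the frontier \<open>wirtinger f\<close> and
  \<open>wirtinger_bar f\<close> depend on how \<open>f\<close> happens to continue beyond \<Omega>,
  so the comparison is made on \<Omega> only.\<close>

lemma C_closure_Suc:
  assumes opn: "open \<Omega>" and f: "C_closure (Suc k) \<Omega> f"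
  obtains a b where "C1_closure \<Omega> f a b" "C_closure k \<Omega> a" "C_closure k \<Omega> b"
    "\<And>z. z \<in> \<Omega> \<Longrightarrow> a z = wirtinger f z" "\<And>z. z \<in> \<Omega> \<Longrightarrow> b z = wirtinger_bar f z"
proof -
  obtain fx fy where fxy: "\<And>z. z \<in> \<Omega> \<Longrightarrow> ((\<lambda>t::real. f (z + of_real t)) has_vector_derivative fx z) (at 0)"
    "\<And>z. z \<in> \<Omega> \<Longrightarrow> ((\<lambda>t::real. f (z + \<i> * of_real t)) has_vector_derivative fy z) (at 0)"
    "C_closure k \<Omega> fx" "C_closure k \<Omega> fy" and cf: "continuous_on (closure \<Omega>) f" using f by auto
  define a where "a z = (1/2) * fx z + (- \<i> / 2) * fy z" for z
  define b where "b z = (1/2) * fx z + (\<i> / 2) * fy z" for z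
  have ab: "C_closure k \<Omega> a" "C_closure k \<Omega> b"
    unfolding a_def b_def by (intro C_closure_lincomb fxy)+
  have cab: "continuous_on (closure \<Omega>) a" "continuous_on (closure \<Omega>) b"
    using ab by (auto intro: C_closure_continuous)
  have cfy: "continuous_on \<Omega> fy"
    by (rule continuous_on_subset[OF C_closure_continuous[OF fxy(4)] closure_subset])
  have "C1_wirtinger \<Omega> f a b"
    unfolding C1_wirtinger_def
  proof (intro conjI ballI)
    show "continuous_on \<Omega> a" "continuous_on \<Omega> b"
      by (rule continuous_on_subset[OF cab(1) closure_subset] continuous_on_subset[OF cab(2) closure_subset])+
    fix z assume z: "z \<in> \<Omega>"
    have "fx z * of_real (Re h) + fy z * of_real (Im h) = a z * h + b z * cnj h" for h
    proof -
      have ab: "fx z = a z + b z" "fy z = \<i> * (a z - b z)" by (simp_all add: a_def b_def complex_eq_iff)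
      have h: "h = of_real (Re h) + \<i> * of_real (Im h)" "cnj h = of_real (Re h) - \<i> * of_real (Im h)"
        by (simp_all add: complex_eq_iff)
      have "(a z + b z) * x + \<i> * (a z - b z) * y = a z * (x + \<i> * y) + b z * (x - \<i> * y)" for x y
        by (simp add: algebra_simps)
      from this[of "of_real (Re h)" "of_real (Im h)"] show ?thesis
        unfolding ab h(1)[symmetric] h(2)[symmetric] .
    qed
    then show "(f has_derivative (\<lambda>h. a z * h + b z * cnj h)) (at z)"
      using C1_from_partials[OF opn z fxy(1,2) cfy] by simp
  qed
  then have "C1_closure \<Omega> f a b" using cf cab by (simp add: C1_closure_def)
  moreover have "a z = wirtinger f z" "b z = wirtinger_bar f z" if "z \<in> \<Omega>" for z
    using vector_derivative_at[OF fxy(1)[OF that]] vector_derivative_at[OF fxy(2)[OF that]]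
    by (simp_all add: a_def b_def wirtinger_def wirtinger_bar_def partial_xi_def partial_eta_def
        diff_divide_distrib add_divide_distrib)
  ultimately show ?thesis using ab that by blast
qed

section \<open>Fourier coefficients on small circles\<close>

definition fourier_coeff :: "(complex \<Rightarrow> complex) \<Rightarrow> complex \<Rightarrow> real \<Rightarrow> nat \<Rightarrow> complex" where
  "fourier_coeff f l r k =
     integral {0..1} (\<lambda>x. f (circlepath l r x) * exp (- (of_nat k * (2 * of_real pi * \<i> * of_real x))))"

lemma continuous_on_fourier:
  assumes "continuous_on (path_image (circlepath l r)) f"
  shows "continuous_on {0..1} (\<lambda>x. f (circlepath l r x) * exp (- (of_nat k * (2 * of_real pi * \<i> * of_real x))))"
proof -
  have "continuous_on {0..1} (circlepath l r)" using path_circlepath unfolding path_def .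
  then have "continuous_on {0..1} (\<lambda>x. f (circlepath l r x))"
    by (rule continuous_on_compose2[OF assms]) (auto simp: path_image_def)
  then show ?thesis by (intro continuous_intros)
qed

text \<open>Differentiate \<open>f\<close> along the circle times the exponential of index k + 1.
  The chain rule multiplies the \<open>a\<close> term by the unit exponential and the
  \<open>b\<close> term by its conjugate, which is its inverse, so their indices become k and k + 2.
  Over a full period the derivative integrates to 0.\<close>

lemma fourier_coeff_recursion:
  assumes f: "C1_wirtinger U f a b" and U: "sphere l r \<subseteq> U" and r: "r > 0"
  shows "of_nat (Suc k) * fourier_coeff f l r (Suc k) =
     of_real r * (fourier_coeff a l r k - fourier_coeff b l r (Suc (Suc k)))"
proof -
  define E where "E x = exp (2 * of_real pi * \<i> * of_real x)" for x :: real
  define e where "e k x = exp (- (of_nat k * (2 * of_real pi * \<i> * of_real x)))" for k :: nat and x :: real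
  define c where "c = circlepath l r"
  have cE: "c x = l + of_real r * E x" for x by (simp add: c_def circlepath E_def)
  have cU: "c x \<in> U" if "x \<in> {0..1}" for x
  proof -
    have "norm (E x) = 1" by (simp add: E_def)
    then show ?thesis using U r by (auto simp: cE dist_norm norm_mult)
  qed
  have e1: "E x * e (Suc k) x = e k x" for k x
    by (simp add: E_def e_def exp_add[symmetric] algebra_simps)
  have e2: "cnj (E x) * e k x = e (Suc k) x" for k x
    by (simp add: E_def e_def exp_cnj exp_add[symmetric] algebra_simps)
  define F' where "F' x = 2 * of_real pi * \<i> * (of_real r * (a (c x) * e k x) -
      of_real r * (b (c x) * e (Suc (Suc k)) x) - of_nat (Suc k) * (f (c x) * e (Suc k) x))" for x
  have "((\<lambda>x. f (c x) * e (Suc k) x) has_vector_derivative F' x) (at x within {0..1})" if x: "x \<in> {0..1}" for x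
  proof -
    have "(c has_derivative (\<lambda>h. h *\<^sub>R (2 * pi * \<i> * r * E x))) (at x within {0..1})"
      using has_vector_derivative_circlepath[of l r x "{0..1}"] unfolding c_def E_def has_vector_derivative_def .
    moreover have "(f has_derivative (\<lambda>h. a (c x) * h + b (c x) * cnj h)) (at (c x))"
      using f cU[OF x] by (simp add: C1_wirtinger_def)
    ultimately have "((\<lambda>x. f (c x)) has_derivative
       (\<lambda>h. a (c x) * (h *\<^sub>R (2 * pi * \<i> * r * E x)) + b (c x) * cnj (h *\<^sub>R (2 * pi * \<i> * r * E x)))) (at x within {0..1})"
      by (rule has_derivative_compose)
    then have D: "((\<lambda>x. f (c x)) has_vector_derivative
        (a (c x) * (2 * pi * \<i> * r * E x) + b (c x) * cnj (2 * pi * \<i> * r * E x))) (at x within {0..1})"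
      unfolding has_vector_derivative_def by (simp add: scaleR_conv_of_real algebra_simps)
    have "((\<lambda>z. exp (- (of_nat (Suc k) * (2 * of_real pi * \<i> * z)))) has_field_derivative
        - (of_nat (Suc k) * (2 * of_real pi * \<i>)) * exp (- (of_nat (Suc k) * (2 * of_real pi * \<i> * of_real x)))) (at (of_real x))"
      by (auto intro!: derivative_eq_intros)
    then have "((\<lambda>x. e (Suc k) x) has_vector_derivative - (of_nat (Suc k) * (2 * of_real pi * \<i>)) * e (Suc k) x) (at x within {0..1})"
      unfolding e_def by (rule has_vector_derivative_real_field)
    from has_vector_derivative_mult[OF D this]
    have "((\<lambda>x. f (c x) * e (Suc k) x) has_vector_derivative
       (f (c x) * (- (of_nat (Suc k) * (2 * of_real pi * \<i>)) * e (Suc k) x) +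
        (a (c x) * (2 * pi * \<i> * r * E x) + b (c x) * cnj (2 * pi * \<i> * r * E x)) * e (Suc k) x)) (at x within {0..1})" .
    moreover have "f (c x) * (- (of_nat (Suc k) * (2 * of_real pi * \<i>)) * e (Suc k) x) +
        (a (c x) * (2 * pi * \<i> * r * E x) + b (c x) * cnj (2 * pi * \<i> * r * E x)) * e (Suc k) x = F' x"
    proof -
      have "F' x = 2 * of_real pi * \<i> * (of_real r * (a (c x) * (E x * e (Suc k) x)) -
        of_real r * (b (c x) * (cnj (E x) * e (Suc k) x)) - of_nat (Suc k) * (f (c x) * e (Suc k) x))"
        unfolding F'_def e1 e2 ..
      then show ?thesis by (simp add: algebra_simps)
    qed
    ultimately show ?thesis by simp
  qed
  then have "(F' has_integral (f (c 1) * e (Suc k) 1 - f (c 0) * e (Suc k) 0)) {0..1}"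
    by (intro fundamental_theorem_of_calculus) auto
  moreover have "f (c 1) * e (Suc k) 1 = f (c 0) * e (Suc k) 0"
  proof -
    have "c 1 = c 0" by (simp add: c_def circlepath)
    moreover have "e (Suc k) 1 = 1"
    proof -
      have "e (Suc k) 1 = exp (2 * of_int (- int (Suc k)) * of_real pi * \<i>)" by (simp add: e_def algebra_simps)
      also have "\<dots> = 1" unfolding exp_eq_1 by (intro conjI exI[of _ "- int (Suc k)"]) simp_all
      finally show ?thesis .
    qed
    ultimately show ?thesis by (simp add: e_def)
  qed
  ultimately have 0: "integral {0..1} F' = 0" by (simp add: integral_unique)
  have img: "path_image (circlepath l r) \<subseteq> U" using U r by simp
  have cont: "continuous_on (path_image (circlepath l r)) f" "continuous_on (path_image (circlepath l r)) a"
    "continuous_on (path_image (circlepath l r)) b"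
    using f C1_wirtinger_continuous_on[OF f] continuous_on_subset[OF _ img] unfolding C1_wirtinger_def by auto
  have int: "((\<lambda>x. g (c x) * e k x) has_integral fourier_coeff g l r k) {0..1}"
    if "continuous_on (path_image (circlepath l r)) g" for g k
    using integrable_integral[OF integrable_continuous_interval[OF continuous_on_fourier[OF that]]]
    unfolding c_def e_def fourier_coeff_def .
  have "(F' has_integral 2 * of_real pi * \<i> * (of_real r * fourier_coeff a l r k -
      of_real r * fourier_coeff b l r (Suc (Suc k)) - of_nat (Suc k) * fourier_coeff f l r (Suc k))) {0..1}"
    unfolding F'_def by (intro has_integral_mult_right has_integral_diff int cont)
  then have "integral {0..1} F' = 2 * of_real pi * \<i> * (of_real r * fourier_coeff a l r k -
      of_real r * fourier_coeff b l r (Suc (Suc k)) - of_nat (Suc k) * fourier_coeff f l r (Suc k))"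
    by (rule integral_unique)
  with 0 have "of_real r * fourier_coeff a l r k - of_real r * fourier_coeff b l r (Suc (Suc k))
      - of_nat (Suc k) * fourier_coeff f l r (Suc k) = 0"
    by (simp del: of_nat_Suc right_minus_eq eq_iff_diff_eq_0)
  then show ?thesis by (simp only: right_diff_distrib right_minus_eq)
qed

lemma fourier_coeff_const:
  assumes "r > 0"
  shows "fourier_coeff (\<lambda>_. c) l r k = (if k = 0 then c else 0)"
proof (cases k)
  case 0
  then show ?thesis by (simp add: fourier_coeff_def)
next
  case (Suc j)
  have "fourier_coeff (\<lambda>_. 0) l r i = 0" for i by (simp add: fourier_coeff_def)
  \<comment> \<open>The recursion with both derivatives 0 replaces the integration of an
    exponential.\<close>
  then have "of_nat (Suc j) * fourier_coeff (\<lambda>_. c) l r (Suc j) = 0"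
    using fourier_coeff_recursion[OF C1_wirtinger_const[of UNIV c] _ assms, of l j] by simp
  then show ?thesis using Suc by (simp del: of_nat_Suc)
qed

lemma fourier_coeff_tendsto_0:
  assumes opn: "open \<Omega>" and l: "l \<in> \<Omega>" and f: "continuous_on \<Omega> f"
  shows "((\<lambda>r. fourier_coeff f l r k) \<longlongrightarrow> (if k = 0 then f l else 0)) (at_right 0)"
proof (rule tendstoI)
  fix e :: real assume e: "e > 0"
  obtain d0 where d0: "d0 > 0" "ball l d0 \<subseteq> \<Omega>" using opn l open_contains_ball by blast
  have "continuous (at l) f" using f opn l continuous_on_eq_continuous_at by blast
  then obtain d1 where d1: "d1 > 0" "\<And>w. dist w l < d1 \<Longrightarrow> dist (f w) (f l) < e / 2"
    using e unfolding continuous_at_eps_delta by (metis half_gt_zero)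
  have "eventually (\<lambda>r. r \<in> {0<..<min d0 d1}) (at_right 0)"
    by (rule eventually_at_right_real) (use d0 d1 in auto)
  then show "eventually (\<lambda>r. dist (fourier_coeff f l r k) (if k = 0 then f l else 0) < e) (at_right 0)"
  proof eventually_elim
    case (elim r)
    then have r: "r > 0" "r < d0" "r < d1" by auto
    have sub: "path_image (circlepath l r) \<subseteq> \<Omega>" using r d0 by auto
    have c1: "continuous_on (path_image (circlepath l r)) f" by (rule continuous_on_subset[OF f sub])
    have c2: "continuous_on (path_image (circlepath l r)) (\<lambda>_. f l)" by simp
    have "fourier_coeff f l r k - fourier_coeff (\<lambda>_. f l) l r k = fourier_coeff (\<lambda>z. f z - f l) l r k"
      unfolding fourier_coeff_def left_diff_distrib
      by (rule integral_diff[symmetric, OF integrable_continuous_interval[OF continuous_on_fourier[OF c1]]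
            integrable_continuous_interval[OF continuous_on_fourier[OF c2]]])
    moreover have "norm (fourier_coeff (\<lambda>z. f z - f l) l r k) \<le> e / 2 * (1 - 0)"
      unfolding fourier_coeff_def
    proof (rule integral_bound)
      show "continuous_on {0..1} (\<lambda>x. (f (circlepath l r x) - f l) * exp (- (of_nat k * (2 * complex_of_real pi * \<i> * complex_of_real x))))"
        by (rule continuous_on_fourier) (intro continuous_intros c1)
      fix x :: real
      have "dist (circlepath l r x) l < d1" using r by (simp add: circlepath dist_norm norm_mult)
      then have "norm (f (circlepath l r x) - f l) \<le> e / 2" using d1(2) by (simp add: dist_norm less_imp_le)
      then show "norm ((f (circlepath l r x) - f l) * exp (- (of_nat k * (2 * complex_of_real pi * \<i> * complex_of_real x)))) \<le> e / 2"
        by (simp add: norm_mult norm_exp_eq_Re)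
    qed simp
    moreover have "fourier_coeff (\<lambda>_. f l) l r k = (if k = 0 then f l else 0)" by (rule fourier_coeff_const[OF r(1)])
    ultimately have "norm (fourier_coeff f l r k - (if k = 0 then f l else 0)) \<le> e / 2" by (simp only:) simp
    then show ?case using e unfolding dist_norm by linarith
  qed
qed

text \<open>Integration by parts on the circle lowers both the order of differentiability and the frequency,
  so no Taylor expansion and no symmetry of mixed derivatives is needed.\<close>

lemma fourier_coeff_limits:
  assumes opn: "open \<Omega>" and l: "l \<in> \<Omega>"
  shows "C_closure j \<Omega> f \<Longrightarrow>
     (\<forall>k>j. ((\<lambda>r. fourier_coeff f l r k / of_real r ^ j) \<longlongrightarrow> 0) (at_right 0)) \<and>
     ((\<lambda>r. fourier_coeff f l r j / of_real r ^ j) \<longlongrightarrow> (wirtinger ^^ j) f l / fact j) (at_right 0)"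
proof (induction j arbitrary: f)
  case 0
  then have c: "continuous_on \<Omega> f" using continuous_on_subset[OF _ closure_subset[of \<Omega>]] by simp
  have "((\<lambda>r. fourier_coeff f l r k) \<longlongrightarrow> 0) (at_right 0)" if "k > 0" for k
    using fourier_coeff_tendsto_0[OF opn l c, of k] that by simp
  moreover have "((\<lambda>r. fourier_coeff f l r 0) \<longlongrightarrow> f l) (at_right 0)"
    using fourier_coeff_tendsto_0[OF opn l c, of 0] by simp
  ultimately show ?case by simp
next
  case (Suc j)
  obtain a b where ab: "C1_closure \<Omega> f a b" "C_closure j \<Omega> a" "C_closure j \<Omega> b"
    "\<And>z. z \<in> \<Omega> \<Longrightarrow> a z = wirtinger f z"
  proof (rule C_closure_Suc[OF opn Suc.prems])
    fix a b
    assume "C1_closure \<Omega> f a b" "C_closure j \<Omega> a" "C_closure j \<Omega> b" "\<And>z. z \<in> \<Omega> \<Longrightarrow> a z = wirtinger f z"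
    then show thesis by (rule that)
  qed
  obtain d0 where d0: "d0 > 0" "ball l d0 \<subseteq> \<Omega>" using opn l open_contains_ball by blast
  \<comment> \<open>The recursion divided by r^(j+1), valid once the circle lies in
    \<Omega>.\<close>
  have ev: "eventually (\<lambda>r. (1 / of_nat (Suc k)) * (fourier_coeff a l r k / of_real r ^ j - fourier_coeff b l r (Suc (Suc k)) / of_real r ^ j)
      = fourier_coeff f l r (Suc k) / of_real r ^ Suc j) (at_right 0)" for k
  proof -
    have "eventually (\<lambda>r. r \<in> {0<..<d0}) (at_right 0)"
      by (rule eventually_at_right_real) (use d0 in auto)
    then show ?thesis
    proof eventually_elim
      case (elim r)
      have "sphere l r \<subseteq> \<Omega>" using elim d0 by auto
      then have "of_nat (Suc k) * fourier_coeff f l r (Suc k) =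
          of_real r * (fourier_coeff a l r k - fourier_coeff b l r (Suc (Suc k)))"
        using fourier_coeff_recursion[of \<Omega> f a b l r k] ab(1) elim by (simp add: C1_closure_def)
      then have "fourier_coeff f l r (Suc k) = of_real r * (fourier_coeff a l r k - fourier_coeff b l r (Suc (Suc k))) / of_nat (Suc k)"
        by (simp add: eq_divide_eq mult.commute del: of_nat_Suc)
      then show ?case using elim by (simp add: diff_divide_distrib mult.commute del: of_nat_Suc)
    qed
  qed
  \<comment> \<open>For k >= j the index k + 2 exceeds j, so by induction the \<open>b\<close> term
    disappears in the limit; the factor 1/(k+1) builds up the factorial.\<close>
  have lim: "((\<lambda>r. fourier_coeff f l r (Suc k) / of_real r ^ Suc j) \<longlongrightarrow> (1 / of_nat (Suc k)) * (L - 0)) (at_right 0)"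
    if "((\<lambda>r. fourier_coeff a l r k / of_real r ^ j) \<longlongrightarrow> L) (at_right 0)" "k \<ge> j" for k L
  proof (rule Lim_transform_eventually[OF _ ev])
    have "((\<lambda>r. fourier_coeff b l r (Suc (Suc k)) / of_real r ^ j) \<longlongrightarrow> 0) (at_right 0)"
      using Suc.IH[OF ab(3)] that(2) by auto
    then show "((\<lambda>r. (1 / of_nat (Suc k)) * (fourier_coeff a l r k / of_real r ^ j - fourier_coeff b l r (Suc (Suc k)) / of_real r ^ j))
        \<longlongrightarrow> (1 / of_nat (Suc k)) * (L - 0)) (at_right 0)"
      by (intro tendsto_intros that(1))
  qed
  show ?case
  proof (intro conjI allI impI)
    fix k assume "Suc j < k"
    then obtain k' where k': "k = Suc k'" "j < k'" by (cases k) auto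
    then show "((\<lambda>r. fourier_coeff f l r k / of_real r ^ Suc j) \<longlongrightarrow> 0) (at_right 0)"
      using lim[of k' 0] Suc.IH[OF ab(2)] by simp
  next
    have "(wirtinger ^^ j) a l = (wirtinger ^^ j) (wirtinger f) l"
      by (rule higher_wirtinger_cong[OF opn l ab(4)])
    then have "(1 / of_nat (Suc j)) * ((wirtinger ^^ j) a l / fact j - 0) = (wirtinger ^^ Suc j) f l / fact (Suc j)"
      by (simp add: funpow_Suc_right mult.commute del: funpow.simps)
    then show "((\<lambda>r. fourier_coeff f l r (Suc j) / of_real r ^ Suc j) \<longlongrightarrow> (wirtinger ^^ Suc j) f l / fact (Suc j)) (at_right 0)"
      using lim[of j "(wirtinger ^^ j) a l / fact j"] Suc.IH[OF ab(2)] by (simp only: order_refl)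
  qed
qed

text \<open>Cauchy's formula for derivatives survives without holomorphy in the limit of small
  circles: on the circle dz / (z - l)^(j+1) is 2 pi i r^(-j) times the exponential of index j times
  dx.\<close>

lemma contour_integral_circle_limit:
  assumes "open \<Omega>" "l \<in> \<Omega>" "C_closure j \<Omega> f"
  shows "((\<lambda>r. contour_integral (circlepath l r) (\<lambda>z. f z / (z - l) ^ Suc j)) \<longlongrightarrow>
     2 * of_real pi * \<i> * ((wirtinger ^^ j) f l / fact j)) (at_right 0)"
proof (rule Lim_transform_eventually)
  show "((\<lambda>r. 2 * of_real pi * \<i> * (fourier_coeff f l r j / of_real r ^ j)) \<longlongrightarrow>
     2 * of_real pi * \<i> * ((wirtinger ^^ j) f l / fact j)) (at_right 0)"
    by (rule tendsto_mult[OF tendsto_const conjunct2[OF fourier_coeff_limits[OF assms]]])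
  have "eventually (\<lambda>r::real. r > 0) (at_right 0)" by (rule eventually_at_right_less)
  then show "eventually (\<lambda>r. 2 * of_real pi * \<i> * (fourier_coeff f l r j / of_real r ^ j) =
     contour_integral (circlepath l r) (\<lambda>z. f z / (z - l) ^ Suc j)) (at_right 0)"
  proof eventually_elim
    case (elim r)
    have "contour_integral (circlepath l r) (\<lambda>z. f z / (z - l) ^ Suc j) =
      integral {0..1} (\<lambda>x. (2 * of_real pi * \<i> / of_real r ^ j) * (f (circlepath l r x) * exp (- (of_nat j * (2 * of_real pi * \<i> * of_real x)))))"
      unfolding contour_integral_integral
    proof (rule integral_cong)
      fix x :: real
      define E where "E = exp (2 * of_real pi * \<i> * of_real x)"
      have E: "E \<noteq> 0" by (simp add: E_def)
      have Ej: "exp (- (of_nat j * (2 * of_real pi * \<i> * of_real x))) = inverse (E ^ j)"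
        by (simp only: E_def exp_minus exp_of_nat_mult)
      have circ: "circlepath l r x - l = of_real r * E" by (simp add: circlepath E_def)
      define R where "R = complex_of_real r"
      have R: "R \<noteq> 0" using elim by (simp add: R_def)
      have "w / (R * E) ^ Suc j * (2 * of_real pi * \<i> * R * E) = 2 * of_real pi * \<i> / R ^ j * (w * inverse (E ^ j))" for w
        using E R by (simp add: power_mult_distrib field_simps)
      then show "f (circlepath l r x) / (circlepath l r x - l) ^ Suc j * vector_derivative (circlepath l r) (at x) =
        2 * of_real pi * \<i> / of_real r ^ j * (f (circlepath l r x) * exp (- (of_nat j * (2 * of_real pi * \<i> * of_real x))))"
        unfolding vector_derivative_circlepath E_def[symmetric] Ej circ R_def by simp
    qed
    also have "\<dots> = (2 * of_real pi * \<i> / of_real r ^ j) * fourier_coeff f l r j"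
      unfolding fourier_coeff_def by (rule integral_mult_right)
    finally show ?case by simp
  qed
qed

section \<open>The integral representation\<close>

lemma poly_taylor_quotient:
  fixes q m0 :: "complex poly"
  assumes "poly m0 l \<noteq> 0"
  shows "\<exists>c t. \<forall>z. poly q z = (\<Sum>i<k. c i * (z - l) ^ i) * poly m0 z + (z - l) ^ k * poly t z"
proof (induction k)
  case 0
  show ?case by (intro exI[of _ "\<lambda>_. 0"] exI[of _ q]) simp
next
  case (Suc k)
  then obtain c t where ct: "\<forall>z. poly q z = (\<Sum>i<k. c i * (z - l) ^ i) * poly m0 z + (z - l) ^ k * poly t z"
    by blast
  \<comment> \<open>Chosen so that \<open>t - smult d m0\<close> vanishes at \<open>l\<close> and
    one more factor z - l splits off.\<close>
  define d where "d = poly t l / poly m0 l"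
  have "poly (t - smult d m0) l = 0" using assms by (simp add: d_def)
  then have "[:- l, 1:] dvd t - smult d m0" by (simp only: poly_eq_0_iff_dvd)
  then obtain t' where t': "t - smult d m0 = [:- l, 1:] * t'" by (elim dvdE)
  have t: "poly t z = d * poly m0 z + (z - l) * poly t' z" for z
    using arg_cong[OF t', of "\<lambda>p. poly p z"] by (simp add: algebra_simps)
  have "poly q z = (\<Sum>i<Suc k. (c(k := d)) i * (z - l) ^ i) * poly m0 z + (z - l) ^ Suc k * poly t' z" for z
  proof -
    have "(\<Sum>i<k. (c(k := d)) i * (z - l) ^ i) = (\<Sum>i<k. c i * (z - l) ^ i)"
      by (rule sum.cong) auto
    moreover have "poly q z = (\<Sum>i<k. c i * (z - l) ^ i) * poly m0 z +
        (z - l) ^ k * (d * poly m0 z + (z - l) * poly t' z)"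
      using ct t[of z] by simp
    ultimately show ?thesis
      by (simp only: sum.lessThan_Suc fun_upd_same distrib_right distrib_left power_Suc) (simp add: mult_ac add_ac)
  qed
  then show ?case by blast
qed

text \<open>Near \<open>l\<close> the quotient q/m is a sum of terms c_i (z - l)^(i-n) and a
  continuous function. By \<open>contour_integral_circle_limit\<close> the term with index i tests
  the derivative of order n - 1 - i of \<phi> - p, which is 0.\<close>

lemma circle_limit_rational:
  assumes opn: "open \<Omega>" and l: "l \<in> \<Omega>" and \<phi>: "C_closure k \<Omega> \<phi>"
    and m: "m \<noteq> 0" "order l m \<le> Suc k"
    and jets: "\<And>\<nu>. \<nu> < order l m \<Longrightarrow> poly ((pderiv ^^ \<nu>) p) l = (wirtinger ^^ \<nu>) \<phi> l"
  shows "((\<lambda>r. contour_integral (circlepath l r) (\<lambda>z. (\<phi> z - poly p z) * (poly q z / poly m z)))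
     \<longlongrightarrow> 0) (at_right 0)"
proof -
  let ?I = "\<lambda>r. contour_integral (circlepath l r)"
  define n where "n = order l m"
  obtain m0 where m0: "m = [:- l, 1:] ^ n * m0" "\<not> [:- l, 1:] dvd m0"
    using order_decomp[OF m(1), of l] unfolding n_def by blast
  have m0l: "poly m0 l \<noteq> 0" using m0(2) by (simp add: poly_eq_0_iff_dvd)
  obtain c t where ct: "\<And>z. poly q z = (\<Sum>i<n. c i * (z - l) ^ i) * poly m0 z + (z - l) ^ n * poly t z"
    using poly_taylor_quotient[OF m0l, of q n] by blast
  have c\<phi>: "continuous_on \<Omega> \<phi>"
    by (rule continuous_on_subset[OF C_closure_continuous[OF \<phi>] closure_subset])
  have "open (\<Omega> \<inter> {z. poly m0 z \<noteq> 0})"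
    by (intro open_Int opn open_Collect_neq continuous_intros)
  then obtain e where e: "e > 0" "cball l e \<subseteq> \<Omega> \<inter> {z. poly m0 z \<noteq> 0}"
    using l m0l open_contains_cball by blast
  define h where "h z = (\<phi> z - poly p z) * poly t z / poly m0 z" for z
  have ch: "continuous_on (cball l e) h"
    unfolding h_def using e(2)
    by (intro continuous_intros continuous_on_subset[OF c\<phi>]) auto
  \<comment> \<open>The regular part is written as h(z) (z - l) / (z - l), so that the same limit
    lemma with j = 0 applies, to a function with value 0 at \<open>l\<close>.\<close>
  have "C_closure 0 (ball l e) (\<lambda>z. h z * (z - l))"
    using ch e(1) by (auto intro!: continuous_intros)
  from contour_integral_circle_limit[OF open_ball _ this, of l] e(1)
  have lim_h: "((\<lambda>r. ?I r (\<lambda>z. h z * (z - l) / (z - l) ^ Suc 0)) \<longlongrightarrow> 0) (at_right 0)"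
    by simp
  have lim_i: "((\<lambda>r. ?I r (\<lambda>z. \<phi> z / (z - l) ^ Suc j) -
      ?I r (\<lambda>z. poly p z / (z - l) ^ Suc j)) \<longlongrightarrow> 0) (at_right 0)" if "j < n" for j
  proof -
    have j: "j \<le> k" using that m(2) by (simp add: n_def)
    have "2 * of_real pi * \<i> * ((wirtinger ^^ j) \<phi> l / fact j) - 2 * of_real pi * \<i> * ((wirtinger ^^ j) (poly p) l / fact j) = 0"
      using jets[of j] that by (simp add: higher_wirtinger_poly n_def)
    then show ?thesis
      using tendsto_diff[OF contour_integral_circle_limit[OF opn l C_closure_mono[OF \<phi> j]]
          contour_integral_circle_limit[OF opn l C_closure_poly[of j \<Omega> p]]] by simp
  qed
  \<comment> \<open>For i < n the exponent \<open>Suc (n - Suc i)\<close> is n - i, written in the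
    shape that the limit lemma expects.\<close>
  have "((\<lambda>r. (\<Sum>i<n. c i * (?I r (\<lambda>z. \<phi> z / (z - l) ^ Suc (n - Suc i)) -
      ?I r (\<lambda>z. poly p z / (z - l) ^ Suc (n - Suc i)))) +
      ?I r (\<lambda>z. h z * (z - l) / (z - l) ^ Suc 0)) \<longlongrightarrow> (\<Sum>i<n. c i * 0) + 0) (at_right 0)"
    by (intro tendsto_add tendsto_sum tendsto_mult tendsto_const lim_i lim_h) auto
  then have "((\<lambda>r. (\<Sum>i<n. c i * (?I r (\<lambda>z. \<phi> z / (z - l) ^ Suc (n - Suc i)) -
      ?I r (\<lambda>z. poly p z / (z - l) ^ Suc (n - Suc i)))) +
      ?I r (\<lambda>z. h z * (z - l) / (z - l) ^ Suc 0)) \<longlongrightarrow> 0) (at_right 0)"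
    by simp
  then show ?thesis
  proof (rule Lim_transform_eventually)
    have "eventually (\<lambda>r. r \<in> {0<..<e}) (at_right 0)"
      by (rule eventually_at_right_real) (rule e(1))
    then show "eventually (\<lambda>r. (\<Sum>i<n. c i * (?I r (\<lambda>z. \<phi> z / (z - l) ^ Suc (n - Suc i)) -
      ?I r (\<lambda>z. poly p z / (z - l) ^ Suc (n - Suc i)))) +
      ?I r (\<lambda>z. h z * (z - l) / (z - l) ^ Suc 0) =
      ?I r (\<lambda>z. (\<phi> z - poly p z) * (poly q z / poly m z))) (at_right 0)"
    proof eventually_elim
      case (elim r)
      have S: "path_image (circlepath l r) \<subseteq> cball l e" "l \<notin> path_image (circlepath l r)"
        using elim by auto
      have cf: "continuous_on (path_image (circlepath l r)) \<phi>"
        using S(1) e(2) by (intro continuous_on_subset[OF c\<phi>]) blast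
      have ne: "z - l \<noteq> 0" if "z \<in> path_image (circlepath l r)" for z using that S(2) by auto
      have int\<phi>: "(\<lambda>z. \<phi> z / (z - l) ^ j) contour_integrable_on (circlepath l r)" for j
        using ne by (intro contour_integrable_continuous_circlepath continuous_intros cf) auto
      have intp: "(\<lambda>z. poly p z / (z - l) ^ j) contour_integrable_on (circlepath l r)" for j
        using ne by (intro contour_integrable_continuous_circlepath continuous_intros) auto
      have inth: "(\<lambda>z. h z * (z - l) / (z - l) ^ Suc 0) contour_integrable_on (circlepath l r)"
        using ne by (intro contour_integrable_continuous_circlepath continuous_intros continuous_on_subset[OF ch S(1)]) auto
      note intd = contour_integrable_diff[OF int\<phi> intp]
      have "?I r (\<lambda>z. (\<phi> z - poly p z) * (poly q z / poly m z)) =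
         ?I r (\<lambda>z. (\<Sum>i<n. c i * (\<phi> z / (z - l) ^ Suc (n - Suc i) - poly p z / (z - l) ^ Suc (n - Suc i))) +
            h z * (z - l) / (z - l) ^ Suc 0)"
      proof (rule contour_integral_eq)
        fix z assume z: "z \<in> path_image (circlepath l r)"
        have nz: "z - l \<noteq> 0" "poly m0 z \<noteq> 0" using ne[OF z] z S(1) e(2) by auto
        have pm: "poly m z = (z - l) ^ n * poly m0 z" unfolding m0(1) by (simp add: poly_power)
        have "poly q z / poly m z = (\<Sum>i<n. c i * (z - l) ^ i) / (z - l) ^ n + poly t z / poly m0 z"
          unfolding ct pm using nz by (simp add: add_divide_distrib)
        also have "(\<Sum>i<n. c i * (z - l) ^ i) / (z - l) ^ n = (\<Sum>i<n. c i / (z - l) ^ Suc (n - Suc i))"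
          unfolding sum_divide_distrib
        proof (rule sum.cong)
          fix i assume i: "i \<in> {..<n}"
          have "(z - l) ^ n = (z - l) ^ i * (z - l) ^ Suc (n - Suc i)"
            unfolding power_add[symmetric] using i by (intro arg_cong[where f="\<lambda>n. (z - l) ^ n"]) auto
          then show "c i * (z - l) ^ i / (z - l) ^ n = c i / (z - l) ^ Suc (n - Suc i)"
            using nz(1) by simp
        qed simp
        finally have "(\<phi> z - poly p z) * (poly q z / poly m z) =
           (\<phi> z - poly p z) * (\<Sum>i<n. c i / (z - l) ^ Suc (n - Suc i)) + h z"
          by (simp add: h_def distrib_left)
        also have "h z = h z * (z - l) / (z - l) ^ Suc 0" using nz by simp
        also have "(\<phi> z - poly p z) * (\<Sum>i<n. c i / (z - l) ^ Suc (n - Suc i)) =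
           (\<Sum>i<n. c i * (\<phi> z / (z - l) ^ Suc (n - Suc i) - poly p z / (z - l) ^ Suc (n - Suc i)))"
          unfolding sum_distrib_left
          by (intro sum.cong refl) (simp only: diff_divide_distrib[symmetric] times_divide_eq_right mult.commute)
        finally show "(\<phi> z - poly p z) * (poly q z / poly m z) =
          (\<Sum>i<n. c i * (\<phi> z / (z - l) ^ Suc (n - Suc i) - poly p z / (z - l) ^ Suc (n - Suc i))) + h z * (z - l) / (z - l) ^ Suc 0" .
      qed
      also have "\<dots> = (\<Sum>i<n. c i * (?I r (\<lambda>z. \<phi> z / (z - l) ^ Suc (n - Suc i)) -
        ?I r (\<lambda>z. poly p z / (z - l) ^ Suc (n - Suc i)))) +
        ?I r (\<lambda>z. h z * (z - l) / (z - l) ^ Suc 0)"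
      proof (subst contour_integral_add)
        show "(\<lambda>z. \<Sum>i<n. c i * (\<phi> z / (z - l) ^ Suc (n - Suc i) - poly p z / (z - l) ^ Suc (n - Suc i))) contour_integrable_on circlepath l r"
          by (intro contour_integrable_sum contour_integrable_lmul intd) auto
        show "(\<lambda>z. h z * (z - l) / (z - l) ^ Suc 0) contour_integrable_on circlepath l r" by (rule inth)
        have "?I r (\<lambda>z. \<Sum>i<n. c i * (\<phi> z / (z - l) ^ Suc (n - Suc i) - poly p z / (z - l) ^ Suc (n - Suc i))) =
          (\<Sum>i<n. ?I r (\<lambda>z. c i * (\<phi> z / (z - l) ^ Suc (n - Suc i) - poly p z / (z - l) ^ Suc (n - Suc i))))"
          by (intro contour_integral_sum contour_integrable_lmul intd) auto
        also have "\<dots> = (\<Sum>i<n. c i * (?I r (\<lambda>z. \<phi> z / (z - l) ^ Suc (n - Suc i)) -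
        ?I r (\<lambda>z. poly p z / (z - l) ^ Suc (n - Suc i))))"
          by (simp only: contour_integral_lmul[OF intd] contour_integral_diff[OF int\<phi> intp])
        finally show "?I r (\<lambda>z. \<Sum>i<n. c i * (\<phi> z / (z - l) ^ Suc (n - Suc i) - poly p z / (z - l) ^ Suc (n - Suc i))) +
          ?I r (\<lambda>z. h z * (z - l) / (z - l) ^ Suc 0) =
          (\<Sum>i<n. c i * (?I r (\<lambda>z. \<phi> z / (z - l) ^ Suc (n - Suc i)) -
        ?I r (\<lambda>z. poly p z / (z - l) ^ Suc (n - Suc i)))) +
        ?I r (\<lambda>z. h z * (z - l) / (z - l) ^ Suc 0)" by simp
      qed
      finally show ?case by simp
    qed
  qed
qed

section \<open>Excising discs around the poles\<close>

lemma jordan_domain_circlepath: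
  assumes "r > 0" shows "jordan_domain (circlepath l r) (ball l r)"
proof
  show "positively_oriented_boundary (circlepath l r) (ball l r)"
    unfolding positively_oriented_boundary_def
    using assms
    by (auto simp: piecewise_smooth_circlepath simple_path_circlepath frontier_ball
        winding_number_circlepath dist_norm norm_minus_commute)
qed auto

context jordan_domain
begin

text \<open>A domain with holes is avoided: \<open>G\<close> cuts off the poles inside the discs,
  and Green's formula is applied to the same C^1 function on \<Omega> and on each disc. The area
  integrals over the discs, which depend on \<open>G\<close>, are thereby replaced by circle
  integrals; outside the discs \<open>G\<close> is 1.\<close>

lemma green_excised:
  assumes \<psi>: "C1_closure \<Omega> \<psi> a b" and m: "m \<noteq> 0" and roots: "{z. poly m z = 0} \<subseteq> \<Omega>"
    and r: "r > 0" "\<And>l. poly m l = 0 \<Longrightarrow> cball l r \<subseteq> \<Omega>"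
    and sep: "\<And>l l'. poly m l = 0 \<Longrightarrow> poly m l' = 0 \<Longrightarrow> l \<noteq> l' \<Longrightarrow> 2 * r < dist l l'"
  shows "contour_integral \<gamma> (\<lambda>z. \<psi> z * (poly q z / poly m z)) =
     2 * \<i> * (LINT \<zeta>:\<Omega> - (\<Union>l\<in>{z. poly m z = 0}. ball l r)|lborel. b \<zeta> * (poly q \<zeta> / poly m \<zeta>)) +
     (\<Sum>l\<in>{z. poly m z = 0}. contour_integral (circlepath l r) (\<lambda>z. \<psi> z * (poly q z / poly m z)))"
proof -
  define \<sigma> where "\<sigma> = {z. poly m z = 0}"
  have fin: "finite \<sigma>" unfolding \<sigma>_def using m by (rule poly_roots_finite)
  define \<rho> where "\<rho> z = poly q z / poly m z" for z
  \<comment> \<open>Radius r/2, so that \<open>G\<close> is already 1 at distance 3/4 * r from all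
    poles and in particular on the circles.\<close>
  obtain G aG bG where G: "C1_wirtinger UNIV G aG bG"
    and G0: "\<And>p z. p \<in> \<sigma> \<Longrightarrow> z \<in> cball p (r / 2) \<Longrightarrow> G z = 0 \<and> aG z = 0 \<and> bG z = 0"
    and G1: "\<And>z. (\<And>p. p \<in> \<sigma> \<Longrightarrow> z \<notin> ball p (3/2 * (r / 2))) \<Longrightarrow> G z = 1 \<and> aG z = 0 \<and> bG z = 0"
  proof (rule cutoff_exists[OF fin, of "\<lambda>_. r / 2"])
    show "r / 2 > 0" using r(1) by simp
    fix G aG bG
    assume "C1_wirtinger UNIV G aG bG"
      "\<And>p z. p \<in> \<sigma> \<Longrightarrow> z \<in> cball p (r / 2) \<Longrightarrow> G z = 0 \<and> aG z = 0 \<and> bG z = 0"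
      "\<And>z. (\<And>p. p \<in> \<sigma> \<Longrightarrow> z \<notin> ball p (3/2 * (r / 2))) \<Longrightarrow> G z = 1 \<and> aG z = 0 \<and> bG z = 0"
    then show thesis by (rule that)
  qed
  define aT where "aT z = deriv \<rho> z * G z + \<rho> z * aG z" for z
  define bT where "bT z = 0 * G z + \<rho> z * bG z" for z
  have op: "open (- \<sigma>)" using fin by (simp add: finite_imp_closed open_Compl)
  have "\<rho> holomorphic_on - \<sigma>"
    unfolding \<rho>_def[abs_def] by (intro holomorphic_intros) (auto simp: \<sigma>_def)
  then have "C1_wirtinger (- \<sigma>) (\<lambda>z. \<rho> z * G z) aT bT"
    unfolding aT_def bT_def using op
    by (intro C1_wirtinger_mult C1_wirtinger_holomorphic C1_wirtinger_subset[OF G]) auto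
  moreover have "C1_wirtinger (\<Union>l\<in>\<sigma>. ball l (r / 2)) (\<lambda>z. \<rho> z * G z) aT bT"
    by (rule C1_wirtinger_cong[OF C1_wirtinger_const[of _ 0]]) (use G0 in \<open>auto simp: aT_def bT_def\<close>)
  ultimately have "C1_wirtinger (- \<sigma> \<union> (\<Union>l\<in>\<sigma>. ball l (r / 2))) (\<lambda>z. \<rho> z * G z) aT bT"
    using op by (intro C1_wirtinger_Un) auto
  moreover have "- \<sigma> \<union> (\<Union>l\<in>\<sigma>. ball l (r / 2)) = UNIV" using r(1) by auto
  ultimately have T: "C1_wirtinger UNIV (\<lambda>z. \<rho> z * G z) aT bT" by simp
  define F where "F z = \<psi> z * (\<rho> z * G z)" for z
  define aF where "aF z = a z * (\<rho> z * G z) + \<psi> z * aT z" for z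
  define bF where "bF z = b z * (\<rho> z * G z) + \<psi> z * bT z" for z
  have CF: "C1_closure \<Omega> F aF bF"
    unfolding F_def aF_def bF_def by (rule C1_closure_mult[OF \<psi> T])
  have far: "G z = 1 \<and> bG z = 0" if "\<And>l. l \<in> \<sigma> \<Longrightarrow> z \<notin> ball l r" for z
  proof -
    have "z \<notin> ball p (3/2 * (r / 2))" if "p \<in> \<sigma>" for p
      using \<open>\<And>l. l \<in> \<sigma> \<Longrightarrow> z \<notin> ball l r\<close>[OF that] r(1) by auto
    then show ?thesis using G1 by blast
  qed
  have disj: "disjoint_family_on (\<lambda>l. ball l r) \<sigma>"
    unfolding disjoint_family_on_def
  proof (intro ballI impI)
    fix l l' assume "l \<in> \<sigma>" "l' \<in> \<sigma>" "l \<noteq> l'"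
    then have "2 * r < dist l l'" using sep by (simp add: \<sigma>_def)
    then show "ball l r \<inter> ball l' r = {}"
      using dist_triangle2[of l l'] by (auto simp: dist_commute) (smt (verit) dist_commute dist_triangle)
  qed
  have U: "(\<Union>l\<in>\<sigma>. ball l r) \<subseteq> \<Omega>" using r(2) ball_subset_cball by (fastforce simp: \<sigma>_def)
  have path: "contour_integral \<gamma> F = contour_integral \<gamma> (\<lambda>z. \<psi> z * \<rho> z)"
  proof (rule contour_integral_eq)
    fix z assume "z \<in> path_image \<gamma>"
    then have "z \<notin> \<Omega>" using path_image disjoint_frontier by blast
    then have "G z = 1" using far U by blast
    then show "F z = \<psi> z * \<rho> z" by (simp add: F_def)
  qed
  have circ: "contour_integral (circlepath l r) (\<lambda>z. \<psi> z * \<rho> z) = 2 * \<i> * (LINT \<zeta>:ball l r|lborel. bF \<zeta>)" if l: "l \<in> \<sigma>" for l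
  proof -
    interpret B: jordan_domain "circlepath l r" "ball l r" by (rule jordan_domain_circlepath[OF r(1)])
    have sub: "closure (ball l r) \<subseteq> \<Omega>" using r l by (simp add: \<sigma>_def)
    have "C1_closure (ball l r) F aF bF"
      using CF sub closure_subset[of \<Omega>] closure_subset[of "ball l r"] C1_wirtinger_subset[of \<Omega> F aF bF "ball l r"]
      unfolding C1_closure_def by (meson continuous_on_subset subset_trans)
    then have "contour_integral (circlepath l r) F = 2 * \<i> * (LINT \<zeta>:ball l r|lborel. bF \<zeta>)"
      by (rule B.green_formula)
    moreover have "contour_integral (circlepath l r) F = contour_integral (circlepath l r) (\<lambda>z. \<psi> z * \<rho> z)"
    proof (rule contour_integral_eq)
      fix z assume "z \<in> path_image (circlepath l r)"
      then have z: "dist l z = r" using r(1) by simp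
      have "z \<notin> ball l' r" if "l' \<in> \<sigma>" for l'
      proof (cases "l' = l")
        case False
        then have "2 * r < dist l l'" using sep l that by (simp add: \<sigma>_def)
        moreover have "dist l l' \<le> dist l z + dist l' z" by (rule dist_triangle2)
        ultimately show ?thesis using z by simp
      qed (use z in simp)
      then have "G z = 1" using far by blast
      then show "F z = \<psi> z * \<rho> z" by (simp add: F_def)
    qed
    ultimately show ?thesis by simp
  qed
  have bint: "set_integrable lborel \<Omega> bF"
    using CF by (intro set_integrable_closure) (simp add: C1_closure_def)
  let ?U = "\<Union>l\<in>\<sigma>. ball l r"
  have "open ?U" by auto
  then have meas: "?U \<in> sets lborel" "\<Omega> - ?U \<in> sets lborel" using opn by simp_all
  have "(LINT \<zeta>:\<Omega>|lborel. bF \<zeta>) = (LINT \<zeta>:(\<Omega> - ?U) \<union> ?U|lborel. bF \<zeta>)"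
    using U by (simp add: Un_absorb2)
  also have "\<dots> = (LINT \<zeta>:\<Omega> - ?U|lborel. bF \<zeta>) + (LINT \<zeta>:?U|lborel. bF \<zeta>)"
    by (rule set_integral_Un[OF _ set_integrable_subset[OF bint meas(2)] set_integrable_subset[OF bint meas(1) U]]) auto
  also have "(LINT \<zeta>:?U|lborel. bF \<zeta>) = (\<Sum>l\<in>\<sigma>. LINT \<zeta>:ball l r|lborel. bF \<zeta>)"
  proof (rule set_integral_finite_Union[OF fin disj])
    fix l assume "l \<in> \<sigma>"
    then have "ball l r \<subseteq> \<Omega>" using U by blast
    then show "set_integrable lborel (ball l r) bF" by (intro set_integrable_subset[OF bint]) auto
  qed auto
  also have "(LINT \<zeta>:\<Omega> - ?U|lborel. bF \<zeta>) = (LINT \<zeta>:\<Omega> - ?U|lborel. b \<zeta> * \<rho> \<zeta>)"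
  proof (rule set_lebesgue_integral_cong[OF meas(2)], intro allI impI)
    fix z assume "z \<in> \<Omega> - ?U"
    then have "G z = 1 \<and> bG z = 0" using far by blast
    then show "bF z = b z * \<rho> z" by (simp add: bF_def bT_def)
  qed
  finally have "contour_integral \<gamma> (\<lambda>z. \<psi> z * \<rho> z) = 2 * \<i> * ((LINT \<zeta>:\<Omega> - ?U|lborel. b \<zeta> * \<rho> \<zeta>) + (\<Sum>l\<in>\<sigma>. LINT \<zeta>:ball l r|lborel. bF \<zeta>))"
    using green_formula[OF CF] path by simp
  also have "\<dots> = 2 * \<i> * (LINT \<zeta>:\<Omega> - ?U|lborel. b \<zeta> * \<rho> \<zeta>) + (\<Sum>l\<in>\<sigma>. contour_integral (circlepath l r) (\<lambda>z. \<psi> z * \<rho> z))"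
    by (simp add: distrib_left sum_distrib_left circ)
  finally show ?thesis unfolding \<rho>_def \<sigma>_def .
qed

text \<open>The area integral equals a fixed boundary integral minus the circle integrals as soon as
  the discs are disjoint and inside \<Omega>. Its convergence is therefore that of the circle
  integrals.\<close>

lemma green_excised_limit:
  assumes \<psi>: "C1_closure \<Omega> \<psi> a b" and m: "m \<noteq> 0" and roots: "{z. poly m z = 0} \<subseteq> \<Omega>"
    and lim: "\<And>l. poly m l = 0 \<Longrightarrow>
      ((\<lambda>r. contour_integral (circlepath l r) (\<lambda>z. \<psi> z * (poly q z / poly m z))) \<longlongrightarrow> 0) (at_right 0)"
  shows "((\<lambda>r. 2 * \<i> * (LINT \<zeta>:\<Omega> - (\<Union>l\<in>{z. poly m z = 0}. ball l r)|lborel. b \<zeta> * (poly q \<zeta> / poly m \<zeta>)))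
     \<longlongrightarrow> contour_integral \<gamma> (\<lambda>z. \<psi> z * (poly q z / poly m z))) (at_right 0)"
proof -
  let ?f = "\<lambda>z. \<psi> z * (poly q z / poly m z)"
  define \<sigma> where "\<sigma> = {z. poly m z = 0}"
  have fin: "finite \<sigma>" unfolding \<sigma>_def using m by (rule poly_roots_finite)
  define I where "I r = contour_integral \<gamma> ?f -
     (\<Sum>l\<in>\<sigma>. contour_integral (circlepath l r) ?f)" for r
  have "(I \<longlongrightarrow> contour_integral \<gamma> ?f - (\<Sum>l\<in>\<sigma>. 0)) (at_right 0)"
    unfolding I_def[abs_def] by (intro tendsto_diff tendsto_const tendsto_sum lim) (simp add: \<sigma>_def)
  then have L: "(I \<longlongrightarrow> contour_integral \<gamma> ?f) (at_right 0)" by simp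
  have small: "eventually (\<lambda>r. r < c) (at_right 0)" if "c > 0" for c :: real
    using eventually_at_right_real[OF that] by eventually_elim simp
  have e1: "eventually (\<lambda>r. \<forall>l\<in>\<sigma>. cball l r \<subseteq> \<Omega>) (at_right 0)"
  proof (rule eventually_ball_finite[OF fin], rule ballI)
    fix l assume "l \<in> \<sigma>"
    then obtain c where c: "c > 0" "cball l c \<subseteq> \<Omega>" using roots opn open_contains_cball by (metis \<sigma>_def subsetD)
    show "eventually (\<lambda>r. cball l r \<subseteq> \<Omega>) (at_right 0)"
      using small[OF c(1)] by eventually_elim (use c(2) subset_cball in \<open>meson less_imp_le subset_trans\<close>)
  qed
  have e2: "eventually (\<lambda>r. \<forall>l\<in>\<sigma>. \<forall>l'\<in>\<sigma>. l \<noteq> l' \<longrightarrow> 2 * r < dist l l') (at_right 0)"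
  proof (intro eventually_ball_finite[OF fin] ballI)
    fix l l'
    show "eventually (\<lambda>r. l \<noteq> l' \<longrightarrow> 2 * r < dist l l') (at_right 0)"
    proof (cases "l = l'")
      case False
      then have "dist l l' / 2 > 0" by simp
      from small[OF this] show ?thesis by eventually_elim simp
    qed simp
  qed
  have e0: "eventually (\<lambda>r::real. r > 0) (at_right 0)" by (rule eventually_at_right_less)
  from L show ?thesis
  proof (rule Lim_transform_eventually)
    show "eventually (\<lambda>r. I r = 2 * \<i> * (LINT \<zeta>:\<Omega> - (\<Union>l\<in>{z. poly m z = 0}. ball l r)|lborel. b \<zeta> * (poly q \<zeta> / poly m \<zeta>))) (at_right 0)"
      using e0 e1 e2
    proof eventually_elim
      case (elim r)
      from green_excised[OF \<psi> m roots, of r q] elim show ?case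
        unfolding I_def by (simp add: \<sigma>_def)
    qed
  qed
qed

section \<open>Contour integrals involving the resolvent\<close>

lemma contour_integrable_frontier:
  assumes "continuous_on (path_image \<gamma>) f"
  shows "f contour_integrable_on \<gamma>"
proof -
  obtain g where "path_density \<gamma> g" using piecewise_smooth_path_density[OF piecewise_smooth] .
  from path_density_contour_integral(2)[OF this path assms]
  show ?thesis by (auto simp: contour_integrable_on_def)
qed

text \<open>By the residue theorem the contour may be replaced by any large circle, since both wind
  once around every eigenvalue. There z R(z) = I + A R(z) for the resolvent R, and A R(z) tends to 0
  at infinity because the numerators have smaller degree than the minimal polynomial.\<close>

lemma resolvent_contour_integral:
  fixes A :: "complex^'n^'n"
  assumes eig: "eigenvalues A \<subseteq> \<Omega>"
  shows "contour_integral \<gamma> (\<lambda>z. resolvent A z $ i $ j) = 2 * of_real pi * \<i> * (mat 1 $ i $ j)"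
proof -
  let ?R = "\<lambda>i j z. resolvent A z $ i $ j"
  let ?m = "minimal_polynomial A" and ?\<sigma> = "eigenvalues A"
  obtain q where q: "\<And>z i j. z \<notin> ?\<sigma> \<Longrightarrow> resolvent A z $ i $ j = poly (q i j) z / poly ?m z"
    "\<And>i j. q i j = 0 \<or> degree (q i j) < degree ?m"
    "\<And>z. z \<notin> ?\<sigma> \<Longrightarrow> (mat z - A) ** resolvent A z = mat 1"
    by (rule resolvent_rational[of A]) blast
  have fin: "finite ?\<sigma>" by (rule finite_eigenvalues)
  have deg: "degree (q i j) < degree ?m" for i j
    using q(2)[of i j] degree_minimal_polynomial_pos[of A] by auto
  have nz: "poly ?m z \<noteq> 0" if "z \<notin> ?\<sigma>" for z using that by (simp add: eigenvalues_eq_roots)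
  have hol: "(?R i j) holomorphic_on (UNIV - ?\<sigma>)" for i j
  proof (rule holomorphic_transform)
    show "(\<lambda>z. poly (q i j) z / poly ?m z) holomorphic_on (UNIV - ?\<sigma>)"
      using nz by (intro holomorphic_intros) auto
  qed (use q(1) in auto)
  have res: "contour_integral g (?R i j) = 2 * pi * \<i> * (\<Sum>p\<in>?\<sigma>. residue (?R i j) p)"
    if "valid_path g" "pathfinish g = pathstart g" "path_image g \<inter> ?\<sigma> = {}" "\<And>p. p \<in> ?\<sigma> \<Longrightarrow> winding_number g p = 1" for g i j
  proof -
    have "contour_integral g (?R i j) = 2 * pi * \<i> * (\<Sum>p\<in>?\<sigma>. winding_number g p * residue (?R i j) p)"
      using that by (intro Residue_theorem[OF open_UNIV connected_UNIV fin hol]) auto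
    also have "(\<Sum>p\<in>?\<sigma>. winding_number g p * residue (?R i j) p) = (\<Sum>p\<in>?\<sigma>. residue (?R i j) p)"
      using that(4) by (intro sum.cong) auto
    finally show ?thesis .
  qed
  obtain s0 where s0: "?\<sigma> \<subseteq> ball 0 s0"
    using bounded_subset_ballD[OF finite_imp_bounded[OF fin], of 0] by blast
  have to_circle: "contour_integral \<gamma> (?R i j) = contour_integral (circlepath 0 s) (?R i j)"
    if s: "s > 0" "s \<ge> s0" for s i j
  proof -
    have "contour_integral \<gamma> (?R i j) = 2 * pi * \<i> * (\<Sum>p\<in>?\<sigma>. residue (?R i j) p)"
      using eig winding closed_path path_image disjoint_frontier piecewise_smooth_path_valid[OF piecewise_smooth]
      by (intro res) auto
    moreover have "contour_integral (circlepath 0 s) (?R i j) = 2 * pi * \<i> * (\<Sum>p\<in>?\<sigma>. residue (?R i j) p)"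
    proof (rule res)
      have "norm p < s" if "p \<in> ?\<sigma>" for p using that s0 s by auto
      note np = this
      show "path_image (circlepath 0 s) \<inter> ?\<sigma> = {}"
      proof (rule equals0I)
        fix x assume "x \<in> path_image (circlepath 0 s) \<inter> ?\<sigma>"
        then have "norm x = s" "norm x < s" using s np[of x] by auto
        then show False by simp
      qed
      show "winding_number (circlepath 0 s) p = 1" if "p \<in> ?\<sigma>" for p
        using np[OF that] by (simp add: winding_number_circlepath)
    qed auto
    ultimately show ?thesis by simp
  qed
  define h where "h z = (\<Sum>k\<in>UNIV. A $ i $ k * (poly (q k j) z / poly ?m z))" for z
  have "(h \<longlongrightarrow> (\<Sum>k\<in>UNIV. A $ i $ k * 0)) at_infinity"
    unfolding h_def[abs_def] by (intro tendsto_intros poly_divide_tendsto_0_at_infinity deg)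
  then have h0: "(h \<longlongrightarrow> 0) at_infinity" by simp
  have entry: "z * (resolvent A z $ i $ j) = mat 1 $ i $ j + h z" if z: "z \<notin> ?\<sigma>" for z
  proof -
    have "(mat z ** resolvent A z) $ i $ j - (A ** resolvent A z) $ i $ j = mat 1 $ i $ j"
      using q(3)[OF z] by (simp add: matrix_diff_rdistrib vec_eq_iff)
    moreover have "(A ** resolvent A z) $ i $ j = h z"
      by (simp add: matrix_matrix_mult_def h_def q(1)[OF z])
    ultimately show ?thesis by (simp add: mat_mult_entry algebra_simps)
  qed
  \<comment> \<open>On a circle of large radius s the entry differs from its main term by at most
    e/s, and the length 2 pi s cancels the s.\<close>
  have bound: "norm (contour_integral \<gamma> (?R i j) - 2 * of_real pi * \<i> * (mat 1 $ i $ j)) \<le> e * (2 * pi)" if e: "e > 0" for e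
  proof -
    obtain B where B: "\<And>z. norm z \<ge> B \<Longrightarrow> norm (h z) < e"
      using tendstoD[OF h0 e] unfolding eventually_at_infinity by auto
    define s where "s = max 1 (max s0 B)"
    have s: "s > 0" "s \<ge> s0" "s \<ge> B" by (auto simp: s_def)
    have out: "z \<notin> ?\<sigma>" "z \<noteq> 0" if "norm z = s" for z using that s s0 by auto
    have c1: "(?R i j) contour_integrable_on (circlepath 0 s)"
    proof (intro contour_integrable_continuous_circlepath continuous_on_subset[OF holomorphic_on_imp_continuous_on[OF hol]])
      show "path_image (circlepath 0 s) \<subseteq> UNIV - ?\<sigma>" using s(1) out by auto
    qed
    have c2: "(\<lambda>z. mat 1 $ i $ j * (1 / (z - 0))) contour_integrable_on (circlepath 0 s)"
      using s by (intro contour_integrable_continuous_circlepath continuous_intros) auto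
    have "contour_integral (circlepath 0 s) (\<lambda>z. mat 1 $ i $ j * (1 / (z - 0))) = mat 1 $ i $ j * (2 * of_real pi * \<i>)"
    proof (subst contour_integral_lmul)
      show "(\<lambda>z. 1 / (z - 0)) contour_integrable_on circlepath 0 s"
        using s by (intro contour_integrable_continuous_circlepath continuous_intros) auto
      show "mat 1 $ i $ j * contour_integral (circlepath 0 s) (\<lambda>z. 1 / (z - 0)) = mat 1 $ i $ j * (2 * of_real pi * \<i>)"
        by (simp only: contour_integral_circlepath[OF s(1)])
    qed
    then have "((\<lambda>z. resolvent A z $ i $ j - mat 1 $ i $ j * (1 / (z - 0))) has_contour_integral
       (contour_integral \<gamma> (?R i j) - 2 * of_real pi * \<i> * (mat 1 $ i $ j))) (circlepath 0 s)"
      using has_contour_integral_diff[OF has_contour_integral_integral[OF c1] has_contour_integral_integral[OF c2]]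
        to_circle[OF s(1,2), of i j] by (simp add: mult.commute)
    then have "norm (contour_integral \<gamma> (?R i j) - 2 * of_real pi * \<i> * (mat 1 $ i $ j)) \<le> (e / s) * (2 * pi * s)"
    proof (rule has_contour_integral_bound_circlepath)
      fix z :: complex assume "norm (z - 0) = s"
      then have z: "norm z = s" by simp
      have "resolvent A z $ i $ j - mat 1 $ i $ j * (1 / (z - 0)) = h z / z"
        using entry[OF out(1)[OF z]] out(2)[OF z] by (simp add: field_simps)
      then show "norm (resolvent A z $ i $ j - mat 1 $ i $ j * (1 / (z - 0))) \<le> e / s"
        using B[of z] z s by (simp add: norm_divide divide_right_mono less_imp_le)
    qed (use e s in auto)
    then show ?thesis using s by simp
  qed
  have "norm (contour_integral \<gamma> (?R i j) - 2 * of_real pi * \<i> * (mat 1 $ i $ j)) \<le> 0"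
  proof (rule field_le_epsilon)
    fix e :: real assume "e > 0"
    then show "norm (contour_integral \<gamma> (?R i j) - 2 * of_real pi * \<i> * (mat 1 $ i $ j)) \<le> 0 + e"
      using bound[of "e / (2 * pi)"] by simp
  qed
  then show ?thesis by simp
qed

text \<open>By \<open>poly_matrix_remainder\<close>, p(z) R(z) = p(A) R(z) + Q(z) for the resolvent
  R, and the polynomial entries of Q integrate to 0 over a closed path.\<close>

lemma poly_resolvent_contour_integral:
  fixes A :: "complex^'n^'n"
  assumes eig: "eigenvalues A \<subseteq> \<Omega>"
  shows "contour_integral \<gamma> (\<lambda>z. poly p z * resolvent A z $ i $ j) = 2 * of_real pi * \<i> * (poly_matrix p A $ i $ j)"
proof -
  obtain Q where Q: "\<And>z. mat (poly p z) - poly_matrix p A = (\<chi> i j. poly (Q i j) z) ** (mat z - A)"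
    by (rule poly_matrix_remainder[of p A]) blast
  obtain q where q: "\<And>z i j. z \<notin> eigenvalues A \<Longrightarrow> resolvent A z $ i $ j = poly (q i j) z / poly (minimal_polynomial A) z"
    "\<And>z. z \<notin> eigenvalues A \<Longrightarrow> (mat z - A) ** resolvent A z = mat 1"
    by (rule resolvent_rational[of A]) blast
  have out: "z \<notin> eigenvalues A" if "z \<in> path_image \<gamma>" for z
    using that eig path_image disjoint_frontier by blast
  have cR: "continuous_on (path_image \<gamma>) (\<lambda>z. resolvent A z $ k $ j)" for k
  proof (rule continuous_on_eq)
    show "continuous_on (path_image \<gamma>) (\<lambda>z. poly (q k j) z / poly (minimal_polynomial A) z)"
      using out by (intro continuous_intros) (auto simp: eigenvalues_eq_roots)
  qed (use q(1) out in auto)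
  have "contour_integral \<gamma> (\<lambda>z. poly p z * resolvent A z $ i $ j) =
     contour_integral \<gamma> (\<lambda>z. (\<Sum>k\<in>UNIV. poly_matrix p A $ i $ k * resolvent A z $ k $ j) + poly (Q i j) z)"
  proof (rule contour_integral_eq)
    fix z assume z: "z \<in> path_image \<gamma>"
    have "(mat (poly p z) - poly_matrix p A) ** resolvent A z = (\<chi> i j. poly (Q i j) z)"
      unfolding Q matrix_mul_assoc[symmetric] q(2)[OF out[OF z]] by simp
    then have "(mat (poly p z) ** resolvent A z) $ i $ j - (poly_matrix p A ** resolvent A z) $ i $ j = poly (Q i j) z"
      by (simp add: matrix_diff_rdistrib vec_eq_iff)
    then show "poly p z * resolvent A z $ i $ j = (\<Sum>k\<in>UNIV. poly_matrix p A $ i $ k * resolvent A z $ k $ j) + poly (Q i j) z"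
      by (simp add: mat_mult_entry) (simp add: matrix_matrix_mult_def algebra_simps)
  qed
  also have "\<dots> = contour_integral \<gamma> (\<lambda>z. \<Sum>k\<in>UNIV. poly_matrix p A $ i $ k * resolvent A z $ k $ j) + contour_integral \<gamma> (poly (Q i j))"
    by (rule contour_integral_add; rule contour_integrable_frontier; intro continuous_intros cR)
  also have "contour_integral \<gamma> (poly (Q i j)) = 0"
    by (rule contour_integral_unique, rule Cauchy_theorem_convex_simple[of _ UNIV])
      (use piecewise_smooth_path_valid[OF piecewise_smooth] closed_path in \<open>auto intro!: holomorphic_intros\<close>)
  also have "contour_integral \<gamma> (\<lambda>z. \<Sum>k\<in>UNIV. poly_matrix p A $ i $ k * resolvent A z $ k $ j) =
     (\<Sum>k\<in>UNIV. contour_integral \<gamma> (\<lambda>z. poly_matrix p A $ i $ k * resolvent A z $ k $ j))"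
    by (intro contour_integral_sum contour_integrable_lmul contour_integrable_frontier cR) auto
  also have "\<dots> = (\<Sum>k\<in>UNIV. poly_matrix p A $ i $ k * (2 * of_real pi * \<i> * (mat 1 $ k $ j)))"
    by (simp only: contour_integral_lmul[OF contour_integrable_frontier[OF cR]] resolvent_contour_integral[OF eig])
  also have "\<dots> = 2 * of_real pi * \<i> * ((poly_matrix p A ** mat 1) $ i $ j)"
    by (simp add: matrix_matrix_mult_def sum_distrib_left mult_ac)
  finally show ?thesis by simp
qed

end

text \<open>Integral operators are total and return default values for functions that are not
  integrable, so integrability and the existence of the limit are made part of the claim.\<close>

theorem proposition3p3:
  fixes A :: "complex ^ 'n ^ 'n"
    and \<Omega> :: "complex set"
    and \<gamma> :: "real \<Rightarrow> complex"
    and \<phi> :: "complex \<Rightarrow> complex"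
  assumes "CARD('n) \<ge> 2"
    and "bounded \<Omega>" and "open \<Omega>" and "simply_connected \<Omega>"
    and "positively_oriented_boundary \<gamma> \<Omega>"
    and "eigenvalues A \<subseteq> \<Omega>"
    and "C_closure (CARD('n) - 1) \<Omega> \<phi>"
  shows "matrix_contour_integrable \<gamma> (\<lambda>\<zeta>. \<phi> \<zeta> *\<^sub>c resolvent A \<zeta>) \<and>
    (\<forall>r>0. set_integrable lborel (\<Omega> - (\<Union>l\<in>eigenvalues A. ball l r))
      (\<lambda>\<zeta>. wirtinger_bar \<phi> \<zeta> *\<^sub>c resolvent A \<zeta>)) \<and>
    (\<exists>L. ((\<lambda>r. wedge_integral (\<Omega> - (\<Union>l\<in>eigenvalues A. ball l r))
            (\<lambda>\<zeta>. wirtinger_bar \<phi> \<zeta> *\<^sub>c resolvent A \<zeta>)) \<longlongrightarrow> L) (at_right 0) \<and>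
      matrix_function \<phi> A =
        (1 / (2 * pi * \<i>)) *\<^sub>c matrix_contour_integral \<gamma> (\<lambda>\<zeta>. \<phi> \<zeta> *\<^sub>c resolvent A \<zeta>)
        + (1 / (2 * pi * \<i>)) *\<^sub>c L)"
proof -
  let ?S = "\<lambda>r. \<Omega> - (\<Union>l\<in>eigenvalues A. ball l r)" and ?W = "\<lambda>\<zeta>. wirtinger_bar \<phi> \<zeta> *\<^sub>c resolvent A \<zeta>"
  interpret jordan_domain \<gamma> \<Omega> by (unfold_locales) fact+
  note eig = assms(6)
  let ?m = "minimal_polynomial A" and ?\<sigma> = "eigenvalues A"
  define p where "p = hermite_interpolant \<phi> A"
  \<comment> \<open>As n is at least 2, the class n - 1 is a successor and \<phi> has first
    derivatives to which Green's formula applies.\<close>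
  obtain k where k: "CARD('n) - 1 = Suc k" using not0_implies_Suc[of "CARD('n) - 1"] assms(1) by auto
  obtain a b where ab: "C1_closure \<Omega> \<phi> a b" "\<And>z. z \<in> \<Omega> \<Longrightarrow> b z = wirtinger_bar \<phi> z"
  proof (rule C_closure_Suc[OF opn assms(7)[unfolded k]])
    fix a b assume "C1_closure \<Omega> \<phi> a b" "\<And>z. z \<in> \<Omega> \<Longrightarrow> b z = wirtinger_bar \<phi> z"
    then show thesis by (rule that)
  qed
  have c\<phi>: "continuous_on (closure \<Omega>) \<phi>" and cb: "continuous_on (closure \<Omega>) b"
    using ab(1) by (simp_all add: C1_closure_def)
  obtain q where q: "\<And>z i j. z \<notin> ?\<sigma> \<Longrightarrow> resolvent A z $ i $ j = poly (q i j) z / poly ?m z"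
    by (rule resolvent_rational[of A]) blast
  have \<sigma>: "?\<sigma> = {z. poly ?m z = 0}" by (auto simp: eigenvalues_eq_roots)
  have out: "z \<notin> ?\<sigma>" if "z \<in> path_image \<gamma>" for z
    using that eig path_image disjoint_frontier by blast
  have cR: "continuous_on (path_image \<gamma>) (\<lambda>z. resolvent A z $ i $ j)" for i j
  proof (rule continuous_on_eq)
    show "continuous_on (path_image \<gamma>) (\<lambda>z. poly (q i j) z / poly ?m z)"
      using out by (intro continuous_intros) (auto simp: eigenvalues_eq_roots)
  qed (use q out in auto)
  have c\<phi>': "continuous_on (path_image \<gamma>) \<phi>" by (rule continuous_on_subset[OF c\<phi> path_image_closure])
  have int\<phi>: "(\<lambda>z. \<phi> z * resolvent A z $ i $ j) contour_integrable_on \<gamma>" for i j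
    by (intro contour_integrable_frontier continuous_intros c\<phi>' cR)
  have intp: "(\<lambda>z. poly p z * resolvent A z $ i $ j) contour_integrable_on \<gamma>" for i j
    by (intro contour_integrable_frontier continuous_intros cR)
  have 1: "matrix_contour_integrable \<gamma> (\<lambda>\<zeta>. \<phi> \<zeta> *\<^sub>c resolvent A \<zeta>)"
    using int\<phi> by (simp add: matrix_contour_integrable_def cscale_def)
  have 2: "set_integrable lborel (?S r) ?W"
    if r: "r > 0" for r
  proof -
    \<comment> \<open>A compact set on which the entries are continuous; \<open>b\<close> stands in
      for \<open>wirtinger_bar \<phi>\<close> because it is continuous up to the boundary.\<close>
    define K where "K = closure \<Omega> - (\<Union>l\<in>?\<sigma>. ball l r)"
    have K: "compact K" unfolding K_def by (intro compact_diff compact_closure) auto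
    have Ks: "z \<notin> ?\<sigma>" if "z \<in> K" for z using that r by (auto simp: K_def)
    have "continuous_on K (\<lambda>z. \<chi> i j. b z * (poly (q i j) z / poly ?m z))"
      using Ks by (intro continuous_intros continuous_on_subset[OF cb]) (auto simp: K_def eigenvalues_eq_roots)
    then have "set_integrable lborel K (\<lambda>z. \<chi> i j. b z * (poly (q i j) z / poly ?m z))"
      unfolding set_integrable_def by (rule borel_integrable_compact[OF K])
    then have "set_integrable lborel (?S r) (\<lambda>z. \<chi> i j. b z * (poly (q i j) z / poly ?m z))"
    proof (rule set_integrable_subset)
      have "open (\<Union>l\<in>?\<sigma>. ball l r)" by auto
      then show "?S r \<in> sets lborel" using opn by simp
      show "?S r \<subseteq> K"
        using closure_subset[of \<Omega>] unfolding K_def by (rule Diff_mono) simp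
    qed
    then show ?thesis
    proof (rule set_integrable_cong[OF refl refl, THEN iffD1, rotated])
      fix z assume that: "z \<in> ?S r"
      show "(\<chi> i j. b z * (poly (q i j) z / poly ?m z)) = wirtinger_bar \<phi> z *\<^sub>c resolvent A z"
      proof -
        have "z \<notin> ?\<sigma>" using that r by auto
        then show ?thesis using that ab(2)[of z] by (simp add: cscale_def vec_eq_iff q)
      qed
    qed
  qed
  define \<psi> where "\<psi> z = \<phi> z - poly p z" for z
  have C\<psi>: "C1_closure \<Omega> \<psi> (\<lambda>z. a z - poly (pderiv p) z) b"
  proof -
    have "C1_wirtinger \<Omega> (poly p) (poly (pderiv p)) (\<lambda>_. 0)"
      by (rule C1_wirtinger_cong[OF C1_wirtinger_holomorphic[of "poly p" \<Omega>] opn])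
        (auto simp: opn poly_DERIV DERIV_imp_deriv intro!: holomorphic_intros)
    moreover have "C1_wirtinger \<Omega> \<phi> a b" using ab(1) by (simp add: C1_closure_def)
    ultimately have "C1_wirtinger \<Omega> \<psi> (\<lambda>z. a z - poly (pderiv p) z) (\<lambda>z. b z - 0)"
      unfolding \<psi>_def[abs_def] by (rule C1_wirtinger_diff[rotated])
    then show ?thesis
      using ab(1) unfolding C1_closure_def \<psi>_def by (auto intro!: continuous_intros)
  qed
  have herm: "poly ((pderiv ^^ \<nu>) p) l = (wirtinger ^^ \<nu>) \<phi> l" if "poly ?m l = 0" "\<nu> < order l ?m" for l \<nu>
    using hermite_interpolant_props[of A \<phi>] that by (simp add: hermite_conditions_def p_def)
  \<comment> \<open>The order is at most n = k + 2, which matches the class k + 1 of \<phi>.\<close>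
  have ord: "order l ?m \<le> Suc (Suc k)" for l
    using order_minimal_polynomial_le[of l A] k by linarith
  have lim: "((\<lambda>r. contour_integral (circlepath l r) (\<lambda>z. \<psi> z * (poly (q i j) z / poly ?m z))) \<longlongrightarrow> 0) (at_right 0)"
    if "poly ?m l = 0" for l i j
    unfolding \<psi>_def
    by (rule circle_limit_rational[OF opn _ assms(7)[unfolded k] minimal_polynomial_nonzero ord herm[OF that]])
      (use that eig \<sigma> in auto)
  have "{z. poly ?m z = 0} \<subseteq> \<Omega>" using eig \<sigma> by simp
  note G = green_excised_limit[OF C\<psi> minimal_polynomial_nonzero this lim]
  \<comment> \<open>The sign arises because the two-form is -2i times area while Green's formula has
    2i. Since \<psi> is \<phi> - p, this is the contour integral of p minus that of \<phi>, both
    against the resolvent.\<close>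
  define L where "L = (\<chi> i j. - contour_integral \<gamma> (\<lambda>z. \<psi> z * (poly (q i j) z / poly ?m z)))"
  have entry: "wedge_integral (?S r) ?W $ i $ j =
     - (2 * \<i> * (LINT \<zeta>:\<Omega> - (\<Union>l\<in>{z. poly ?m z = 0}. ball l r)|lborel. b \<zeta> * (poly (q i j) \<zeta> / poly ?m \<zeta>)))"
    if r: "r > 0" for r i j
  proof -
    have bl: "bounded_linear (\<lambda>M :: complex^'n^'n. M $ i $ j)"
      by (rule bounded_linear_compose[OF bounded_linear_vec_nth bounded_linear_vec_nth])
    have "(LINT \<zeta>:?S r|lborel. wirtinger_bar \<phi> \<zeta> *\<^sub>c resolvent A \<zeta>) $ i $ j =
        (LINT \<zeta>|lborel. (indicator (?S r) \<zeta> *\<^sub>R (wirtinger_bar \<phi> \<zeta> *\<^sub>c resolvent A \<zeta>)) $ i $ j)"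
      unfolding set_lebesgue_integral_def
      by (rule integral_bounded_linear[OF bl 2[OF r, unfolded set_integrable_def], symmetric])
    also have "\<dots> = (LINT \<zeta>:?S r|lborel. wirtinger_bar \<phi> \<zeta> * resolvent A \<zeta> $ i $ j)"
      by (simp add: set_lebesgue_integral_def cscale_def)
    also have "\<dots> = (LINT \<zeta>:?S r|lborel. b \<zeta> * (poly (q i j) \<zeta> / poly ?m \<zeta>))"
    proof (rule set_lebesgue_integral_cong)
      have "open (\<Union>l\<in>?\<sigma>. ball l r)" by auto
      then show "?S r \<in> sets lborel" using opn by simp
      show "\<forall>z. z \<in> ?S r \<longrightarrow> wirtinger_bar \<phi> z * resolvent A z $ i $ j = b z * (poly (q i j) z / poly ?m z)"
      proof (intro allI impI)
        fix z assume z: "z \<in> ?S r"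
        then have "z \<notin> ?\<sigma>" using r by auto
        then show "wirtinger_bar \<phi> z * resolvent A z $ i $ j = b z * (poly (q i j) z / poly ?m z)"
          using z ab(2)[of z] by (simp add: q)
      qed
    qed
    finally show ?thesis by (simp add: wedge_integral_def cscale_def \<sigma>)
  qed
  have 3: "((\<lambda>r. wedge_integral (?S r) ?W) \<longlongrightarrow> L) (at_right 0)"
  proof (intro vec_tendstoI)
    fix i j
    have "((\<lambda>r. - (2 * \<i> * (LINT \<zeta>:\<Omega> - (\<Union>l\<in>{z. poly ?m z = 0}. ball l r)|lborel. b \<zeta> * (poly (q i j) \<zeta> / poly ?m \<zeta>))))
       \<longlongrightarrow> L $ i $ j) (at_right 0)"
      unfolding L_def vec_lambda_beta by (intro tendsto_minus G)
    then show "((\<lambda>r. wedge_integral (?S r) ?W $ i $ j) \<longlongrightarrow> L $ i $ j) (at_right 0)"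
    proof (rule Lim_transform_eventually)
      have "eventually (\<lambda>r::real. r > 0) (at_right 0)" by (rule eventually_at_right_less)
      then show "eventually (\<lambda>r. - (2 * \<i> * (LINT \<zeta>:\<Omega> - (\<Union>l\<in>{z. poly ?m z = 0}. ball l r)|lborel. b \<zeta> * (poly (q i j) \<zeta> / poly ?m \<zeta>))) =
        wedge_integral (?S r) ?W $ i $ j) (at_right 0)"
        by eventually_elim (simp only: entry)
    qed
  qed
  have 4: "matrix_function \<phi> A = (1 / (2 * pi * \<i>)) *\<^sub>c matrix_contour_integral \<gamma> (\<lambda>\<zeta>. \<phi> \<zeta> *\<^sub>c resolvent A \<zeta>)
        + (1 / (2 * pi * \<i>)) *\<^sub>c L"
  proof -
    have "L $ i $ j = contour_integral \<gamma> (\<lambda>z. poly p z * resolvent A z $ i $ j) - contour_integral \<gamma> (\<lambda>z. \<phi> z * resolvent A z $ i $ j)" for i j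
    proof -
      have "contour_integral \<gamma> (\<lambda>z. \<psi> z * (poly (q i j) z / poly ?m z)) =
         contour_integral \<gamma> (\<lambda>z. \<phi> z * resolvent A z $ i $ j - poly p z * resolvent A z $ i $ j)"
        by (rule contour_integral_eq) (simp add: q out \<psi>_def left_diff_distrib diff_divide_distrib)
      then show ?thesis by (simp add: L_def contour_integral_diff[OF int\<phi> intp])
    qed
    then show ?thesis
      by (simp add: vec_eq_iff matrix_function_def p_def[symmetric] cscale_def matrix_contour_integral_def
          poly_resolvent_contour_integral[OF eig] field_simps)
  qed
  show ?thesis using 1 2 3 4 by blast
qed

end
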